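(* Let $p\ge1$ and assume \[ \beta_1^2>2(\beta_0-\lambda_1). \] Then for every $y_0\in L^p_{\mathcal F_0}(\Omega;H)$ there exists a finite random variable $\xi$ such that the solution $y$ of \[ dy(t)+Ay(t)\,dt=\beta_0 y(t)\,dt+\beta_1 y(t)\,dW(t),\quad t>0,\qquad y(0)=y_0, \] satisfies \[ \|y(t)\|_H^p\le\xi\,e^{-\frac{\mu_{as}}{2}t}\quad\text{for all }t\ge0,\ \text{a.s.},\qquad \mu_{as}:=\frac p2\beta_1^2+p(\lambda_1-\beta_0)>0. \]
   Context: $(\Omega,\mathcal F,\{\mathcal F_t\}_{t\ge0},\mathbb P)$ is a complete filtered probability space whose filtration is the natural (augmented) filtration of a one-dimensional standard Brownian motion $W$. $H$ is a Hilbert space. $A:\mathcal D(A)\subset H\to H$ is linear, self-adjoint, positive-definite, with compact resolvent. Its eigenvalues are $0<\lambda_1\le\lambda_2\le\cdots\to\infty$, with an orthonormal eigenbasis of $H$. The principal eigenvalue is $\lambda_1=\inf_{\varphi\in\mathcal D(A)\setminus\{0\}}\langle A\varphi,\varphi\rangle_H/\|\varphi\|_H^2$. $\beta_0,\beta_1\in\mathbb R$. $L^p_{\mathcal F_0}(\Omega;H)$ is the space of $\mathcal F_0$-measurable $H$-valued random variables with finite $p$-th moment. The solution is the unique adapted continuous $H$-valued mild solution \[ y(t)=T(t)y_0+\int_0^tT(t-s)\beta_0y(s)\,ds+\int_0^tT(t-s)\beta_1y(s)\,dW(s), \] where $(T(t))$ is the semigroup generated by $-A$. The paper assumes throughout that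 $y_0\neq0$ a.s. *)

theory Defs
  imports "HOL-Probability.Probability"
begin

definition std_brownian_motion :: "'w measure \<Rightarrow> (real \<Rightarrow> 'w \<Rightarrow> real) \<Rightarrow> bool" where
  "std_brownian_motion M W \<longleftrightarrow>
     (\<forall>t\<ge>0. W t \<in> borel_measurable M) \<and>
     (AE \<omega> in M. W 0 \<omega> = 0 \<and> continuous_on {0..} (\<lambda>t. W t \<omega>)) \<and>
     (\<forall>s t. 0 \<le> s \<longrightarrow> s < t \<longrightarrow>
        distributed M lborel (\<lambda>\<omega>. W t \<omega> - W s \<omega>)
          (\<lambda>x. ennreal (normal_density 0 (sqrt (t - s)) x))) \<and>
     (\<forall>(tp :: nat \<Rightarrow> real) n. 0 \<le> tp 0 \<longrightarrow> (\<forall>i<n. tp i < tp (Suc i)) \<longrightarrow>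
        prob_space.indep_vars M (\<lambda>_. borel) (\<lambda>i \<omega>. W (tp (Suc i)) \<omega> - W (tp i) \<omega>) {..<n})"

definition nat_filt :: "'w measure \<Rightarrow> (real \<Rightarrow> 'w \<Rightarrow> real) \<Rightarrow> real \<Rightarrow> 'w measure" where
  "nat_filt M W t = sigma (space M)
     ({W s -` B \<inter> space M | s B. 0 \<le> s \<and> s \<le> t \<and> B \<in> sets borel}
      \<union> {N \<in> sets M. emeasure M N = 0})"

definition tendsto_zero_in_prob :: "'w measure \<Rightarrow> (nat \<Rightarrow> 'w \<Rightarrow> ennreal) \<Rightarrow> bool" where
  "tendsto_zero_in_prob M D \<longleftrightarrow>
     (\<forall>\<epsilon>>0. \<forall>\<delta>>0. \<exists>N. \<forall>n\<ge>N. \<exists>A\<in>sets M.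
        {\<omega>\<in>space M. D n \<omega> > ennreal \<epsilon>} \<subseteq> A \<and> measure M A < \<delta>)"

definition simple_ito ::
  "'w measure \<Rightarrow> (real \<Rightarrow> 'w \<Rightarrow> real) \<Rightarrow> real \<Rightarrow> real \<Rightarrow>
   (real \<Rightarrow> 'w \<Rightarrow> 'h::{banach,second_countable_topology}) \<Rightarrow> ('w \<Rightarrow> 'h) \<Rightarrow> bool" where
  "simple_ito M W a b g I \<longleftrightarrow>
     (\<exists>n (tp :: nat \<Rightarrow> real) (\<xi> :: nat \<Rightarrow> 'w \<Rightarrow> 'h).
        tp 0 = a \<and> tp n = b \<and> (\<forall>i<n. tp i < tp (Suc i)) \<and>
        (\<forall>i<n. \<xi> i \<in> borel_measurable (nat_filt M W (tp i))) \<and>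
        (\<forall>s \<omega>. g s \<omega> = (\<Sum>i<n. indicator {tp i<..tp (Suc i)} s *\<^sub>R \<xi> i \<omega>)) \<and>
        (\<forall>\<omega>. I \<omega> = (\<Sum>i<n. (W (tp (Suc i)) \<omega> - W (tp i) \<omega>) *\<^sub>R \<xi> i \<omega>)))"

definition is_ito_integral ::
  "'w measure \<Rightarrow> (real \<Rightarrow> 'w \<Rightarrow> real) \<Rightarrow> real \<Rightarrow> real \<Rightarrow>
   (real \<Rightarrow> 'w \<Rightarrow> 'h::{banach,second_countable_topology}) \<Rightarrow> ('w \<Rightarrow> 'h) \<Rightarrow> bool" where
  "is_ito_integral M W a b f X \<longleftrightarrow>
     X \<in> borel_measurable M \<and>
     (\<exists>g I. (\<forall>n. simple_ito M W a b (g n) (I n)) \<and>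
        tendsto_zero_in_prob M
          (\<lambda>n \<omega>. set_nn_integral lborel {a..b} (\<lambda>s. ennreal ((norm (g n s \<omega> - f s \<omega>))\<^sup>2))) \<and>
        tendsto_zero_in_prob M (\<lambda>n \<omega>. ennreal (norm (I n \<omega> - X \<omega>))))"

definition self_adjoint_op :: "'h::real_inner set \<Rightarrow> ('h \<Rightarrow> 'h) \<Rightarrow> bool" where
  "self_adjoint_op D A \<longleftrightarrow>
     subspace D \<and> closure D = UNIV \<and>
     (\<forall>x\<in>D. \<forall>y\<in>D. \<forall>c. A (x + y) = A x + A y \<and> A (c *\<^sub>R x) = c *\<^sub>R A x) \<and>
     (\<forall>x\<in>D. \<forall>y\<in>D. inner (A x) y = inner x (A y)) \<and>
     (\<forall>y z. (\<forall>x\<in>D. inner (A x) y = inner x z) \<longrightarrow> y \<in> D \<and> A y = z)"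

definition positive_definite_op :: "'h::real_inner set \<Rightarrow> ('h \<Rightarrow> 'h) \<Rightarrow> bool" where
  "positive_definite_op D A \<longleftrightarrow> (\<forall>x\<in>D. x \<noteq> 0 \<longrightarrow> inner (A x) x > 0)"

definition compact_resolvent :: "'h::real_normed_vector set \<Rightarrow> ('h \<Rightarrow> 'h) \<Rightarrow> bool" where
  "compact_resolvent D A \<longleftrightarrow>
     (\<exists>\<mu> R. bounded_linear R \<and>
        (\<forall>x. R x \<in> D \<and> \<mu> *\<^sub>R R x - A (R x) = x) \<and>
        (\<forall>x\<in>D. R (\<mu> *\<^sub>R x - A x) = x) \<and>
        compact (closure (R ` ball 0 1)))"

definition principal_eigenvalue :: "'h::real_inner set \<Rightarrow> ('h \<Rightarrow> 'h) \<Rightarrow> real" where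
  "principal_eigenvalue D A = Inf {inner (A \<phi>) \<phi> / (norm \<phi>)\<^sup>2 | \<phi>. \<phi> \<in> D \<and> \<phi> \<noteq> 0}"

definition generates_C0_semigroup ::
  "(real \<Rightarrow> 'h::real_normed_vector \<Rightarrow> 'h) \<Rightarrow> 'h set \<Rightarrow> ('h \<Rightarrow> 'h) \<Rightarrow> bool" where
  "generates_C0_semigroup T D G \<longleftrightarrow>
     (\<forall>t\<ge>0. bounded_linear (T t)) \<and> (\<forall>x. T 0 x = x) \<and>
     (\<forall>s\<ge>0. \<forall>t\<ge>0. \<forall>x. T (s + t) x = T s (T t x)) \<and>
     (\<forall>x. ((\<lambda>t. T t x) \<longlongrightarrow> x) (at_right 0)) \<and>
     (\<forall>x. x \<in> D \<longleftrightarrow> (\<exists>z. ((\<lambda>h. (1 / h) *\<^sub>R (T h x - x)) \<longlongrightarrow> z) (at_right 0))) \<and>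
     (\<forall>x\<in>D. ((\<lambda>h. (1 / h) *\<^sub>R (T h x - x)) \<longlongrightarrow> G x) (at_right 0))"

definition mild_solution ::
  "'w measure \<Rightarrow> (real \<Rightarrow> 'w \<Rightarrow> real) \<Rightarrow> (real \<Rightarrow> 'h::{real_inner,banach,second_countable_topology} \<Rightarrow> 'h)
   \<Rightarrow> real \<Rightarrow> real \<Rightarrow> ('w \<Rightarrow> 'h) \<Rightarrow> (real \<Rightarrow> 'w \<Rightarrow> 'h) \<Rightarrow> bool" where
  "mild_solution M W T \<beta>0 \<beta>1 y0 y \<longleftrightarrow>
     (\<forall>t\<ge>0. y t \<in> borel_measurable (nat_filt M W t)) \<and>
     (AE \<omega> in M. continuous_on {0..} (\<lambda>t. y t \<omega>)) \<and>
     (\<forall>t\<ge>0. \<exists>X. is_ito_integral M W 0 t (\<lambda>s \<omega>. T (t - s) (\<beta>1 *\<^sub>R y s \<omega>)) X \<and>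
        (AE \<omega> in M. y t \<omega> = T t (y0 \<omega>)
            + set_lebesgue_integral lborel {0..t} (\<lambda>s. T (t - s) (\<beta>0 *\<^sub>R y s \<omega>))
            + X \<omega>))"

end

theory Submission
  imports Defs
begin

text \<open>
  For fixed \<open>t\<close> and \<open>z \<in> H\<close> the process \<open>v s = \<langle>T (t - s) (y s), z\<rangle>\<close> solves the scalar equation
  \<open>dv = \<beta>\<^sub>0 v ds + \<beta>\<^sub>1 v dW\<close> on \<open>[0, t]\<close>: the operator \<open>A\<close> disappears, and no eigenbasis is needed. Such a \<open>v\<close> equals
  \<open>v 0 exp ((\<beta>\<^sub>0 - \<beta>\<^sub>1\<^sup>2/2) s + \<beta>\<^sub>1 W\<^sub>s)\<close>, because \<open>v\<close> times the reciprocal exponential has increments over a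
  grid of mesh \<open>h\<close> that sum to something tending to \<open>0\<close> in probability as \<open>h \<rightarrow> 0\<close>. Hence
  \<open>y t = exp ((\<beta>\<^sub>0 - \<beta>\<^sub>1\<^sup>2/2) t + \<beta>\<^sub>1 W\<^sub>t) T t y\<^sub>0\<close> almost surely. Coercivity of \<open>A\<close> gives
  \<open>\<parallel>T t\<parallel> \<le> exp (-\<lambda>\<^sub>1 t)\<close>, so \<open>\<parallel>y t\<parallel>\<^sup>p \<le> \<parallel>y\<^sub>0\<parallel>\<^sup>p exp (-\<mu> t + p \<beta>\<^sub>1 W\<^sub>t)\<close>, and the maximal inequality for exponential
  martingales bounds \<open>p \<beta>\<^sub>1 W\<^sub>t - \<mu> t / 2\<close> pathwise.
\<close>

section \<open>Increments of Brownian motion and the augmented filtration\<close>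

text \<open>\<open>is_ito_integral\<close> says only that, over one fixed interval, some simple
  processes approximate in probability. The integrals over different intervals are unrelated
  versions, without continuity in the end point and with a null set for each time. So the scalar
  equation is compared with the exponential on finite grids only, and all errors are measured by a
  metric for convergence in probability. Two grids are needed: a coarse one of mesh
  \<open>h\<close>, on which the exponential nearly solves an Euler scheme, and a fine one of mesh
  \<open>h / k\<close>, whose Riemann sums stand in for the Ito integral over a coarse cell. The
  fine one is chosen last, because the Riemann sums converge without a rate. The operator disappears
  since \<open>T (t - s)\<close>, applied to the mild formula at time \<open>s\<close>, turns
  \<open>T (s - r)\<close> into \<open>T (t - r)\<close>, an integrand free of \<open>s\<close>. The
  explicit formula again holds almost surely for each time separately; countably many dense times
  and continuity of \<open>y\<close> give one exceptional set. The rate is halved because \<mu> is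
  the full exponential drift: one half of it absorbs the noise term.\<close>

lemma finite_set_strict_enum:
  fixes P :: "real set"
  assumes "finite P" "P \<noteq> {}"
  shows "\<exists>n tp. (\<forall>i<n. tp i < tp (Suc i)) \<and> P = tp ` {..n} \<and> tp 0 = Min P \<and> tp n = Max P"
proof -
  define xs where "xs = sorted_list_of_set P"
  have set: "set xs = P" and s: "sorted_wrt (<) xs"
    using assms by (auto simp: xs_def)
  define n where "n = length xs - 1"
  have len: "length xs = Suc n" using set assms(2) by (cases xs) (auto simp: n_def)
  have img: "P = (!) xs ` {..n}"
    using set len by (auto simp: set_conv_nth image_iff less_Suc_eq_le)
  have mono: "xs ! i \<le> xs ! j" if "i \<le> j" "j \<le> n" for i j
    using that sorted_wrt_nth_less[OF s, of i j] len by (cases "i = j") auto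
  have "xs ! 0 = Min P"
    using mono img by (intro Min_eqI[symmetric]) (auto simp: assms)
  moreover have "xs ! n = Max P"
    using mono img by (intro Max_eqI[symmetric]) (auto simp: assms)
  ultimately show ?thesis using img sorted_wrt_nth_less[OF s] len
    by (intro exI[of _ n] exI[of _ "(!) xs"]) auto
qed

lemma space_nat_filt [simp]: "space (nat_filt M W t) = space M"
  unfolding nat_filt_def by (rule space_measure_of) (auto dest: sets.sets_into_space)

lemma sets_nat_filt:
  "sets (nat_filt M W t) = sigma_sets (space M)
     ({W s -` B \<inter> space M | s B. 0 \<le> s \<and> s \<le> t \<and> B \<in> sets borel}
      \<union> {N \<in> sets M. emeasure M N = 0})"
  unfolding nat_filt_def by (rule sets_measure_of) (auto dest: sets.sets_into_space)

lemma sets_nat_filt_mono: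
  assumes "s \<le> t"
  shows "sets (nat_filt M W s) \<subseteq> sets (nat_filt M W t)"
  unfolding sets_nat_filt
  by (intro sigma_sets_mono' Un_mono Collect_mono ex_mono impI order_refl)
     (use assms in \<open>auto intro: order_trans\<close>)

lemma measurable_nat_filt_mono:
  "f \<in> measurable (nat_filt M W s) N \<Longrightarrow> s \<le> t \<Longrightarrow> f \<in> measurable (nat_filt M W t) N"
  using sets_nat_filt_mono[of s t M W] by (auto simp: measurable_def)

locale brownian = prob_space M for M :: "'w measure" +
  fixes W :: "real \<Rightarrow> 'w \<Rightarrow> real"
  assumes BM: "std_brownian_motion M W"
begin

abbreviation "F \<equiv> nat_filt M W"

lemma W_measurable [measurable (raw)]: "0 \<le> t \<Longrightarrow> W t \<in> borel_measurable M"
  using BM by (simp add: std_brownian_motion_def)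

lemma W_event: "0 \<le> s \<Longrightarrow> B \<in> sets borel \<Longrightarrow> {\<omega>\<in>space M. W s \<omega> \<in> B} \<in> events"
  using measurable_sets[OF W_measurable[of s]] by (simp add: vimage_def Int_def conj_commute)

lemma W_0: "AE \<omega> in M. W 0 \<omega> = 0"
  and W_continuous: "AE \<omega> in M. continuous_on {0..} (\<lambda>t. W t \<omega>)"
  using BM unfolding std_brownian_motion_def by auto

lemma W_distributed:
  "0 \<le> s \<Longrightarrow> s < t \<Longrightarrow> distributed M lborel (\<lambda>\<omega>. W t \<omega> - W s \<omega>)
     (\<lambda>x. ennreal (normal_density 0 (sqrt (t - s)) x))"
  using BM unfolding std_brownian_motion_def by blast

lemma W_indep:
  "0 \<le> tp 0 \<Longrightarrow> (\<And>i. i < n \<Longrightarrow> tp i < tp (Suc i)) \<Longrightarrow>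
   indep_vars (\<lambda>_. borel) (\<lambda>i \<omega>. W (tp (Suc i)) \<omega> - W (tp i) \<omega>) {..<n}"
  using BM unfolding std_brownian_motion_def by blast

lemma sets_F_subset: "sets (F t) \<subseteq> events"
  unfolding sets_nat_filt by (intro sets.sigma_sets_subset) (auto intro: measurable_sets[OF W_measurable])

lemma measurable_F: "f \<in> measurable (F t) N \<Longrightarrow> f \<in> measurable M N"
  using sets_F_subset[of t] by (auto simp: measurable_def)

lemma W_adapted: "0 \<le> s \<Longrightarrow> s \<le> t \<Longrightarrow> W s \<in> borel_measurable (F t)"
  by (rule measurableI) (auto simp: sets_nat_filt intro!: sigma_sets.Basic)

text \<open>The definition of \<open>std_brownian_motion\<close> speaks about increments along one
  grid, not about values. So the values at the points of \<open>S\<close> are rewritten as partial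
  sums of increments from 0, and the cylinder becomes an event about the first \<open>n\<close>
  increments, independent of the last one, \<open>W b - W a\<close>.\<close>

lemma indep_cylinder_increment:
  assumes ab: "0 \<le> a" "a < b" and S: "finite S" "S \<subseteq> {0..a}"
    and B: "\<And>s. B s \<in> sets borel" and C: "C \<in> sets borel"
  shows "prob ({\<omega>\<in>space M. \<forall>s\<in>S. W s \<omega> \<in> B s} \<inter> {\<omega>\<in>space M. W b \<omega> - W a \<omega> \<in> C})
       = prob {\<omega>\<in>space M. \<forall>s\<in>S. W s \<omega> \<in> B s} * prob {\<omega>\<in>space M. W b \<omega> - W a \<omega> \<in> C}"
proof -
  \<comment> \<open>The point 0 lets the partial sums start at \<open>W 0\<close>; the point
    \<open>a\<close> makes the next grid interval begin exactly where the increment does.\<close>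
  define P where "P = S \<union> {0, a}"
  have P: "finite P" "P \<noteq> {}" using S by (auto simp: P_def)
  obtain n tp where tp: "\<And>i. i < n \<Longrightarrow> tp i < tp (Suc i)" "P = tp ` {..n}" "tp 0 = Min P" "tp n = Max P"
    using finite_set_strict_enum[OF P] by blast
  have tp0: "tp 0 = 0" unfolding tp(3) using S ab by (intro Min_eqI) (auto simp: P_def)
  have tpn: "tp n = a" unfolding tp(4) using S ab by (intro Max_eqI) (auto simp: P_def)
  define tq where "tq i = (if i \<le> n then tp i else b)" for i
  define X where "X i \<omega> = W (tq (Suc i)) \<omega> - W (tq i) \<omega>" for i \<omega>
  have ind: "indep_vars (\<lambda>_. borel) X {..<Suc n}"
    unfolding X_def using tp(1) tp0 tpn ab by (intro W_indep) (auto simp: tq_def less_Suc_eq)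
  have indv: "indep_var (PiM {..<n} (\<lambda>_. borel)) (\<lambda>\<omega>. restrict (\<lambda>i. X i \<omega>) {..<n})
      (PiM {n} (\<lambda>_. borel)) (\<lambda>\<omega>. restrict (\<lambda>i. X i \<omega>) {n})"
    by (rule indep_var_restrict[OF ind]) auto
  have Xn: "X n \<omega> = W b \<omega> - W a \<omega>" for \<omega> by (simp add: X_def tq_def tpn)
  have tel: "(\<Sum>i<k. X i \<omega>) = W (tp k) \<omega> - W 0 \<omega>" if "k \<le> n" for k \<omega>
    using that by (induction k) (auto simp: X_def tq_def tp0)
  have "\<exists>k. \<forall>s\<in>S. k s \<le> n \<and> tp (k s) = s"
    using tp(2) unfolding P_def by (intro bchoice) (metis UnI1 atMost_iff imageE)
  then obtain k where k: "\<And>s. s \<in> S \<Longrightarrow> k s \<le> n" "\<And>s. s \<in> S \<Longrightarrow> tp (k s) = s" by auto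
  define A' where "A' = {x \<in> space (PiM {..<n} (\<lambda>_. borel)). \<forall>s\<in>S. (\<Sum>i<k s. x i :: real) \<in> B s}"
  define C' where "C' = {x \<in> space (PiM {n} (\<lambda>_. borel)). x n \<in> C}"
  have A': "A' \<in> sets (PiM {..<n} (\<lambda>_. borel))"
    unfolding A'_def
  proof (intro sets.sets_Collect_finite_All S)
    fix s assume "s \<in> S"
    then have "(\<lambda>x. \<Sum>i<k s. x i :: real) \<in> borel_measurable (PiM {..<n} (\<lambda>_. borel))"
      using k(1)[of s] by (intro borel_measurable_sum measurable_component_singleton) auto
    then show "{x \<in> space (PiM {..<n} (\<lambda>_. borel)). (\<Sum>i<k s. x i :: real) \<in> B s} \<in> sets (PiM {..<n} (\<lambda>_. borel))"
      using B[of s] by (auto dest!: measurable_sets[OF _ B[of s]] simp: vimage_def Int_def conj_commute)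
  qed
  have C': "C' \<in> sets (PiM {n} (\<lambda>_. borel))"
  proof -
    have "(\<lambda>x. x n :: real) \<in> borel_measurable (PiM {n} (\<lambda>_. borel))"
      by (intro measurable_component_singleton) auto
    from measurable_sets[OF this C] show ?thesis
      unfolding C'_def by (simp add: vimage_def Int_def conj_commute)
  qed
  define E where "E = {\<omega>\<in>space M. \<forall>s\<in>S. W s \<omega> \<in> B s}"
  define E' where "E' = {\<omega>\<in>space M. \<forall>s\<in>S. (\<Sum>i<k s. X i \<omega>) \<in> B s}"
  define H where "H = {\<omega>\<in>space M. W b \<omega> - W a \<omega> \<in> C}"
  have vA: "(\<lambda>\<omega>. restrict (\<lambda>i. X i \<omega>) {..<n}) -` A' \<inter> space M = E'"
  proof -
    have "(\<Sum>i<k s. restrict (\<lambda>i. X i \<omega>) {..<n} i) = (\<Sum>i<k s. X i \<omega>)" if "s \<in> S" for s \<omega>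
      using k(1)[OF that] by (intro sum.cong) auto
    then show ?thesis by (auto simp: A'_def E'_def space_PiM)
  qed
  have vC: "(\<lambda>\<omega>. restrict (\<lambda>i. X i \<omega>) {n}) -` C' \<inter> space M = H"
    by (auto simp: C'_def H_def space_PiM Xn)
  have E: "E \<in> events" unfolding E_def
    by (intro sets.sets_Collect_finite_All S)
       (use S B in \<open>auto intro!: W_event simp: subset_iff\<close>)
  have XM: "X i \<in> borel_measurable M" if "i < Suc n" for i
    using ind that by (auto simp: indep_vars_def)
  have H: "H \<in> events" unfolding vC[symmetric]
    by (intro measurable_sets[OF _ C'] measurable_restrict XM) auto
  have E': "E' \<in> events" unfolding vA[symmetric]
    by (intro measurable_sets[OF _ A'] measurable_restrict XM) auto
  \<comment> \<open>\<open>E'\<close> uses \<open>W s - W 0\<close> in place of \<open>W s\<close>,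
    and \<open>W 0\<close> vanishes only almost surely.\<close>
  have AE: "AE \<omega> in M. \<omega> \<in> E \<longleftrightarrow> \<omega> \<in> E'"
    using W_0 by eventually_elim (auto simp: E_def E'_def tel k)
  have "prob (E \<inter> H) = prob (E' \<inter> H)"
    by (rule finite_measure_eq_AE) (use AE E E' H in auto)
  also have "\<dots> = prob E' * prob H"
  proof -
    have "E' \<inter> H = (\<lambda>x. (restrict (\<lambda>i. X i x) {..<n}, restrict (\<lambda>i. X i x) {n})) -` (A' \<times> C') \<inter> space M"
      using vA vC by auto
    then show ?thesis using indep_varD[OF indv A' C'] unfolding vA vC by simp
  qed
  also have "prob E' = prob E"
    by (rule finite_measure_eq_AE) (use AE E E' in auto)
  finally show ?thesis by (simp add: E_def H_def)
qed

text \<open>By the pi-lambda theorem an intersection-stable generator suffices. The augmentation is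
  harmless: meeting an event with a null event gives a null event, so cylinders together with null
  events are stable, and a null event is independent of everything.\<close>

lemma indep_set_F_increment:
  assumes ab: "0 \<le> a" "a < b"
  shows "indep_set (sets (F a)) (sigma_sets (space M) {(\<lambda>\<omega>. W b \<omega> - W a \<omega>) -` C \<inter> space M | C. C \<in> sets borel})"
proof -
  define cyl where "cyl S B = {\<omega>\<in>space M. \<forall>s\<in>S. W s \<omega> \<in> B s}" for S and B :: "real \<Rightarrow> real set"
  define G1 where "G1 = {cyl S B | S B. finite S \<and> S \<subseteq> {0..a} \<and> (\<forall>s. B s \<in> sets borel)}"
  define G2 where "G2 = {N \<in> events. emeasure M N = 0}"
  define G3 where "G3 = {(\<lambda>\<omega>. W b \<omega> - W a \<omega>) -` C \<inter> space M | C. C \<in> sets borel}"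
  have cyl: "cyl S B \<in> events" if "finite S" "S \<subseteq> {0..a}" "\<And>s. B s \<in> sets borel" for S B
    unfolding cyl_def by (intro sets.sets_Collect_finite_All that)
      (use that in \<open>auto intro!: W_event simp: subset_iff\<close>)
  have G1e: "G1 \<subseteq> events" using cyl by (auto simp: G1_def)
  have G2e: "G2 \<subseteq> events" by (auto simp: G2_def)
  have d: "(\<lambda>\<omega>. W b \<omega> - W a \<omega>) \<in> borel_measurable M" using ab by simp
  have G3e: "G3 \<subseteq> events" using measurable_sets[OF d] by (auto simp: G3_def)
  have st1: "Int_stable (G1 \<union> G2)"
  proof (rule Int_stableI)
    fix x z assume xz: "x \<in> G1 \<union> G2" "z \<in> G1 \<union> G2"
    then have ev: "x \<in> events" "z \<in> events" using G1e G2e by auto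
    show "x \<inter> z \<in> G1 \<union> G2"
    proof (cases "x \<in> G2 \<or> z \<in> G2")
      case True
      then have "emeasure M (x \<inter> z) = 0"
        using ev emeasure_mono[of "x \<inter> z" x M] emeasure_mono[of "x \<inter> z" z M] by (auto simp: G2_def)
      then show ?thesis using ev by (auto simp: G2_def)
    next
      case False
      then obtain S B S' B' where *: "x = cyl S B" "z = cyl S' B'" "finite S" "finite S'" "S \<subseteq> {0..a}" "S' \<subseteq> {0..a}"
        "\<And>s. B s \<in> sets borel" "\<And>s. B' s \<in> sets borel" using xz by (auto simp: G1_def)
      \<comment> \<open>A coordinate constrained by only one of the two cylinders gets
        \<open>UNIV\<close> from the other.\<close>
      define B'' where "B'' s = (if s \<in> S then B s else UNIV) \<inter> (if s \<in> S' then B' s else UNIV)" for s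
      have "x \<inter> z = cyl (S \<union> S') B''" unfolding *(1,2) cyl_def B''_def by auto
      moreover have "B'' s \<in> sets borel" for s using *(7,8) by (auto simp: B''_def)
      ultimately have "x \<inter> z \<in> G1" unfolding G1_def using *(3-6) by blast
      then show ?thesis by simp
    qed
  qed
  have st3: "Int_stable G3"
  proof (rule Int_stableI)
    fix x z assume "x \<in> G3" "z \<in> G3"
    then obtain C C' where "C \<in> sets borel" "C' \<in> sets borel" "x = (\<lambda>\<omega>. W b \<omega> - W a \<omega>) -` C \<inter> space M"
      "z = (\<lambda>\<omega>. W b \<omega> - W a \<omega>) -` C' \<inter> space M" by (auto simp: G3_def)
    then show "x \<inter> z \<in> G3" unfolding G3_def by (intro CollectI exI[of _ "C \<inter> C'"]) auto
  qed
  have "indep_set (G1 \<union> G2) G3"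
    unfolding indep_sets2_eq
  proof (intro conjI ballI)
    fix x z assume x: "x \<in> G1 \<union> G2" and z: "z \<in> G3"
    then have ev: "x \<in> events" "z \<in> events" using G1e G2e G3e by auto
    obtain C where C: "C \<in> sets borel" "z = {\<omega>\<in>space M. W b \<omega> - W a \<omega> \<in> C}"
      using z by (auto simp: G3_def)
    show "prob (x \<inter> z) = prob x * prob z"
    proof (cases "x \<in> G2")
      case True
      then have "prob x = 0" by (auto simp: G2_def measure_def)
      moreover have "prob (x \<inter> z) \<le> prob x" using ev by (intro finite_measure_mono) auto
      ultimately show ?thesis using measure_nonneg[of M "x \<inter> z"] by simp
    next
      case False
      then obtain S B where "x = cyl S B" "finite S" "S \<subseteq> {0..a}" "\<And>s. B s \<in> sets borel"
        using x by (auto simp: G1_def)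
      then show ?thesis using indep_cylinder_increment[OF ab, of S B C] C by (simp add: cyl_def)
    qed
  qed (use G1e G2e G3e in auto)
  then have "indep_set (sigma_sets (space M) (G1 \<union> G2)) (sigma_sets (space M) G3)"
    by (rule indep_set_sigma_sets) fact+
  moreover have "sets (F a) \<subseteq> sigma_sets (space M) (G1 \<union> G2)"
    unfolding sets_nat_filt
  proof (rule sigma_sets_mono')
    show "{W s -` B \<inter> space M |s B. 0 \<le> s \<and> s \<le> a \<and> (B :: real set) \<in> sets borel} \<union> {N \<in> events. emeasure M N = 0} \<subseteq> G1 \<union> G2"
    proof safe
      fix s and B :: "real set" assume s: "0 \<le> s" "s \<le> a" "B \<in> sets borel"
      have "W s -` B \<inter> space M = cyl {s} (\<lambda>_. B)" by (auto simp: cyl_def)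
      then show "W s -` B \<inter> space M \<in> G1" unfolding G1_def
        by (intro CollectI exI[of _ "{s}"] exI[of _ "\<lambda>_. B"]) (use s in auto)
    qed (auto simp: G2_def)
  qed
  ultimately show ?thesis unfolding G3_def indep_sets2_eq by blast
qed

lemma indep_var_increment:
  assumes "0 \<le> a" "a < b" and c: "c \<in> borel_measurable (F a)"
  shows "indep_var borel c borel (\<lambda>\<omega>. W b \<omega> - W a \<omega>)"
  unfolding indep_var_eq
proof (intro conjI)
  show "c \<in> borel_measurable M" by (rule measurable_F[OF c])
  show "(\<lambda>\<omega>. W b \<omega> - W a \<omega>) \<in> borel_measurable M" using assms by simp
  have "sigma_sets (space M) {c -` A \<inter> space M |A. A \<in> sets borel} \<subseteq> sets (F a)"
    using measurable_sets[OF c] by (intro sets.sigma_sets_subset[of _ "F a", simplified]) auto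
  then show "indep_set (sigma_sets (space M) {c -` A \<inter> space M |A. A \<in> sets borel})
     (sigma_sets (space M) {(\<lambda>\<omega>. W b \<omega> - W a \<omega>) -` A \<inter> space M |A. A \<in> sets borel})"
    using indep_set_F_increment[OF assms(1,2)] unfolding indep_sets2_eq by blast
qed

lemma
  fixes c :: "'w \<Rightarrow> real" and \<psi> :: "real \<Rightarrow> real"
  assumes "0 \<le> a" "a < b" and c: "c \<in> borel_measurable (F a)" "integrable M c"
    and \<psi>: "\<psi> \<in> borel_measurable borel" "integrable M (\<lambda>\<omega>. \<psi> (W b \<omega> - W a \<omega>))"
  shows integrable_mult_increment: "integrable M (\<lambda>\<omega>. c \<omega> * \<psi> (W b \<omega> - W a \<omega>))"
    and expectation_mult_increment: "expectation (\<lambda>\<omega>. c \<omega> * \<psi> (W b \<omega> - W a \<omega>))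
      = expectation c * expectation (\<lambda>\<omega>. \<psi> (W b \<omega> - W a \<omega>))"
proof -
  have "indep_var borel ((\<lambda>x. x) \<circ> c) borel (\<psi> \<circ> (\<lambda>\<omega>. W b \<omega> - W a \<omega>))"
    by (rule indep_var_compose[OF indep_var_increment[OF assms(1-3)]]) (use \<psi> in auto)
  then have i: "indep_var borel c borel (\<lambda>\<omega>. \<psi> (W b \<omega> - W a \<omega>))" by (simp add: comp_def)
  show "integrable M (\<lambda>\<omega>. c \<omega> * \<psi> (W b \<omega> - W a \<omega>))"
    by (rule indep_var_integrable[OF i c(2) \<psi>(2)])
  show "expectation (\<lambda>\<omega>. c \<omega> * \<psi> (W b \<omega> - W a \<omega>))
      = expectation c * expectation (\<lambda>\<omega>. \<psi> (W b \<omega> - W a \<omega>))"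
    by (rule indep_var_lebesgue_integral[OF i c(2) \<psi>(2)])
qed

end

section \<open>Gaussian moments and convergence in probability\<close>

text \<open>The factor \<open>exp (c * x)\<close> tilts the centred normal density to one with mean
  \<open>c * \<sigma>\<^sup>2\<close> and the same variance; the polynomial is then expanded about
  the new mean and integrated through the central moments of order 0, 1 and 2. Every Gaussian
  expectation of the proof is derived from this one.\<close>

lemma normal_exp_quadratic:
  fixes \<sigma> c \<alpha> \<beta> \<gamma> :: real
  assumes "0 < \<sigma>"
  shows "has_bochner_integral lborel (\<lambda>x. normal_density 0 \<sigma> x * ((\<alpha> + \<beta> * x + \<gamma> * x\<^sup>2) * exp (c * x)))
     (exp (c\<^sup>2 * \<sigma>\<^sup>2 / 2) * (\<alpha> + \<beta> * (c * \<sigma>\<^sup>2) + \<gamma> * ((c * \<sigma>\<^sup>2)\<^sup>2 + \<sigma>\<^sup>2)))"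
proof -
  define m where "m = c * \<sigma>\<^sup>2"
  define n where "n = normal_density m \<sigma>"
  have shift: "normal_density 0 \<sigma> x * exp (c * x) = exp (c\<^sup>2 * \<sigma>\<^sup>2 / 2) * n x" for x
  proof -
    have "- (x - 0)\<^sup>2 / (2 * \<sigma>\<^sup>2) + c * x = c\<^sup>2 * \<sigma>\<^sup>2 / 2 + - (x - m)\<^sup>2 / (2 * \<sigma>\<^sup>2)"
      using assms by (simp add: m_def power2_eq_square field_simps)
    then have "exp (- (x - 0)\<^sup>2 / (2 * \<sigma>\<^sup>2)) * exp (c * x)
        = exp (c\<^sup>2 * \<sigma>\<^sup>2 / 2) * exp (- (x - m)\<^sup>2 / (2 * \<sigma>\<^sup>2))"
      by (metis exp_add)
    then show ?thesis by (simp add: normal_density_def n_def)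
  qed
  have i0: "has_bochner_integral lborel n 1"
    using assms by (simp add: has_bochner_integral_iff n_def)
  have i1: "has_bochner_integral lborel (\<lambda>x. n x * (x - m)) 0"
    using normal_moment_odd[OF assms, of m 0] by (simp add: n_def)
  have i2: "has_bochner_integral lborel (\<lambda>x. n x * (x - m)\<^sup>2) (\<sigma>\<^sup>2)"
    using normal_moment_even[OF assms, of m 1] by (simp add: n_def)
  have "has_bochner_integral lborel (\<lambda>x. exp (c\<^sup>2 * \<sigma>\<^sup>2 / 2) *
      ((\<alpha> + \<beta> * m + \<gamma> * m\<^sup>2) * n x + (\<beta> + 2 * \<gamma> * m) * (n x * (x - m)) + \<gamma> * (n x * (x - m)\<^sup>2)))
     (exp (c\<^sup>2 * \<sigma>\<^sup>2 / 2) * ((\<alpha> + \<beta> * m + \<gamma> * m\<^sup>2) * 1 + (\<beta> + 2 * \<gamma> * m) * 0 + \<gamma> * \<sigma>\<^sup>2))"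
    by (intro has_bochner_integral_mult_right has_bochner_integral_add i0 i1 i2)
  moreover have "exp (c\<^sup>2 * \<sigma>\<^sup>2 / 2) *
      ((\<alpha> + \<beta> * m + \<gamma> * m\<^sup>2) * n x + (\<beta> + 2 * \<gamma> * m) * (n x * (x - m)) + \<gamma> * (n x * (x - m)\<^sup>2))
     = normal_density 0 \<sigma> x * ((\<alpha> + \<beta> * x + \<gamma> * x\<^sup>2) * exp (c * x))" for x
  proof -
    have "normal_density 0 \<sigma> x * ((\<alpha> + \<beta> * x + \<gamma> * x\<^sup>2) * exp (c * x))
      = (\<alpha> + \<beta> * x + \<gamma> * x\<^sup>2) * (exp (c\<^sup>2 * \<sigma>\<^sup>2 / 2) * n x)"
      unfolding shift[symmetric] by simp
    then show ?thesis by (simp add: algebra_simps power2_eq_square)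
  qed
  moreover have "exp (c\<^sup>2 * \<sigma>\<^sup>2 / 2) * ((\<alpha> + \<beta> * m + \<gamma> * m\<^sup>2) * 1 + (\<beta> + 2 * \<gamma> * m) * 0 + \<gamma> * \<sigma>\<^sup>2)
    = exp (c\<^sup>2 * \<sigma>\<^sup>2 / 2) * (\<alpha> + \<beta> * (c * \<sigma>\<^sup>2) + \<gamma> * ((c * \<sigma>\<^sup>2)\<^sup>2 + \<sigma>\<^sup>2))"
    by (simp add: m_def algebra_simps)
  ultimately show ?thesis by (simp only:)
qed

context brownian begin

lemma increment_exp_quadratic:
  assumes "0 \<le> a" "a < b"
  shows "has_bochner_integral M
     (\<lambda>\<omega>. (\<alpha> + \<beta> * (W b \<omega> - W a \<omega>) + \<gamma> * (W b \<omega> - W a \<omega>)\<^sup>2) * exp (c * (W b \<omega> - W a \<omega>)))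
     (exp (c\<^sup>2 * (b - a) / 2) * (\<alpha> + \<beta> * (c * (b - a)) + \<gamma> * ((c * (b - a))\<^sup>2 + (b - a))))"
proof -
  let ?g = "\<lambda>x. (\<alpha> + \<beta> * x + \<gamma> * x\<^sup>2) * exp (c * x)"
  have "0 < sqrt (b - a)" using assms by simp
  from normal_exp_quadratic[OF this, of \<alpha> \<beta> \<gamma> c]
  have "has_bochner_integral lborel (\<lambda>x. normal_density 0 (sqrt (b - a)) x * ?g x)
     (exp (c\<^sup>2 * (b - a) / 2) * (\<alpha> + \<beta> * (c * (b - a)) + \<gamma> * ((c * (b - a))\<^sup>2 + (b - a))))"
    using assms by simp
  then show ?thesis
    using distributed_integral[OF W_distributed[OF assms], of ?g]
      distributed_integrable[OF W_distributed[OF assms], of ?g]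
    by (auto simp: has_bochner_integral_iff)
qed

lemma increment_mean: "0 \<le> a \<Longrightarrow> a < b \<Longrightarrow> has_bochner_integral M (\<lambda>\<omega>. W b \<omega> - W a \<omega>) 0"
  using increment_exp_quadratic[of a b 0 1 0 0] by simp

lemma increment_square: "0 \<le> a \<Longrightarrow> a < b \<Longrightarrow> has_bochner_integral M (\<lambda>\<omega>. (W b \<omega> - W a \<omega>)\<^sup>2) (b - a)"
  using increment_exp_quadratic[of a b 0 0 1 0] by simp

lemma increment_exp: "0 \<le> a \<Longrightarrow> a < b \<Longrightarrow>
    has_bochner_integral M (\<lambda>\<omega>. exp (c * (W b \<omega> - W a \<omega>))) (exp (c\<^sup>2 * (b - a) / 2))"
  using increment_exp_quadratic[of a b 1 0 0 c] by simp

end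

context prob_space begin

text \<open>\<open>prob_norm (X n) \<longlonglongrightarrow> 0\<close> is convergence of \<open>X n\<close> to \<open>0\<close> in probability.\<close>

definition prob_norm :: "('a \<Rightarrow> real) \<Rightarrow> real" where
  "prob_norm X = expectation (\<lambda>\<omega>. min 1 \<bar>X \<omega>\<bar>)"

lemma integrable_min_abs:
  fixes X :: "'a \<Rightarrow> real"
  shows "X \<in> borel_measurable M \<Longrightarrow> integrable M (\<lambda>\<omega>. min 1 \<bar>X \<omega>\<bar>)"
  by (rule integrable_const_bound[of _ 1]) auto

lemma prob_norm_nonneg: "0 \<le> prob_norm X"
  unfolding prob_norm_def by (rule Bochner_Integration.integral_nonneg) auto

text \<open>An exceptional event costs at most its probability because \<open>prob_norm\<close>
  truncates at 1. All estimates valid outside a small event enter through this lemma.\<close>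

lemma prob_norm_le_AE:
  assumes X[measurable]: "X \<in> borel_measurable M" and Y[measurable]: "Y \<in> borel_measurable M"
    and B[measurable]: "B \<in> events" and le: "AE \<omega> in M. \<omega> \<notin> B \<longrightarrow> \<bar>X \<omega>\<bar> \<le> \<bar>Y \<omega>\<bar>"
  shows "prob_norm X \<le> prob_norm Y + prob B"
proof -
  have "prob_norm X \<le> expectation (\<lambda>\<omega>. min 1 \<bar>Y \<omega>\<bar> + indicator B \<omega>)"
    unfolding prob_norm_def
  proof (intro integral_mono_AE)
    show "AE \<omega> in M. min 1 \<bar>X \<omega>\<bar> \<le> min 1 \<bar>Y \<omega>\<bar> + indicator B \<omega>"
      using le by eventually_elim (auto simp: indicator_def)
  qed (auto intro!: integrable_min_abs Bochner_Integration.integrable_add integrable_real_indicator simp: less_top[symmetric])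
  also have "\<dots> = prob_norm Y + prob B"
    unfolding prob_norm_def
    by (subst Bochner_Integration.integral_add)
       (auto intro!: integrable_min_abs integrable_real_indicator simp: less_top[symmetric])
  finally show ?thesis .
qed

lemma prob_norm_mono:
  assumes "X \<in> borel_measurable M" "Y \<in> borel_measurable M" "AE \<omega> in M. \<bar>X \<omega>\<bar> \<le> \<bar>Y \<omega>\<bar>"
  shows "prob_norm X \<le> prob_norm Y"
  using prob_norm_le_AE[of X Y "{}"] assms by simp

lemma prob_norm_add:
  assumes [measurable]: "X \<in> borel_measurable M" "Y \<in> borel_measurable M"
  shows "prob_norm (\<lambda>\<omega>. X \<omega> + Y \<omega>) \<le> prob_norm X + prob_norm Y"
proof -
  have "prob_norm (\<lambda>\<omega>. X \<omega> + Y \<omega>) \<le> expectation (\<lambda>\<omega>. min 1 \<bar>X \<omega>\<bar> + min 1 \<bar>Y \<omega>\<bar>)"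
    unfolding prob_norm_def
    by (intro integral_mono Bochner_Integration.integrable_add integrable_min_abs) auto
  then show ?thesis unfolding prob_norm_def by (simp add: integrable_min_abs)
qed

lemma prob_norm_uminus: "prob_norm (\<lambda>\<omega>. - X \<omega>) = prob_norm X"
  by (simp add: prob_norm_def)

lemma prob_norm_diff:
  assumes [measurable]: "X \<in> borel_measurable M" "Y \<in> borel_measurable M"
  shows "prob_norm (\<lambda>\<omega>. X \<omega> - Y \<omega>) \<le> prob_norm X + prob_norm Y"
  using prob_norm_add[of X "\<lambda>\<omega>. - Y \<omega>"] by (simp add: prob_norm_uminus)

lemma prob_norm_sum:
  assumes "finite I" "\<And>i. i \<in> I \<Longrightarrow> X i \<in> borel_measurable M"
  shows "prob_norm (\<lambda>\<omega>. \<Sum>i\<in>I. X i \<omega>) \<le> (\<Sum>i\<in>I. prob_norm (X i))"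
  using assms
proof (induction I rule: finite_induct)
  case empty then show ?case by (simp add: prob_norm_def)
next
  case (insert i I)
  have "prob_norm (\<lambda>\<omega>. X i \<omega> + (\<Sum>i\<in>I. X i \<omega>)) \<le> prob_norm (X i) + prob_norm (\<lambda>\<omega>. \<Sum>i\<in>I. X i \<omega>)"
    using insert by (intro prob_norm_add borel_measurable_sum) auto
  with insert show ?case by simp
qed

lemma prob_norm_le_expectation:
  assumes "integrable M X"
  shows "prob_norm X \<le> expectation (\<lambda>\<omega>. \<bar>X \<omega>\<bar>)"
  unfolding prob_norm_def
  using assms by (intro integral_mono integrable_min_abs integrable_abs) auto

lemma expectation_abs_le_sqrt:
  fixes X :: "'a \<Rightarrow> real"
  assumes X[measurable]: "X \<in> borel_measurable M" and i: "integrable M (\<lambda>\<omega>. (X \<omega>)\<^sup>2)"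
  shows "integrable M X" "expectation (\<lambda>\<omega>. \<bar>X \<omega>\<bar>) \<le> sqrt (expectation (\<lambda>\<omega>. (X \<omega>)\<^sup>2))"
proof -
  show X: "integrable M X" by (rule square_integrable_imp_integrable[OF assms])
  have "(expectation (\<lambda>\<omega>. \<bar>X \<omega>\<bar>))\<^sup>2 \<le> expectation (\<lambda>\<omega>. \<bar>X \<omega>\<bar>\<^sup>2)"
  proof -
    have "0 \<le> variance (\<lambda>\<omega>. \<bar>X \<omega>\<bar>)" by (rule variance_positive)
    also have "\<dots> = expectation (\<lambda>\<omega>. \<bar>X \<omega>\<bar>\<^sup>2) - (expectation (\<lambda>\<omega>. \<bar>X \<omega>\<bar>))\<^sup>2"
      using X i by (intro variance_eq) auto
    finally show ?thesis by simp
  qed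
  then show "expectation (\<lambda>\<omega>. \<bar>X \<omega>\<bar>) \<le> sqrt (expectation (\<lambda>\<omega>. (X \<omega>)\<^sup>2))"
    by (intro real_le_rsqrt) simp
qed

lemma prob_norm_le_sqrt:
  assumes "X \<in> borel_measurable M" "integrable M (\<lambda>\<omega>. (X \<omega>)\<^sup>2)"
  shows "prob_norm X \<le> sqrt (expectation (\<lambda>\<omega>. (X \<omega>)\<^sup>2))"
  using expectation_abs_le_sqrt[OF assms] prob_norm_le_expectation[of X] by linarith

lemma prob_norm_eq_0:
  assumes X[measurable]: "X \<in> borel_measurable M" and "prob_norm X = 0"
  shows "AE \<omega> in M. X \<omega> = 0"
proof -
  have "AE \<omega> in M. min 1 \<bar>X \<omega>\<bar> = 0"
    using assms integral_nonneg_eq_0_iff_AE[OF integrable_min_abs[OF X]] by (simp add: prob_norm_def)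
  then show ?thesis by eventually_elim (auto simp: min_def split: if_splits)
qed

lemma tail_prob_tendsto_0:
  fixes R :: "'a \<Rightarrow> real"
  assumes R[measurable]: "R \<in> borel_measurable M" and "\<delta> > 0"
  shows "\<exists>K\<ge>1. prob {\<omega>\<in>space M. \<bar>R \<omega>\<bar> > K} < \<delta>"
proof -
  have "(\<lambda>n. prob {\<omega>\<in>space M. \<bar>R \<omega>\<bar> > real n}) \<longlonglongrightarrow> prob (\<Inter>n. {\<omega>\<in>space M. \<bar>R \<omega>\<bar> > real n})"
    by (rule finite_Lim_measure_decseq) (auto simp: decseq_def)
  also have "(\<Inter>n. {\<omega>\<in>space M. \<bar>R \<omega>\<bar> > real n}) = {}"
  proof safe
    fix \<omega> assume *: "\<omega> \<in> (\<Inter>n. {\<omega>\<in>space M. \<bar>R \<omega>\<bar> > real n})"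
    obtain n where "\<bar>R \<omega>\<bar> < real n" using reals_Archimedean2 by blast
    moreover have "real n < \<bar>R \<omega>\<bar>" using * by auto
    ultimately show "\<omega> \<in> {}" by simp
  qed
  finally have "(\<lambda>n. prob {\<omega>\<in>space M. \<bar>R \<omega>\<bar> > real n}) \<longlonglongrightarrow> 0" by simp
  then have "eventually (\<lambda>n. prob {\<omega>\<in>space M. \<bar>R \<omega>\<bar> > real n} < \<delta>) sequentially"
    by (rule order_tendstoD) fact
  then obtain N where "\<And>n. n \<ge> N \<Longrightarrow> prob {\<omega>\<in>space M. \<bar>R \<omega>\<bar> > real n} < \<delta>"
    by (auto simp: eventually_sequentially)
  then show ?thesis by (intro exI[of _ "real (max 1 N)"]) auto
qed

text \<open>Truncation at 1 destroys homogeneity: a factor below 1 need not shrink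
  \<open>prob_norm\<close>, hence the \<open>max\<close>.\<close>

lemma prob_norm_cmult:
  assumes X: "X \<in> borel_measurable M"
  shows "prob_norm (\<lambda>\<omega>. c * X \<omega>) \<le> max 1 \<bar>c\<bar> * prob_norm X"
proof -
  have kmin: "min 1 (\<bar>c\<bar> * x) \<le> max 1 \<bar>c\<bar> * min 1 x" if "0 \<le> x" for x :: real
  proof (cases "x \<le> 1")
    case True
    have "\<bar>c\<bar> * x \<le> max 1 \<bar>c\<bar> * x" using that by (intro mult_right_mono) auto
    then show ?thesis using True by (simp add: min_def)
  qed (auto simp: min_def max_def)
  have "prob_norm (\<lambda>\<omega>. c * X \<omega>) \<le> expectation (\<lambda>\<omega>. max 1 \<bar>c\<bar> * min 1 \<bar>X \<omega>\<bar>)"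
    unfolding prob_norm_def using X
    by (intro integral_mono integrable_mult_right integrable_min_abs)
       (auto simp only: abs_mult intro!: kmin borel_measurable_times borel_measurable_const abs_ge_zero)
  then show ?thesis by (simp add: prob_norm_def)
qed

text \<open>\<open>R\<close> may be unbounded, but a single random variable is tight: off an event
  of probability below \<open>\<epsilon> / 2\<close> it is bounded by some \<open>K\<close>, chosen
  before \<open>n\<close>.\<close>

lemma prob_norm_mult_tendsto_0:
  assumes R[measurable]: "R \<in> borel_measurable M" and X[measurable]: "\<And>n. X n \<in> borel_measurable M"
    and lim: "(\<lambda>n. prob_norm (X n)) \<longlonglongrightarrow> 0"
  shows "(\<lambda>n. prob_norm (\<lambda>\<omega>. R \<omega> * X n \<omega>)) \<longlonglongrightarrow> 0"
proof (rule LIMSEQ_I)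
  fix \<epsilon> :: real assume \<epsilon>: "\<epsilon> > 0"
  obtain K where K: "K \<ge> 1" "prob {\<omega>\<in>space M. \<bar>R \<omega>\<bar> > K} < \<epsilon> / 2"
    using tail_prob_tendsto_0[OF R, of "\<epsilon> / 2"] \<epsilon> by auto
  have KX: "prob_norm (\<lambda>\<omega>. K * X n \<omega>) \<le> K * prob_norm (X n)" for n
    using prob_norm_cmult[OF X, of K] K(1) by simp
  have "prob_norm (\<lambda>\<omega>. R \<omega> * X n \<omega>) \<le> K * prob_norm (X n) + \<epsilon> / 2" for n
  proof -
    have "prob_norm (\<lambda>\<omega>. R \<omega> * X n \<omega>) \<le> prob_norm (\<lambda>\<omega>. K * X n \<omega>) + prob {\<omega>\<in>space M. \<bar>R \<omega>\<bar> > K}"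
      using K(1) by (intro prob_norm_le_AE AE_I2) (auto simp: abs_mult intro!: mult_right_mono)
    with KX[of n] K(2) show ?thesis by linarith
  qed
  moreover obtain N where "\<And>n. n \<ge> N \<Longrightarrow> prob_norm (X n) < \<epsilon> / (2 * K)"
    using LIMSEQ_D[OF lim, of "\<epsilon> / (2 * K)"] K \<epsilon> prob_norm_nonneg by auto
  ultimately have "prob_norm (\<lambda>\<omega>. R \<omega> * X n \<omega>) < \<epsilon>" if "n \<ge> N" for n
  proof -
    have "K * prob_norm (X n) < \<epsilon> / 2"
      using \<open>n \<ge> N\<close> \<open>\<And>n. n \<ge> N \<Longrightarrow> prob_norm (X n) < \<epsilon> / (2 * K)\<close>[of n] K(1) by (simp add: field_simps)
    with \<open>\<And>n. prob_norm (\<lambda>\<omega>. R \<omega> * X n \<omega>) \<le> K * prob_norm (X n) + \<epsilon> / 2\<close>[of n] show ?thesis by linarith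
  qed
  then show "\<exists>no. \<forall>n\<ge>no. norm (prob_norm (\<lambda>\<omega>. R \<omega> * X n \<omega>) - 0) < \<epsilon>"
    using prob_norm_nonneg by auto
qed

text \<open>The covering event \<open>A\<close> plays the exceptional event; off it the variable is
  at most \<open>\<epsilon> / 2\<close>.\<close>

lemma tendsto_zero_in_prob_prob_norm:
  assumes X[measurable]: "\<And>n. X n \<in> borel_measurable M"
    and lim: "tendsto_zero_in_prob M (\<lambda>n \<omega>. ennreal \<bar>X n \<omega>\<bar>)"
  shows "(\<lambda>n. prob_norm (X n)) \<longlonglongrightarrow> 0"
proof (rule LIMSEQ_I)
  fix \<epsilon> :: real assume \<epsilon>: "\<epsilon> > 0"
  then obtain N where N: "\<And>n. n \<ge> N \<Longrightarrow> \<exists>A\<in>events. {\<omega>\<in>space M. ennreal \<bar>X n \<omega>\<bar> > ennreal (\<epsilon> / 2)} \<subseteq> A \<and> prob A < \<epsilon> / 2"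
    using lim unfolding tendsto_zero_in_prob_def by (metis half_gt_zero)
  have "prob_norm (X n) < \<epsilon>" if n: "n \<ge> N" for n
  proof -
    obtain A where A: "A \<in> events" "{\<omega>\<in>space M. ennreal \<bar>X n \<omega>\<bar> > ennreal (\<epsilon> / 2)} \<subseteq> A" "prob A < \<epsilon> / 2"
      using N[OF n] by auto
    have "prob_norm (X n) \<le> prob_norm (\<lambda>_. \<epsilon> / 2) + prob A"
      using A(1,2) \<epsilon> by (intro prob_norm_le_AE AE_I2) (auto simp: subset_iff ennreal_less_iff not_less)
    moreover have "prob_norm (\<lambda>_. \<epsilon> / 2) \<le> \<epsilon> / 2"
      using prob_norm_le_expectation[of "\<lambda>_. \<epsilon> / 2"] \<epsilon> by (simp add: prob_space)
    ultimately show ?thesis using A(3) by linarith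
  qed
  then show "\<exists>no. \<forall>n\<ge>no. norm (prob_norm (X n) - 0) < \<epsilon>"
    using prob_norm_nonneg by auto
qed

section \<open>Uniform control of continuous paths outside events of small probability\<close>

lemma decseq_prob_small:
  assumes E: "\<And>n. E n \<in> events" "decseq E" and AE: "AE \<omega> in M. \<exists>n. \<omega> \<notin> E n"
    and ae: "AE \<omega> in M. P \<omega>" and \<delta>: "\<delta> > 0"
  shows "\<exists>n. \<exists>B\<in>events. E n \<subseteq> B \<and> prob B < \<delta> \<and> (\<forall>\<omega>\<in>space M - B. P \<omega>)"
proof -
  have "prob (\<Inter>n. E n) = 0"
    using AE E(1) by (subst prob_eq_0) auto
  then have "(\<lambda>n. prob (E n)) \<longlonglongrightarrow> 0"
    using finite_Lim_measure_decseq[OF _ E(2)] E(1) by (simp add: image_subset_iff)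
  then have "eventually (\<lambda>n. prob (E n) < \<delta>) sequentially"
    by (rule order_tendstoD) fact
  then obtain n where n: "prob (E n) < \<delta>" by (auto simp: eventually_sequentially)
  \<comment> \<open>Enlarging \<open>E n\<close> by a measurable null set makes \<open>P\<close>,
    whose own set may fail to be measurable, hold everywhere off \<open>B\<close>.\<close>
  obtain N where N: "{\<omega>\<in>space M. \<not> P \<omega>} \<subseteq> N" "emeasure M N = 0" "N \<in> events"
    using ae by (auto elim: AE_E)
  have "prob (E n \<union> N) \<le> prob (E n) + prob N"
    using E N by (intro measure_Un_le) auto
  also have "prob N = 0" using N by (simp add: measure_def)
  finally show ?thesis using n E N by (intro exI[of _ n] bexI[of _ "E n \<union> N"]) auto
qed

text \<open>A supremum over all times need not give a measurable event, so the exceedance event is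
  taken over a countable dense set of times. It shrinks to a null event as the level grows, since
  continuous paths on a compact interval are bounded; continuity carries the bound back to all
  times.\<close>

lemma continuous_process_bounded:
  fixes X :: "real \<Rightarrow> 'a \<Rightarrow> real"
  assumes X[measurable]: "\<And>r. r \<in> {0..t} \<Longrightarrow> X r \<in> borel_measurable M"
    and cont: "AE \<omega> in M. continuous_on {0..t} (\<lambda>r. X r \<omega>)" and \<delta>: "\<delta> > 0"
  shows "\<exists>K\<ge>1. \<exists>B\<in>events. prob B < \<delta> \<and> (\<forall>\<omega>\<in>space M - B. \<forall>r\<in>{0..t}. \<bar>X r \<omega>\<bar> \<le> K)"
proof -
  obtain T where T: "countable T" "T \<subseteq> {0..t}" "{0..t} \<subseteq> closure T"
    using separable[of "{0..t}"] by metis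
  define E where "E n = {\<omega>\<in>space M. \<exists>r\<in>T. \<bar>X r \<omega>\<bar> > real (Suc n)}" for n
  have "\<exists>n. \<exists>B\<in>events. E n \<subseteq> B \<and> prob B < \<delta> \<and> (\<forall>\<omega>\<in>space M - B. continuous_on {0..t} (\<lambda>r. X r \<omega>))"
  proof (rule decseq_prob_small)
    fix n
    have "{\<omega>\<in>space M. \<bar>X r \<omega>\<bar> > real (Suc n)} \<in> events" if "r \<in> T" for r
      using T(2) that by (intro borel_measurable_less borel_measurable_abs X) auto
    then show "E n \<in> events" unfolding E_def by (intro sets.sets_Collect_countable_Ex' T)
  next
    show "decseq E" unfolding decseq_def E_def
    proof safe
      fix m n \<omega> r assume *: "m \<le> n" "\<omega> \<in> space M" "r \<in> T" "real (Suc n) < \<bar>X r \<omega>\<bar>"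
      then have "real (Suc m) < \<bar>X r \<omega>\<bar>" by linarith
      with * show "\<exists>r\<in>T. real (Suc m) < \<bar>X r \<omega>\<bar>" by blast
    qed
    show "AE \<omega> in M. \<exists>n. \<omega> \<notin> E n"
      using cont
    proof eventually_elim
      case (elim \<omega>)
      then have "bounded ((\<lambda>r. X r \<omega>) ` {0..t})"
        by (intro compact_imp_bounded compact_continuous_image) auto
      then obtain b where b: "\<forall>r\<in>{0..t}. \<bar>X r \<omega>\<bar> \<le> b" unfolding bounded_iff by auto
      obtain n where "b \<le> real n" using real_arch_simple by blast
      then have "\<not> real (Suc n) < \<bar>X r \<omega>\<bar>" if "r \<in> T" for r
        using b T(2) that by (force simp: subset_iff)
      then have "\<omega> \<notin> E n" unfolding E_def by blast
      then show ?case by blast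
    qed
  qed (fact cont, fact \<delta>)
  then obtain n B where B: "B \<in> events" "E n \<subseteq> B" "prob B < \<delta>" "\<And>\<omega>. \<omega> \<in> space M - B \<Longrightarrow> continuous_on {0..t} (\<lambda>r. X r \<omega>)"
    by blast
  have "\<bar>X r \<omega>\<bar> \<le> real (Suc n)" if \<omega>: "\<omega> \<in> space M - B" and r: "r \<in> {0..t}" for \<omega> r
  proof -
    obtain s where s: "\<And>k. s k \<in> T" "s \<longlonglongrightarrow> r"
      using r T(3) closure_sequential by (metis subsetD)
    have "(\<lambda>k. X (s k) \<omega>) \<longlonglongrightarrow> X r \<omega>"
      using B(4)[OF \<omega>] r s T(2) by (auto simp: continuous_on_sequentially o_def subset_iff)
    moreover have "\<bar>X (s k) \<omega>\<bar> \<le> real (Suc n)" for k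
      using \<omega> B(2) s(1)[of k] by (force simp: E_def)
    ultimately show ?thesis
      by (intro LIMSEQ_le_const2[OF tendsto_rabs]) auto
  qed
  then show ?thesis using B by (intro exI[of _ "real (Suc n)"] conjI bexI[of _ B]) auto
qed

text \<open>The same device with pairs of times: by uniform continuity on the compact interval the
  bad events for the moduli \<open>1 / Suc n\<close> decrease to a null event. The strict inequality
  between two times survives approximation by dense times, and the bound \<eta> survives the limit
  as a weak one.\<close>

lemma continuous_process_oscillation:
  fixes X :: "real \<Rightarrow> 'a \<Rightarrow> real"
  assumes X[measurable]: "\<And>r. r \<in> {0..t} \<Longrightarrow> X r \<in> borel_measurable M"
    and cont: "AE \<omega> in M. continuous_on {0..t} (\<lambda>r. X r \<omega>)" and \<delta>: "\<delta> > 0" and \<eta>: "\<eta> > 0"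
  shows "\<exists>\<rho>>0. \<exists>B\<in>events. prob B < \<delta> \<and> (\<forall>\<omega>\<in>space M - B. continuous_on {0..t} (\<lambda>r. X r \<omega>) \<and>
           (\<forall>r\<in>{0..t}. \<forall>r'\<in>{0..t}. \<bar>r - r'\<bar> < \<rho> \<longrightarrow> \<bar>X r \<omega> - X r' \<omega>\<bar> \<le> \<eta>))"
proof -
  obtain T where T: "countable T" "T \<subseteq> {0..t}" "{0..t} \<subseteq> closure T"
    using separable[of "{0..t}"] by metis
  define E where "E n = {\<omega>\<in>space M. \<exists>r\<in>T. \<exists>r'\<in>T. \<bar>r - r'\<bar> < 1 / real (Suc n) \<and> \<bar>X r \<omega> - X r' \<omega>\<bar> > \<eta>}" for n
  have "\<exists>n. \<exists>B\<in>events. E n \<subseteq> B \<and> prob B < \<delta> \<and> (\<forall>\<omega>\<in>space M - B. continuous_on {0..t} (\<lambda>r. X r \<omega>))"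
  proof (rule decseq_prob_small)
    fix n
    have "{\<omega>\<in>space M. \<bar>r - r'\<bar> < 1 / real (Suc n) \<and> \<bar>X r \<omega> - X r' \<omega>\<bar> > \<eta>} \<in> events" if "r \<in> T" "r' \<in> T" for r r'
      using T(2) that by (intro sets.sets_Collect_conj sets.sets_Collect_const borel_measurable_less borel_measurable_abs borel_measurable_diff X) auto
    then show "E n \<in> events" unfolding E_def by (intro sets.sets_Collect_countable_Ex' T)
  next
    show "decseq E" unfolding decseq_def E_def
    proof safe
      fix m n \<omega> r r' assume *: "m \<le> n" "\<omega> \<in> space M" "r \<in> T" "r' \<in> T" "\<bar>r - r'\<bar> < 1 / real (Suc n)" "\<eta> < \<bar>X r \<omega> - X r' \<omega>\<bar>"
      have "1 / real (Suc n) \<le> 1 / real (Suc m)" using * by (intro divide_left_mono) auto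
      then show "\<exists>r\<in>T. \<exists>r'\<in>T. \<bar>r - r'\<bar> < 1 / real (Suc m) \<and> \<eta> < \<bar>X r \<omega> - X r' \<omega>\<bar>"
        using * by (meson order_less_le_trans)
    qed
    show "AE \<omega> in M. \<exists>n. \<omega> \<notin> E n"
      using cont
    proof eventually_elim
      case (elim \<omega>)
      then have "uniformly_continuous_on {0..t} (\<lambda>r. X r \<omega>)"
        by (intro compact_uniformly_continuous) auto
      then obtain \<rho> where \<rho>: "\<rho> > 0" "\<And>r r'. r \<in> {0..t} \<Longrightarrow> r' \<in> {0..t} \<Longrightarrow> \<bar>r - r'\<bar> < \<rho> \<Longrightarrow> \<bar>X r \<omega> - X r' \<omega>\<bar> < \<eta>"
        unfolding uniformly_continuous_on_def using \<eta> by (metis dist_real_def)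
      obtain n where "1 / real (Suc n) < \<rho>" using \<rho>(1) nat_approx_posE by blast
      then have "\<not> \<bar>X r \<omega> - X r' \<omega>\<bar> > \<eta>" if "r \<in> T" "r' \<in> T" "\<bar>r - r'\<bar> < 1 / real (Suc n)" for r r'
        using \<rho>(2)[of r r'] T(2) that by (auto simp: subset_iff)
      then have "\<omega> \<notin> E n" unfolding E_def by blast
      then show ?case by blast
    qed
  qed (fact cont, fact \<delta>)
  then obtain n B where B: "B \<in> events" "E n \<subseteq> B" "prob B < \<delta>" "\<And>\<omega>. \<omega> \<in> space M - B \<Longrightarrow> continuous_on {0..t} (\<lambda>r. X r \<omega>)"
    by blast
  have "\<bar>X r \<omega> - X r' \<omega>\<bar> \<le> \<eta>" if \<omega>: "\<omega> \<in> space M - B" and r: "r \<in> {0..t}" "r' \<in> {0..t}" "\<bar>r - r'\<bar> < 1 / real (Suc n)" for \<omega> r r'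
  proof -
    obtain s where s: "\<And>k. s k \<in> T" "s \<longlonglongrightarrow> r"
      using r T(3) closure_sequential by (metis subsetD)
    obtain s' where s': "\<And>k. s' k \<in> T" "s' \<longlonglongrightarrow> r'"
      using r T(3) closure_sequential by (metis subsetD)
    have "(\<lambda>k. X (s k) \<omega>) \<longlonglongrightarrow> X r \<omega>" "(\<lambda>k. X (s' k) \<omega>) \<longlonglongrightarrow> X r' \<omega>"
      using B(4)[OF \<omega>] r s s' T(2) by (auto simp: continuous_on_sequentially o_def subset_iff)
    then have lim: "(\<lambda>k. \<bar>X (s k) \<omega> - X (s' k) \<omega>\<bar>) \<longlonglongrightarrow> \<bar>X r \<omega> - X r' \<omega>\<bar>"
      by (intro tendsto_rabs tendsto_diff)
    have "(\<lambda>k. \<bar>s k - s' k\<bar>) \<longlonglongrightarrow> \<bar>r - r'\<bar>"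
      by (intro tendsto_rabs tendsto_diff s s')
    then have "eventually (\<lambda>k. \<bar>s k - s' k\<bar> < 1 / real (Suc n)) sequentially"
      using r(3) by (rule order_tendstoD)
    then have "eventually (\<lambda>k. \<bar>X (s k) \<omega> - X (s' k) \<omega>\<bar> \<le> \<eta>) sequentially"
    proof eventually_elim
      case (elim k)
      then show ?case using \<omega> B(2) s(1)[of k] s'(1)[of k] unfolding E_def by (auto simp: not_less[symmetric] simp del: of_nat_Suc)
    qed
    then show ?thesis by (intro tendsto_upperbound[OF lim]) auto
  qed
  then show ?thesis using B by (intro exI[of _ "1 / real (Suc n)"] conjI bexI[of _ B]) auto
qed

end

section \<open>Ito integrals as limits of Riemann sums\<close>

lemma strict_step_less:
  fixes tp :: "nat \<Rightarrow> real"
  assumes "\<And>i. i < N \<Longrightarrow> tp i < tp (Suc i)" "i < j" "j \<le> N"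
  shows "tp i < tp j"
  using assms(2,3)
proof (induction j)
  case (Suc j)
  then show ?case using assms(1)[of j] by (cases "i = j") force+
qed simp

lemma strict_step_le:
  fixes tp :: "nat \<Rightarrow> real"
  assumes "\<And>i. i < N \<Longrightarrow> tp i < tp (Suc i)" "i \<le> j" "j \<le> N"
  shows "tp i \<le> tp j"
  using strict_step_less[of N tp i j] assms by (cases "i = j") auto

lemma strict_step_less_iff:
  fixes tp :: "nat \<Rightarrow> real"
  assumes "\<And>i. i < N \<Longrightarrow> tp i < tp (Suc i)" "i \<le> N" "j \<le> N"
  shows "tp i < tp j \<longleftrightarrow> i < j"
  using strict_step_less[of N tp i j] strict_step_le[of N tp j i] assms by (meson not_less)

lemma step_function_value:
  fixes tp :: "nat \<Rightarrow> real" and x :: "nat \<Rightarrow> real"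
  assumes "\<And>i. i < n \<Longrightarrow> tp i < tp (Suc i)" "i < n" "r \<in> {tp i<..tp (Suc i)}"
  shows "(\<Sum>j<n. indicator {tp j<..tp (Suc j)} r * x j) = x i"
proof -
  have "indicator {tp j<..tp (Suc j)} r * x j = (if j = i then x j else 0)" if "j < n" for j
  proof (cases "j = i")
    case False
    then consider "Suc j \<le> i" | "Suc i \<le> j" by linarith
    then have "r \<notin> {tp j<..tp (Suc j)}"
    proof cases
      case 1
      then have "tp (Suc j) \<le> tp i" using assms by (intro strict_step_le[of n]) auto
      then show ?thesis using assms(3) by auto
    next
      case 2
      then have "tp (Suc i) \<le> tp j" using assms that by (intro strict_step_le[of n]) auto
      then show ?thesis using assms(3) by auto
    qed
    with False show ?thesis by auto
  qed (use assms(3) in auto)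
  then have "(\<Sum>j<n. indicator {tp j<..tp (Suc j)} r * x j) = (\<Sum>j<n. if j = i then x j else 0)"
    by (intro sum.cong) auto
  also have "\<dots> = x i" using assms(2) by simp
  finally show ?thesis .
qed

section \<open>Sums of adapted coefficients times functions of Brownian increments\<close>

context brownian begin

text \<open>The summands are martingale differences: in a cross term the partial sum and
  \<open>c n\<close> belong to the past, and the centred factor is independent of it. The induction
  carries adaptedness of the partial sum for exactly this reason. The functions
  \<open>\<psi> i\<close> are general so that both plain increments and centred Euler defects are
  covered.\<close>

lemma orthogonal_sum:
  fixes tp :: "nat \<Rightarrow> real" and c :: "nat \<Rightarrow> 'w \<Rightarrow> real" and \<psi> :: "nat \<Rightarrow> real \<Rightarrow> real"
  defines "\<rho> \<equiv> \<lambda>i \<omega>. c i \<omega> * \<psi> i (W (tp (Suc i)) \<omega> - W (tp i) \<omega>)"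
  assumes tp0: "0 \<le> tp 0" and tp: "\<And>i. i < N \<Longrightarrow> tp i < tp (Suc i)"
    and c: "\<And>i. i < N \<Longrightarrow> c i \<in> borel_measurable (F (tp i))"
    and K: "\<And>i \<omega>. i < N \<Longrightarrow> \<omega> \<in> space M \<Longrightarrow> \<bar>c i \<omega>\<bar> \<le> K i"
    and \<psi>: "\<And>i. i < N \<Longrightarrow> \<psi> i \<in> borel_measurable borel"
    and m1: "\<And>i. i < N \<Longrightarrow> has_bochner_integral M (\<lambda>\<omega>. \<psi> i (W (tp (Suc i)) \<omega> - W (tp i) \<omega>)) 0"
    and m2: "\<And>i. i < N \<Longrightarrow> has_bochner_integral M (\<lambda>\<omega>. (\<psi> i (W (tp (Suc i)) \<omega> - W (tp i) \<omega>))\<^sup>2) (v i)"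
  shows "has_bochner_integral M (\<lambda>\<omega>. (\<Sum>i<N. \<rho> i \<omega>)\<^sup>2) (\<Sum>i<N. expectation (\<lambda>\<omega>. (c i \<omega>)\<^sup>2) * v i)"
proof -
  have tpn: "0 \<le> tp i" if "i \<le> N" for i
    using strict_step_le[of N tp 0 i] tp tp0 that by auto
  have "(\<lambda>\<omega>. \<Sum>i<n. \<rho> i \<omega>) \<in> borel_measurable (F (tp n)) \<and>
    has_bochner_integral M (\<lambda>\<omega>. (\<Sum>i<n. \<rho> i \<omega>)\<^sup>2) (\<Sum>i<n. expectation (\<lambda>\<omega>. (c i \<omega>)\<^sup>2) * v i)"
    if "n \<le> N" for n
    using that
  proof (induction n)
    case 0 then show ?case by (simp add: has_bochner_integral_zero)
  next
    case (Suc n)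
    then have n: "n < N" and IHm: "(\<lambda>\<omega>. \<Sum>i<n. \<rho> i \<omega>) \<in> borel_measurable (F (tp n))"
      and IHi: "has_bochner_integral M (\<lambda>\<omega>. (\<Sum>i<n. \<rho> i \<omega>)\<^sup>2) (\<Sum>i<n. expectation (\<lambda>\<omega>. (c i \<omega>)\<^sup>2) * v i)"
      by auto
    let ?S = "\<lambda>\<omega>. \<Sum>i<n. \<rho> i \<omega>" and ?D = "\<lambda>\<omega>. \<psi> n (W (tp (Suc n)) \<omega> - W (tp n) \<omega>)"
    let ?a = "tp n" and ?b = "tp (Suc n)"
    have ab: "0 \<le> ?a" "?a < ?b" using tpn n tp by auto
    have mono: "f \<in> borel_measurable (F ?a) \<Longrightarrow> f \<in> borel_measurable (F ?b)" for f :: "'w \<Rightarrow> real"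
      using measurable_nat_filt_mono ab by (metis less_imp_le)
    have "(\<lambda>\<omega>. W ?b \<omega> - W ?a \<omega>) \<in> borel_measurable (F ?b)"
      using ab by (intro borel_measurable_diff W_adapted) auto
    then have "\<rho> n \<in> borel_measurable (F ?b)"
      unfolding \<rho>_def using \<psi>[OF n] mono[OF c[OF n]]
      by (intro borel_measurable_times) (auto intro: measurable_compose)
    with mono[OF IHm] have m: "(\<lambda>\<omega>. \<Sum>i<Suc n. \<rho> i \<omega>) \<in> borel_measurable (F ?b)" by simp
    have SM: "?S \<in> borel_measurable M" by (rule measurable_F[OF IHm])
    have cM: "c n \<in> borel_measurable M" by (rule measurable_F[OF c[OF n]])
    have iS: "integrable M ?S" "integrable M (\<lambda>\<omega>. (?S \<omega>)\<^sup>2)"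
      using square_integrable_imp_integrable[OF SM] IHi by (auto simp: has_bochner_integral_iff)
    \<comment> \<open>Boundedness of \<open>c n\<close> makes the past factor of the cross term
      integrable, as the product rule for expectations requires.\<close>
    have iSc: "integrable M (\<lambda>\<omega>. ?S \<omega> * c n \<omega>)"
    proof (rule Bochner_Integration.integrable_bound[of _ "\<lambda>\<omega>. K n * ?S \<omega>"])
      show "AE \<omega> in M. norm (?S \<omega> * c n \<omega>) \<le> norm (K n * ?S \<omega>)"
      proof (rule AE_I2)
        fix \<omega> assume "\<omega> \<in> space M"
        then have "\<bar>c n \<omega>\<bar> \<le> \<bar>K n\<bar>" using K[OF n, of \<omega>] by linarith
        then show "norm (?S \<omega> * c n \<omega>) \<le> norm (K n * ?S \<omega>)"
          by (simp add: abs_mult mult.commute mult_right_mono)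
      qed
    qed (use iS SM cM in auto)
    have ic2: "integrable M (\<lambda>\<omega>. (c n \<omega>)\<^sup>2)"
      by (rule integrable_const_bound[of _ "(K n)\<^sup>2"])
         (use K[OF n] cM in \<open>auto intro!: power2_le_iff_abs_le[THEN iffD2] AE_I2 intro: order_trans[OF abs_ge_zero]\<close>)
    have iD: "integrable M ?D" "expectation ?D = 0" "integrable M (\<lambda>\<omega>. (?D \<omega>)\<^sup>2)" "expectation (\<lambda>\<omega>. (?D \<omega>)\<^sup>2) = v n"
      using m1[OF n] m2[OF n] by (auto simp: has_bochner_integral_iff)
    have t2: "has_bochner_integral M (\<lambda>\<omega>. (?S \<omega> * c n \<omega>) * ?D \<omega>) 0"
      using integrable_mult_increment[OF ab _ iSc \<psi>[OF n] iD(1)] expectation_mult_increment[OF ab _ iSc \<psi>[OF n] iD(1)]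
        IHm c[OF n] iD(2) by (simp add: has_bochner_integral_iff)
    have \<psi>2: "(\<lambda>x. (\<psi> n x)\<^sup>2) \<in> borel_measurable borel" using \<psi>[OF n] by simp
    have t3: "has_bochner_integral M (\<lambda>\<omega>. (c n \<omega>)\<^sup>2 * (?D \<omega>)\<^sup>2) (expectation (\<lambda>\<omega>. (c n \<omega>)\<^sup>2) * v n)"
      using integrable_mult_increment[OF ab _ ic2 \<psi>2 iD(3)] expectation_mult_increment[OF ab _ ic2 \<psi>2 iD(3)]
        c[OF n] iD(4) by (simp add: has_bochner_integral_iff)
    have "has_bochner_integral M (\<lambda>\<omega>. (?S \<omega>)\<^sup>2 + 2 * ((?S \<omega> * c n \<omega>) * ?D \<omega>) + (c n \<omega>)\<^sup>2 * (?D \<omega>)\<^sup>2)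
      ((\<Sum>i<n. expectation (\<lambda>\<omega>. (c i \<omega>)\<^sup>2) * v i) + 2 * 0 + expectation (\<lambda>\<omega>. (c n \<omega>)\<^sup>2) * v n)"
      by (intro has_bochner_integral_add has_bochner_integral_mult_right IHi t2 t3)
    moreover have "(\<lambda>\<omega>. (?S \<omega>)\<^sup>2 + 2 * ((?S \<omega> * c n \<omega>) * ?D \<omega>) + (c n \<omega>)\<^sup>2 * (?D \<omega>)\<^sup>2) = (\<lambda>\<omega>. (\<Sum>i<Suc n. \<rho> i \<omega>)\<^sup>2)"
      by (rule ext) (simp add: \<rho>_def power2_eq_square algebra_simps)
    ultimately show ?case using m by simp
  qed
  then show ?thesis by simp
qed

text \<open>Lenglart's domination inequality for simple integrands: the integrand is cut off at the first
  partition point where its quadratic variation would exceed \<open>\<delta>\<close>, which keeps it adapted.\<close>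

lemma simple_sum_prob_norm_le:
  fixes tp :: "nat \<Rightarrow> real" and c :: "nat \<Rightarrow> 'w \<Rightarrow> real"
  assumes tp0: "0 \<le> tp 0" and tp: "\<And>i. i < N \<Longrightarrow> tp i < tp (Suc i)"
    and c: "\<And>i. i < N \<Longrightarrow> c i \<in> borel_measurable (F (tp i))"
    and \<delta>: "\<delta> > 0" and A: "A \<in> events" "{\<omega>\<in>space M. (\<Sum>i<N. (c i \<omega>)\<^sup>2 * (tp (Suc i) - tp i)) > \<delta>} \<subseteq> A"
  shows "prob_norm (\<lambda>\<omega>. \<Sum>i<N. c i \<omega> * (W (tp (Suc i)) \<omega> - W (tp i) \<omega>)) \<le> sqrt \<delta> + prob A"
proof -
  define Q where "Q n \<omega> = (\<Sum>l<n. (c l \<omega>)\<^sup>2 * (tp (Suc l) - tp l))" for n \<omega>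
  \<comment> \<open>\<open>Q (Suc i)\<close> contains the contribution of step \<open>i\<close>
    itself, yet involves only coefficients up to \<open>c i\<close>, all known at time
    \<open>tp i\<close>. As \<open>Q\<close> is nondecreasing, a coefficient once cut stays
    cut.\<close>
  define c' where "c' i \<omega> = (if Q (Suc i) \<omega> \<le> \<delta> then c i \<omega> else 0)" for i \<omega>
  have pos: "0 \<le> (c l \<omega>)\<^sup>2 * (tp (Suc l) - tp l)" if "l < N" for l \<omega>
    using tp[OF that] by simp
  have Qmono: "Q i \<omega> \<le> Q j \<omega>" if "i \<le> j" "j \<le> N" for i j \<omega>
    unfolding Q_def using that pos by (intro sum_mono2) auto
  have tpn: "0 \<le> tp i" if "i \<le> N" for i
    using strict_step_le[of N tp 0 i] tp tp0 that by auto
  have c'm: "c' i \<in> borel_measurable (F (tp i))" if i: "i < N" for i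
  proof -
    have cl: "c l \<in> borel_measurable (F (tp i))" if "l < Suc i" for l
      using that i tp by (intro measurable_nat_filt_mono[OF c[of l]] strict_step_le[of N]) auto
    have [measurable]: "Q (Suc i) \<in> borel_measurable (F (tp i))"
      unfolding Q_def using cl by (intro borel_measurable_sum borel_measurable_times borel_measurable_power) auto
    have [measurable]: "c i \<in> borel_measurable (F (tp i))" by (rule c[OF i])
    show ?thesis unfolding c'_def by measurable
  qed
  have c'2: "(c' i \<omega>)\<^sup>2 * (tp (Suc i) - tp i) \<le> \<delta>" if i: "i < N" for i \<omega>
  proof (cases "Q (Suc i) \<omega> \<le> \<delta>")
    case True
    have "0 \<le> Q i \<omega>" unfolding Q_def using i by (intro sum_nonneg pos) auto
    with True show ?thesis by (simp add: c'_def Q_def)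
  qed (use \<delta> in \<open>simp add: c'_def\<close>)
  \<comment> \<open>A surviving coefficient contributes at most \<delta> on its own, so the cut-off
    also bounds coefficients that were not assumed bounded.\<close>
  have c'K: "\<bar>c' i \<omega>\<bar> \<le> sqrt (\<delta> / (tp (Suc i) - tp i))" if "i < N" for i \<omega>
    using c'2[OF that, of \<omega>] tp[OF that] by (intro real_le_rsqrt) (simp add: field_simps)
  have sumc': "(\<Sum>i<n. (c' i \<omega>)\<^sup>2 * (tp (Suc i) - tp i)) \<le> \<delta>" if "n \<le> N" for n \<omega>
    using that
  proof (induction n)
    case (Suc n)
    show ?case
    proof (cases "Q (Suc n) \<omega> \<le> \<delta>")
      case True
      have "(\<Sum>i<Suc n. (c' i \<omega>)\<^sup>2 * (tp (Suc i) - tp i)) \<le> Q (Suc n) \<omega>"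
        unfolding Q_def using Suc.prems pos by (intro sum_mono) (auto simp: c'_def)
      with True show ?thesis by simp
    next
      case False
      with Suc show ?thesis by (simp add: c'_def)
    qed
  qed (use \<delta> in simp)
  let ?S' = "\<lambda>\<omega>. \<Sum>i<N. c' i \<omega> * (W (tp (Suc i)) \<omega> - W (tp i) \<omega>)"
  have E: "has_bochner_integral M (\<lambda>\<omega>. (?S' \<omega>)\<^sup>2) (\<Sum>i<N. expectation (\<lambda>\<omega>. (c' i \<omega>)\<^sup>2) * (tp (Suc i) - tp i))"
    by (rule orthogonal_sum[where \<psi>="\<lambda>_ x. x", OF tp0 tp c'm c'K]) (use tpn tp in \<open>auto intro!: increment_mean increment_square\<close>)
  have c'M: "c' i \<in> borel_measurable M" if "i < N" for i by (rule measurable_F[OF c'm[OF that]])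
  have ic': "integrable M (\<lambda>\<omega>. (c' i \<omega>)\<^sup>2)" if "i < N" for i
  proof (rule integrable_const_bound[of _ "\<delta> / (tp (Suc i) - tp i)"])
    show "AE \<omega> in M. norm ((c' i \<omega>)\<^sup>2) \<le> \<delta> / (tp (Suc i) - tp i)"
      using c'2[OF that] tp[OF that] by (auto simp: field_simps)
  qed (use c'M[OF that] in simp)
  have "(\<Sum>i<N. expectation (\<lambda>\<omega>. (c' i \<omega>)\<^sup>2) * (tp (Suc i) - tp i))
      = expectation (\<lambda>\<omega>. \<Sum>i<N. (c' i \<omega>)\<^sup>2 * (tp (Suc i) - tp i))"
    using ic' by (subst Bochner_Integration.integral_sum) auto
  also have "\<dots> \<le> expectation (\<lambda>_. \<delta>)"
    using ic' sumc'[of N] by (intro integral_mono) auto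
  finally have le: "(\<Sum>i<N. expectation (\<lambda>\<omega>. (c' i \<omega>)\<^sup>2) * (tp (Suc i) - tp i)) \<le> \<delta>" by (simp add: prob_space)
  have W: "W (tp i) \<in> borel_measurable M" if "i \<le> N" for i using tpn[OF that] by simp
  have cM: "c i \<in> borel_measurable M" if "i < N" for i by (rule measurable_F[OF c[OF that]])
  have S'M: "?S' \<in> borel_measurable M"
    using c'M W by (intro borel_measurable_sum borel_measurable_times borel_measurable_diff) auto
  have SM: "(\<lambda>\<omega>. \<Sum>i<N. c i \<omega> * (W (tp (Suc i)) \<omega> - W (tp i) \<omega>)) \<in> borel_measurable M"
    using cM W by (intro borel_measurable_sum borel_measurable_times borel_measurable_diff) auto
  have "prob_norm (\<lambda>\<omega>. \<Sum>i<N. c i \<omega> * (W (tp (Suc i)) \<omega> - W (tp i) \<omega>)) \<le> prob_norm ?S' + prob A"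
  proof (intro prob_norm_le_AE AE_I2 impI)
    fix \<omega> assume \<omega>: "\<omega> \<in> space M" "\<omega> \<notin> A"
    then have "Q N \<omega> \<le> \<delta>" using A(2) by (auto simp: Q_def not_less)
    then have "c' i \<omega> = c i \<omega>" if "i < N" for i
      using Qmono[of "Suc i" N \<omega>] that by (auto simp: c'_def)
    then show "\<bar>\<Sum>i<N. c i \<omega> * (W (tp (Suc i)) \<omega> - W (tp i) \<omega>)\<bar> \<le> \<bar>?S' \<omega>\<bar>" by simp
  qed (use S'M SM A in auto)
  also have "prob_norm ?S' \<le> sqrt \<delta>"
  proof -
    have "prob_norm ?S' \<le> sqrt (expectation (\<lambda>\<omega>. (?S' \<omega>)\<^sup>2))"
      using E S'M by (intro prob_norm_le_sqrt) (auto simp: has_bochner_integral_iff)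
    also have "\<dots> \<le> sqrt \<delta>" using E le by (auto simp: has_bochner_integral_iff)
    finally show ?thesis .
  qed
  finally show ?thesis by simp
qed

text \<open>Two simple processes come with unrelated partitions, while the domination inequality
  concerns a single one; the common refinement reconciles them. On a cell of the refinement each
  process is constant. As the cell is open on the left, its right end point serves as
  representative, although the value there is already known at the left end point.\<close>

lemma simple_ito_diff:
  fixes g g' :: "real \<Rightarrow> 'w \<Rightarrow> real"
  assumes "simple_ito M W a b g I" "simple_ito M W a b g' I'"
  shows "simple_ito M W a b (\<lambda>s \<omega>. g s \<omega> - g' s \<omega>) (\<lambda>\<omega>. I \<omega> - I' \<omega>)"
proof -
  obtain n tp \<xi> where g: "tp 0 = a" "tp n = b" "\<And>i. i < n \<Longrightarrow> tp i < tp (Suc i)"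
    "\<And>i. i < n \<Longrightarrow> \<xi> i \<in> borel_measurable (F (tp i))"
    "\<And>s \<omega>. g s \<omega> = (\<Sum>i<n. indicator {tp i<..tp (Suc i)} s *\<^sub>R \<xi> i \<omega>)"
    "\<And>\<omega>. I \<omega> = (\<Sum>i<n. (W (tp (Suc i)) \<omega> - W (tp i) \<omega>) *\<^sub>R \<xi> i \<omega>)"
    using assms(1) unfolding simple_ito_def by blast
  obtain n' tp' \<xi>' where g': "tp' 0 = a" "tp' n' = b" "\<And>i. i < n' \<Longrightarrow> tp' i < tp' (Suc i)"
    "\<And>i. i < n' \<Longrightarrow> \<xi>' i \<in> borel_measurable (F (tp' i))"
    "\<And>s \<omega>. g' s \<omega> = (\<Sum>i<n'. indicator {tp' i<..tp' (Suc i)} s *\<^sub>R \<xi>' i \<omega>)"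
    "\<And>\<omega>. I' \<omega> = (\<Sum>i<n'. (W (tp' (Suc i)) \<omega> - W (tp' i) \<omega>) *\<^sub>R \<xi>' i \<omega>)"
    using assms(2) unfolding simple_ito_def by blast
  define P where "P = tp ` {..n} \<union> tp' ` {..n'}"
  have P: "finite P" "P \<noteq> {}" by (auto simp: P_def)
  obtain N q where q: "\<And>i. i < N \<Longrightarrow> q i < q (Suc i)" "P = q ` {..N}" "q 0 = Min P" "q N = Max P"
    using finite_set_strict_enum[OF P] by blast
  have bnd: "a \<le> tp i" "tp i \<le> b" if "i \<le> n" for i
    using strict_step_le[of n tp 0 i] strict_step_le[of n tp i n] that g by auto
  have bnd': "a \<le> tp' i" "tp' i \<le> b" if "i \<le> n'" for i
    using strict_step_le[of n' tp' 0 i] strict_step_le[of n' tp' i n'] that g' by auto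
  have "a \<in> P" "b \<in> P" using g(1,2) by (auto simp: P_def)
  then have q0: "q 0 = a" "q N = b" unfolding q(3,4)
    using P bnd bnd' by (auto simp: P_def intro!: Min_eqI Max_eqI)
  \<comment> \<open>Stated for an arbitrary simple process with partition points in
    \<open>P\<close>, to be applied to \<open>g\<close> and to \<open>g'\<close>. The premise on
    \<open>j\<close> also governs the second part, which is why an empty grid is treated separately
    below.\<close>
  have key: "(\<forall>r\<in>{q j<..q (Suc j)}. \<forall>\<omega>. h r \<omega> = h (q (Suc j)) \<omega>) \<and> h (q (Suc j)) \<in> borel_measurable (F (q j))"
      "J \<omega> = (\<Sum>j<N. (W (q (Suc j)) \<omega> - W (q j) \<omega>) * h (q (Suc j)) \<omega>)"
      if "j < N" "tq ` {..m} \<subseteq> P" "\<And>i. i < m \<Longrightarrow> tq i < tq (Suc i)" "\<And>i. i < m \<Longrightarrow> \<zeta> i \<in> borel_measurable (F (tq i))"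
       "\<And>s \<omega>. h s \<omega> = (\<Sum>i<m. indicator {tq i<..tq (Suc i)} s *\<^sub>R \<zeta> i \<omega>)"
       "\<And>\<omega>. J \<omega> = (\<Sum>i<m. (W (tq (Suc i)) \<omega> - W (tq i) \<omega>) *\<^sub>R \<zeta> i \<omega>)"
      for m :: nat and tq and \<zeta> :: "nat \<Rightarrow> 'w \<Rightarrow> real" and h J j \<omega>
  proof -
    note tq = that(3) and \<zeta> = that(4) and h = that(5) and J = that(6)
    have "\<forall>i\<in>{..m}. \<exists>k\<le>N. q k = tq i" using that(2) q(2) by force
    then obtain k where k: "\<And>i. i \<le> m \<Longrightarrow> k i \<le> N" "\<And>i. i \<le> m \<Longrightarrow> q (k i) = tq i"
      unfolding bchoice_iff by auto
    have kle: "k i \<le> k (Suc i)" if "i < m" for i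
    proof -
      have "q (k i) < q (k (Suc i))" using k that tq by simp
      then show ?thesis using strict_step_less_iff[of N q "k i" "k (Suc i)", OF q(1)] k that by simp
    qed
    \<comment> \<open>With \<open>k\<close> locating the original points among the \<open>q\<close>,
      membership of a cell becomes a comparison of indices.\<close>
    have iff: "r \<in> {tq i<..tq (Suc i)} \<longleftrightarrow> k i \<le> j \<and> j < k (Suc i)"
      if "r \<in> {q j<..q (Suc j)}" "i < m" "j < N" for r i j
    proof -
      have "tq i < r \<longleftrightarrow> k i \<le> j"
      proof
        assume "tq i < r"
        then have "q (k i) < q (Suc j)" using that k(2)[of i] by simp
        then show "k i \<le> j" using strict_step_less_iff[of N q "k i" "Suc j", OF q(1)] k(1)[of i] that by simp
      next
        assume "k i \<le> j"
        then have "q (k i) \<le> q j" using strict_step_le[of N q "k i" j, OF q(1)] that by simp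
        then show "tq i < r" using that k(2)[of i] by simp
      qed
      moreover have "r \<le> tq (Suc i) \<longleftrightarrow> j < k (Suc i)"
      proof
        assume "r \<le> tq (Suc i)"
        then have "q j < q (k (Suc i))" using that k(2)[of "Suc i"] by simp
        then show "j < k (Suc i)" using strict_step_less_iff[of N q j "k (Suc i)", OF q(1)] k(1)[of "Suc i"] that by simp
      next
        assume "j < k (Suc i)"
        then have "q (Suc j) \<le> q (k (Suc i))" using strict_step_le[of N q "Suc j" "k (Suc i)", OF q(1)] k(1)[of "Suc i"] that by simp
        then show "r \<le> tq (Suc i)" using that k(2)[of "Suc i"] by simp
      qed
      ultimately show ?thesis by auto
    qed
    have hval: "h r \<omega> = (\<Sum>i<m. if k i \<le> j \<and> j < k (Suc i) then \<zeta> i \<omega> else 0)"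
      if "r \<in> {q j<..q (Suc j)}" "j < N" for r \<omega> j
      unfolding h using iff[OF that(1) _ that(2)]
      by (intro sum.cong) (auto simp: indicator_def)
    have rr: "q (Suc j) \<in> {q j<..q (Suc j)}" if "j < N" for j using q(1)[OF that] by simp
    show "(\<forall>r\<in>{q j<..q (Suc j)}. \<forall>\<omega>. h r \<omega> = h (q (Suc j)) \<omega>) \<and> h (q (Suc j)) \<in> borel_measurable (F (q j))"
    proof (intro conjI ballI allI)
      show "h r \<omega> = h (q (Suc j)) \<omega>" if "r \<in> {q j<..q (Suc j)}" for r \<omega>
        using hval[OF that \<open>j < N\<close>] hval[OF rr[OF \<open>j < N\<close>] \<open>j < N\<close>] by simp
      have "(\<lambda>\<omega>. \<Sum>i<m. if k i \<le> j \<and> j < k (Suc i) then \<zeta> i \<omega> else 0) \<in> borel_measurable (F (q j))"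
      proof (intro borel_measurable_sum)
        fix i assume i: "i \<in> {..<m}"
        show "(\<lambda>\<omega>. if k i \<le> j \<and> j < k (Suc i) then \<zeta> i \<omega> else 0) \<in> borel_measurable (F (q j))"
        proof (cases "k i \<le> j \<and> j < k (Suc i)")
          case True
          then have "tq i \<le> q j" using strict_step_le[of N q "k i" j, OF q(1)] \<open>j < N\<close> k(2)[of i] i by simp
          then have "\<zeta> i \<in> borel_measurable (F (q j))"
            using i by (intro measurable_nat_filt_mono[OF \<zeta>]) auto
          with True show ?thesis by simp
        qed auto
      qed
      also have "(\<lambda>\<omega>. \<Sum>i<m. if k i \<le> j \<and> j < k (Suc i) then \<zeta> i \<omega> else 0) = h (q (Suc j))"
        using hval[OF rr[OF \<open>j < N\<close>] \<open>j < N\<close>] by (intro ext) simp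
      finally show "h (q (Suc j)) \<in> borel_measurable (F (q j))" .
    qed
    have tel: "(\<Sum>j<N. if k i \<le> j \<and> j < k (Suc i) then W (q (Suc j)) \<omega> - W (q j) \<omega> else 0) = W (tq (Suc i)) \<omega> - W (tq i) \<omega>"
      if i: "i < m" for i
    proof -
      have "(\<Sum>j<N. if k i \<le> j \<and> j < k (Suc i) then W (q (Suc j)) \<omega> - W (q j) \<omega> else 0)
         = (\<Sum>j\<in>{k i..<k (Suc i)}. W (q (Suc j)) \<omega> - W (q j) \<omega>)"
        using k(1)[of "Suc i"] i by (subst sum.inter_filter[symmetric]) (auto intro!: sum.cong)
      also have "\<dots> = W (q (k (Suc i))) \<omega> - W (q (k i)) \<omega>"
        by (rule sum_Suc_diff'[OF kle[OF i]])
      finally show ?thesis using k(2)[of i] k(2)[of "Suc i"] i by simp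
    qed
    have "(\<Sum>j<N. (W (q (Suc j)) \<omega> - W (q j) \<omega>) * h (q (Suc j)) \<omega>)
       = (\<Sum>j<N. \<Sum>i<m. (if k i \<le> j \<and> j < k (Suc i) then W (q (Suc j)) \<omega> - W (q j) \<omega> else 0) * \<zeta> i \<omega>)"
      using hval[OF rr] by (intro sum.cong) (auto simp: sum_distrib_left intro!: sum.cong)
    also have "\<dots> = (\<Sum>i<m. \<Sum>j<N. (if k i \<le> j \<and> j < k (Suc i) then W (q (Suc j)) \<omega> - W (q j) \<omega> else 0) * \<zeta> i \<omega>)"
      by (rule sum.swap)
    also have "\<dots> = J \<omega>"
      unfolding sum_distrib_right[symmetric] J using tel by (intro sum.cong) auto
    finally show "J \<omega> = (\<Sum>j<N. (W (q (Suc j)) \<omega> - W (q j) \<omega>) * h (q (Suc j)) \<omega>)" ..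
  qed
  have k1: "(\<forall>r\<in>{q j<..q (Suc j)}. \<forall>\<omega>. g r \<omega> = g (q (Suc j)) \<omega>) \<and> g (q (Suc j)) \<in> borel_measurable (F (q j))" if "j < N" for j
    by (rule key(1)[OF that _ g(3,4,5,6)]) (auto simp: P_def)
  have k1': "(\<forall>r\<in>{q j<..q (Suc j)}. \<forall>\<omega>. g' r \<omega> = g' (q (Suc j)) \<omega>) \<and> g' (q (Suc j)) \<in> borel_measurable (F (q j))" if "j < N" for j
    by (rule key(1)[OF that _ g'(3,4,5,6)]) (auto simp: P_def)
  show ?thesis
  proof (cases "N = 0")
    case True
    with q0 have "a = b" by simp
    have "n = 0" using g(1,2) strict_step_less[of n tp 0 n, OF g(3)] \<open>a = b\<close> by (cases "n = 0") auto
    moreover have "n' = 0" using g'(1,2) strict_step_less[of n' tp' 0 n', OF g'(3)] \<open>a = b\<close> by (cases "n' = 0") auto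
    ultimately show ?thesis unfolding simple_ito_def
      by (intro exI[of _ 0] exI[of _ "\<lambda>_. a"] exI[of _ \<xi>]) (use g g' in auto)
  next
    case False
    then have N: "0 < N" by simp
    have k2: "I \<omega> = (\<Sum>j<N. (W (q (Suc j)) \<omega> - W (q j) \<omega>) * g (q (Suc j)) \<omega>)" for \<omega>
      by (rule key(2)[OF N _ g(3,4,5,6)]) (auto simp: P_def)
    have k2': "I' \<omega> = (\<Sum>j<N. (W (q (Suc j)) \<omega> - W (q j) \<omega>) * g' (q (Suc j)) \<omega>)" for \<omega>
      by (rule key(2)[OF N _ g'(3,4,5,6)]) (auto simp: P_def)
    define \<zeta> where "\<zeta> j \<omega> = g (q (Suc j)) \<omega> - g' (q (Suc j)) \<omega>" for j \<omega>
    have val: "g s \<omega> - g' s \<omega> = (\<Sum>j<N. indicator {q j<..q (Suc j)} s *\<^sub>R \<zeta> j \<omega>)" for s \<omega>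
    proof (cases "\<exists>j<N. s \<in> {q j<..q (Suc j)}")
      case True
      then obtain j where j: "j < N" "s \<in> {q j<..q (Suc j)}" by blast
      have "(\<Sum>j<N. indicator {q j<..q (Suc j)} s *\<^sub>R \<zeta> j \<omega>) = \<zeta> j \<omega>"
        using step_function_value[of N q j s "\<lambda>j. \<zeta> j \<omega>", OF q(1) j] by simp
      also have "\<dots> = g s \<omega> - g' s \<omega>"
        unfolding \<zeta>_def k1[OF j(1), THEN conjunct1, rule_format, OF j(2)]
          k1'[OF j(1), THEN conjunct1, rule_format, OF j(2)] ..
      finally show ?thesis by simp
    next
      case False
      \<comment> \<open>A point of \<open>{a<..b}\<close> lies in the cell that ends at the first
        \<open>q j\<close> not below it. So a point in no cell is outside \<open>{a<..b}\<close>,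
        where both processes vanish.\<close>
      have out: "s \<notin> {a<..b}"
      proof
        assume s: "s \<in> {a<..b}"
        define j where "j = (LEAST j. s \<le> q j)"
        have "s \<le> q N" using s q0 by simp
        then have j: "s \<le> q j" "j \<le> N" unfolding j_def by (auto intro: LeastI Least_le)
        have "j \<noteq> 0" using j s q0 by (cases j) auto
        then obtain j' where j': "j = Suc j'" by (cases j) auto
        have "\<not> s \<le> q j'" using not_less_Least[of j' "\<lambda>j. s \<le> q j"] j' by (simp add: j_def)
        with False j j' show False by auto
      qed
      have "g s \<omega> = 0" unfolding g(5)
      proof (intro sum.neutral ballI)
        fix i assume "i \<in> {..<n}"
        then have "s \<notin> {tp i<..tp (Suc i)}" using bnd[of i] bnd[of "Suc i"] out by auto
        then show "indicator {tp i<..tp (Suc i)} s *\<^sub>R \<xi> i \<omega> = 0" by auto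
      qed
      moreover have "g' s \<omega> = 0" unfolding g'(5)
      proof (intro sum.neutral ballI)
        fix i assume "i \<in> {..<n'}"
        then have "s \<notin> {tp' i<..tp' (Suc i)}" using bnd'[of i] bnd'[of "Suc i"] out by auto
        then show "indicator {tp' i<..tp' (Suc i)} s *\<^sub>R \<xi>' i \<omega> = 0" by auto
      qed
      ultimately show ?thesis using False by (auto intro!: sum.neutral[symmetric])
    qed
    have "\<zeta> j \<in> borel_measurable (F (q j))" if "j < N" for j
      unfolding \<zeta>_def using k1[OF that] k1'[OF that] by (intro borel_measurable_diff) auto
    moreover have "I \<omega> - I' \<omega> = (\<Sum>j<N. (W (q (Suc j)) \<omega> - W (q j) \<omega>) *\<^sub>R \<zeta> j \<omega>)" for \<omega>
      unfolding k2 k2' by (simp add: \<zeta>_def right_diff_distrib sum_subtractf)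
    ultimately show ?thesis unfolding simple_ito_def
      using q0 q(1) val by (intro exI[of _ N] exI[of _ q] exI[of _ \<zeta>]) auto
  qed
qed

text \<open>The quadratic variation of a step function is at most the integral of its square over
  \<open>{a..b}\<close>, which pushes the event where it exceeds \<delta> into
  \<open>A\<close>.\<close>

lemma simple_ito_prob_norm_le:
  fixes g :: "real \<Rightarrow> 'w \<Rightarrow> real"
  assumes a: "0 \<le> a" and s: "simple_ito M W a b g I" and \<delta>: "\<delta> > 0" and A: "A \<in> events"
    "{\<omega>\<in>space M. set_nn_integral lborel {a..b} (\<lambda>s. ennreal ((g s \<omega>)\<^sup>2)) > ennreal \<delta>} \<subseteq> A"
  shows "I \<in> borel_measurable M" "prob_norm I \<le> sqrt \<delta> + prob A"
proof -
  obtain n tp \<xi> where g: "tp 0 = a" "tp n = b" "\<And>i. i < n \<Longrightarrow> tp i < tp (Suc i)"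
    "\<And>i. i < n \<Longrightarrow> \<xi> i \<in> borel_measurable (F (tp i))"
    "\<And>s \<omega>. g s \<omega> = (\<Sum>i<n. indicator {tp i<..tp (Suc i)} s *\<^sub>R \<xi> i \<omega>)"
    "\<And>\<omega>. I \<omega> = (\<Sum>i<n. (W (tp (Suc i)) \<omega> - W (tp i) \<omega>) *\<^sub>R \<xi> i \<omega>)"
    using s unfolding simple_ito_def by blast
  have bnd: "a \<le> tp i" "tp i \<le> b" if "i \<le> n" for i
    using strict_step_le[of n tp 0 i] strict_step_le[of n tp i n] that g by auto
  have I: "I = (\<lambda>\<omega>. \<Sum>i<n. \<xi> i \<omega> * (W (tp (Suc i)) \<omega> - W (tp i) \<omega>))"
    by (rule ext) (simp add: g(6) mult.commute)
  show "I \<in> borel_measurable M" unfolding I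
    using bnd a g(4) by (intro borel_measurable_sum borel_measurable_times borel_measurable_diff W_measurable)
      (auto intro: measurable_F order_trans)
  have int: "ennreal (\<Sum>i<n. (\<xi> i \<omega>)\<^sup>2 * (tp (Suc i) - tp i)) \<le> set_nn_integral lborel {a..b} (\<lambda>s. ennreal ((g s \<omega>)\<^sup>2))" for \<omega>
  proof -
    have "ennreal (\<Sum>i<n. (\<xi> i \<omega>)\<^sup>2 * (tp (Suc i) - tp i)) = (\<Sum>i<n. ennreal ((\<xi> i \<omega>)\<^sup>2 * (tp (Suc i) - tp i)))"
      using g(3) by (intro sum_ennreal[symmetric] mult_nonneg_nonneg) (auto simp: less_imp_le)
    also have "\<dots> = (\<Sum>i<n. \<integral>\<^sup>+s. ennreal ((\<xi> i \<omega>)\<^sup>2) * indicator {tp i<..tp (Suc i)} s \<partial>lborel)"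
    proof (intro sum.cong refl)
      fix i assume "i \<in> {..<n}"
      then have "tp i \<le> tp (Suc i)" using g(3)[of i] by simp
      then show "ennreal ((\<xi> i \<omega>)\<^sup>2 * (tp (Suc i) - tp i)) = (\<integral>\<^sup>+s. ennreal ((\<xi> i \<omega>)\<^sup>2) * indicator {tp i<..tp (Suc i)} s \<partial>lborel)"
        by (simp add: nn_integral_cmult_indicator ennreal_mult)
    qed
    also have "\<dots> = (\<integral>\<^sup>+s. (\<Sum>i<n. ennreal ((\<xi> i \<omega>)\<^sup>2) * indicator {tp i<..tp (Suc i)} s) \<partial>lborel)"
      by (intro nn_integral_sum[symmetric]) simp
    also have "\<dots> \<le> set_nn_integral lborel {a..b} (\<lambda>s. ennreal ((g s \<omega>)\<^sup>2))"
    proof (intro nn_integral_mono)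
      fix s
      show "(\<Sum>i<n. ennreal ((\<xi> i \<omega>)\<^sup>2) * indicator {tp i<..tp (Suc i)} s) \<le> ennreal ((g s \<omega>)\<^sup>2) * indicator {a..b} s"
      proof (cases "\<exists>i<n. s \<in> {tp i<..tp (Suc i)}")
        case True
        then obtain i where i: "i < n" "s \<in> {tp i<..tp (Suc i)}" by blast
        have "(\<Sum>i<n. ennreal ((\<xi> i \<omega>)\<^sup>2) * indicator {tp i<..tp (Suc i)} s)
          = (\<Sum>i<n. ennreal (indicator {tp i<..tp (Suc i)} s * (\<xi> i \<omega>)\<^sup>2))"
          by (intro sum.cong) (auto simp: indicator_def)
        also have "\<dots> = ennreal (\<Sum>i<n. indicator {tp i<..tp (Suc i)} s * (\<xi> i \<omega>)\<^sup>2)"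
          by (intro sum_ennreal) auto
        also have "(\<Sum>i<n. indicator {tp i<..tp (Suc i)} s * (\<xi> i \<omega>)\<^sup>2) = (\<xi> i \<omega>)\<^sup>2"
          by (rule step_function_value[OF g(3) i])
        also have "\<xi> i \<omega> = g s \<omega>"
          using step_function_value[of n tp i s "\<lambda>i. \<xi> i \<omega>", OF g(3) i] by (simp add: g(5))
        finally show ?thesis using i bnd[of i] bnd[of "Suc i"] by (auto simp: indicator_def)
      next
        case False
        then have "(\<Sum>i<n. ennreal ((\<xi> i \<omega>)\<^sup>2) * indicator {tp i<..tp (Suc i)} s) = 0"
          by (intro sum.neutral) auto
        then show ?thesis by simp
      qed
    qed
    finally show ?thesis .
  qed
  show "prob_norm I \<le> sqrt \<delta> + prob A" unfolding I
  proof (rule simple_sum_prob_norm_le)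
    show "{\<omega> \<in> space M. \<delta> < (\<Sum>i<n. (\<xi> i \<omega>)\<^sup>2 * (tp (Suc i) - tp i))} \<subseteq> A"
    proof
      fix \<omega> assume \<omega>: "\<omega> \<in> {\<omega> \<in> space M. \<delta> < (\<Sum>i<n. (\<xi> i \<omega>)\<^sup>2 * (tp (Suc i) - tp i))}"
      then have "ennreal \<delta> < ennreal (\<Sum>i<n. (\<xi> i \<omega>)\<^sup>2 * (tp (Suc i) - tp i))"
        using \<delta> by (intro ennreal_lessI) auto
      with int[of \<omega>] \<omega> A(2) show "\<omega> \<in> A" by (auto dest: order_less_le_trans)
    qed
  qed (use g a \<delta> A in auto)
qed

text \<open>The approximants in the definition of the integral are arbitrary. But the left-end step
  process of a continuous \<open>f\<close> is near \<open>f\<close> off a small event, hence near a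
  good approximant \<open>g k\<close> in mean square over time. The domination inequality for their
  difference brings the Riemann sum near \<open>I k\<close>, hence near \<open>X\<close>.\<close>

lemma ito_integral_riemann_sums:
  fixes f :: "real \<Rightarrow> 'w \<Rightarrow> real"
  assumes s: "0 < s" and ad: "\<And>r. r \<in> {0..s} \<Longrightarrow> f r \<in> borel_measurable (F r)"
    and cont: "AE \<omega> in M. continuous_on {0..s} (\<lambda>r. f r \<omega>)"
    and ito: "is_ito_integral M W 0 s f X"
  defines "S \<equiv> \<lambda>m \<omega>. \<Sum>j<m. f (real j * s / real m) \<omega> * (W (real (Suc j) * s / real m) \<omega> - W (real j * s / real m) \<omega>)"
  shows "(\<lambda>m. prob_norm (\<lambda>\<omega>. S m \<omega> - X \<omega>)) \<longlonglongrightarrow> 0"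
proof (rule LIMSEQ_I)
  fix \<epsilon> :: real assume \<epsilon>: "\<epsilon> > 0"
  from ito obtain g I where X: "X \<in> borel_measurable M" and gI: "\<And>n. simple_ito M W 0 s (g n) (I n)"
    and g: "tendsto_zero_in_prob M (\<lambda>n \<omega>. set_nn_integral lborel {0..s} (\<lambda>r. ennreal ((norm (g n r \<omega> - f r \<omega>))\<^sup>2)))"
    and I: "tendsto_zero_in_prob M (\<lambda>n \<omega>. ennreal (norm (I n \<omega> - X \<omega>)))"
    unfolding is_ito_integral_def by blast
  have IM: "I n \<in> borel_measurable M" for n
    using simple_ito_prob_norm_le(1)[OF order_refl gI, of 1 "space M"] by auto
  \<comment> \<open>The error is the sum of \<open>sqrt \<delta>\<close>, the probabilities of
    \<open>A\<close> and \<open>B\<close>, and the distance from \<open>I k\<close> to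
    \<open>X\<close>, each at most \<open>\<epsilon> / 5\<close>.\<close>
  define \<delta> where "\<delta> = (\<epsilon> / 5)\<^sup>2"
  have \<delta>: "\<delta> > 0" "sqrt \<delta> = \<epsilon> / 5" using \<epsilon> by (auto simp: \<delta>_def)
  have fM: "f r \<in> borel_measurable M" if "r \<in> {0..s}" for r by (rule measurable_F[OF ad[OF that]])
  \<comment> \<open>Makes \<open>2 * (\<delta> / 4) + 2 * \<eta>\<^sup>2 * s = \<delta>\<close>, the
    two terms coming from \<open>g k - f\<close> and \<open>f - fm\<close>.\<close>
  define \<eta> where "\<eta> = sqrt (\<delta> / (4 * s))"
  have \<eta>: "\<eta> > 0" "\<eta>\<^sup>2 = \<delta> / (4 * s)" using \<delta> s by (auto simp: \<eta>_def)
  obtain \<rho> B where \<rho>: "\<rho> > 0" and B: "B \<in> events" "prob B < \<epsilon> / 5"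
    "\<And>\<omega>. \<omega> \<in> space M - B \<Longrightarrow> continuous_on {0..s} (\<lambda>r. f r \<omega>)"
    "\<And>\<omega> r r'. \<omega> \<in> space M - B \<Longrightarrow> r \<in> {0..s} \<Longrightarrow> r' \<in> {0..s} \<Longrightarrow> \<bar>r - r'\<bar> < \<rho> \<Longrightarrow> \<bar>f r \<omega> - f r' \<omega>\<bar> \<le> \<eta>"
    using continuous_process_oscillation[OF fM cont, of "\<epsilon> / 5" \<eta>] \<epsilon> \<eta> by auto
  have "(\<lambda>n. prob_norm (\<lambda>\<omega>. I n \<omega> - X \<omega>)) \<longlonglongrightarrow> 0"
    using tendsto_zero_in_prob_prob_norm[of "\<lambda>n \<omega>. I n \<omega> - X \<omega>"] I IM X by simp
  from LIMSEQ_D[OF this, of "\<epsilon> / 5"] obtain N1 where N1: "\<And>n. n \<ge> N1 \<Longrightarrow> prob_norm (\<lambda>\<omega>. I n \<omega> - X \<omega>) < \<epsilon> / 5"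
    using \<epsilon> by (auto simp: abs_of_nonneg[OF prob_norm_nonneg])
  obtain N2 where N2: "\<And>n. n \<ge> N2 \<Longrightarrow> \<exists>A\<in>events. {\<omega>\<in>space M. set_nn_integral lborel {0..s} (\<lambda>r. ennreal ((norm (g n r \<omega> - f r \<omega>))\<^sup>2)) > ennreal (\<delta> / 4)} \<subseteq> A \<and> prob A < \<epsilon> / 5"
    using g[unfolded tendsto_zero_in_prob_def, rule_format, of "\<delta> / 4" "\<epsilon> / 5"] \<delta>(1) \<epsilon> by auto
  define k where "k = max N1 N2"
  obtain A where A: "A \<in> events" "prob A < \<epsilon> / 5"
    "{\<omega>\<in>space M. set_nn_integral lborel {0..s} (\<lambda>r. ennreal ((norm (g k r \<omega> - f r \<omega>))\<^sup>2)) > ennreal (\<delta> / 4)} \<subseteq> A"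
    using N2[of k] by (auto simp: k_def)
  have kN1: "prob_norm (\<lambda>\<omega>. I k \<omega> - X \<omega>) < \<epsilon> / 5" using N1[of k] by (simp add: k_def)
  obtain m0 :: nat where m0: "s / \<rho> < real m0" using reals_Archimedean2 by blast
  have "prob_norm (\<lambda>\<omega>. S m \<omega> - X \<omega>) < \<epsilon>" if m: "m \<ge> m0" for m
  proof -
    have "s / \<rho> < real m" using m0 m by simp
    moreover from this have mpos: "0 < m" using \<rho> s by (auto intro!: gr0I simp: field_simps)
    ultimately have mesh: "s / real m < \<rho>" using \<rho> by (simp add: field_simps)
    define tp where "tp j = real j * s / real m" for j
    have tp: "tp j < tp (Suc j)" "0 \<le> tp j" for j using s mpos by (auto simp: tp_def divide_strict_right_mono)
    have tpd: "tp (Suc j) - tp j = s / real m" for j using mpos by (simp add: tp_def field_simps)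
    have tps: "tp j \<le> s" if "j \<le> m" for j
      using that s mpos by (simp add: tp_def field_simps)
    define fm where "fm r \<omega> = (\<Sum>j<m. indicator {tp j<..tp (Suc j)} r *\<^sub>R f (tp j) \<omega>)" for r \<omega>
    have simp_m: "simple_ito M W 0 s fm (S m)"
      unfolding simple_ito_def
    proof (intro exI conjI allI impI)
      show "tp 0 = 0" "tp m = s" using mpos by (auto simp: tp_def)
      show "fm r \<omega> = (\<Sum>j<m. indicator {tp j<..tp (Suc j)} r *\<^sub>R f (tp j) \<omega>)" for r \<omega> by (simp add: fm_def)
      show "S m \<omega> = (\<Sum>j<m. (W (tp (Suc j)) \<omega> - W (tp j) \<omega>) *\<^sub>R f (tp j) \<omega>)" for \<omega>
        by (simp add: S_def tp_def mult.commute)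
    qed (use tp tps ad in auto)
    note diff = simple_ito_diff[OF gI[of k] simp_m]
    have sub: "{\<omega>\<in>space M. set_nn_integral lborel {0..s} (\<lambda>r. ennreal ((g k r \<omega> - fm r \<omega>)\<^sup>2)) > ennreal \<delta>} \<subseteq> A \<union> B"
    proof (rule subsetI, rule ccontr)
      fix \<omega> assume *: "\<omega> \<in> {\<omega>\<in>space M. set_nn_integral lborel {0..s} (\<lambda>r. ennreal ((g k r \<omega> - fm r \<omega>)\<^sup>2)) > ennreal \<delta>}" "\<omega> \<notin> A \<union> B"
      then have \<omega>: "\<omega> \<in> space M" "\<omega> \<notin> A" "\<omega> \<in> space M - B" by auto
      have small: "set_nn_integral lborel {0..s} (\<lambda>r. ennreal ((g k r \<omega> - f r \<omega>)\<^sup>2)) \<le> ennreal (\<delta> / 4)"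
        using A(3) \<omega> by (auto simp: not_less)
      obtain n tq \<xi> where gk: "tq 0 = 0" "\<And>i. i < n \<Longrightarrow> tq i < tq (Suc i)" "\<And>s \<omega>. g k s \<omega> = (\<Sum>i<n. indicator {tq i<..tq (Suc i)} s *\<^sub>R \<xi> i \<omega>)"
        using gI[of k] unfolding simple_ito_def by metis
      \<comment> \<open>At time 0 the step process does not see \<open>f\<close>, because its cells
        omit their left end points; there the estimate holds since both step processes
        vanish.\<close>
      have g0: "g k 0 \<omega> = 0" unfolding gk(3)
      proof (intro sum.neutral ballI)
        fix i assume "i \<in> {..<n}"
        then have "0 \<le> tq i" using strict_step_le[of n tq 0 i] gk by auto
        then show "indicator {tq i<..tq (Suc i)} 0 *\<^sub>R \<xi> i \<omega> = 0" by simp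
      qed
      have fm0: "fm 0 \<omega> = 0" unfolding fm_def using tp(2) by (intro sum.neutral) (auto simp: indicator_def not_less)
      have close: "\<bar>f r \<omega> - fm r \<omega>\<bar> \<le> \<eta>" if r: "r \<in> {0<..s}" for r
      proof -
        \<comment> \<open>A cell contains its right end point and not its left one, hence a ceiling
          minus 1 and not a floor.\<close>
        define i where "i = nat (\<lceil>r * real m / s\<rceil> - 1)"
        have pos: "0 < r * real m / s" using r s mpos by simp
        then have c1: "1 \<le> \<lceil>r * real m / s\<rceil>" by (simp add: le_ceiling_iff)
        then have ir: "real i = of_int \<lceil>r * real m / s\<rceil> - 1" by (simp add: i_def)
        have "real i < r * real m / s" "r * real m / s \<le> real (Suc i)"
          using ir ceiling_correct[of "r * real m / s"] by simp_all
        then have ri: "r \<in> {tp i<..tp (Suc i)}" using s mpos by (simp add: tp_def field_simps)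
        have "r * real m / s \<le> real m" using r s mpos by (simp add: field_simps)
        with \<open>real i < r * real m / s\<close> have im: "i < m" by linarith
        have "fm r \<omega> = f (tp i) \<omega>"
          using step_function_value[of m tp i r "\<lambda>j. f (tp j) \<omega>", OF tp(1) im ri] by (simp add: fm_def)
        moreover have "\<bar>f r \<omega> - f (tp i) \<omega>\<bar> \<le> \<eta>"
          using tpd[of i] mesh ri r tp(2)[of i] tps[of i] im by (intro B(4)[OF \<omega>(3)]) auto
        ultimately show ?thesis by simp
      qed
      have pw: "(g k r \<omega> - fm r \<omega>)\<^sup>2 \<le> 2 * (g k r \<omega> - f r \<omega>)\<^sup>2 + 2 * \<eta>\<^sup>2" if r: "r \<in> {0..s}" for r
      proof (cases "r = 0")
        case True then show ?thesis by (simp add: g0 fm0)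
      next
        case False
        then have "(f r \<omega> - fm r \<omega>)\<^sup>2 \<le> \<eta>\<^sup>2" using close[of r] r by (intro power2_le_iff_abs_le[THEN iffD2]) (use \<eta> in auto)
        moreover have "(g k r \<omega> - fm r \<omega>)\<^sup>2 \<le> 2 * (g k r \<omega> - f r \<omega>)\<^sup>2 + 2 * (f r \<omega> - fm r \<omega>)\<^sup>2"
          using sum_squares_bound[of "g k r \<omega> - f r \<omega>" "f r \<omega> - fm r \<omega>"] by (simp add: power2_eq_square algebra_simps)
        ultimately show ?thesis by linarith
      qed
      \<comment> \<open>Splitting the integral requires measurability in time, which off
        \<open>B\<close> comes from continuity of the path cut to \<open>{0..s}\<close>.\<close>
      have "(\<lambda>r. indicator {0..s} r *\<^sub>R f r \<omega>) \<in> borel_measurable borel"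
        by (rule borel_measurable_continuous_on_indicator[OF _ B(3)[OF \<omega>(3)]]) simp
      moreover have "(\<lambda>r. g k r \<omega>) \<in> borel_measurable borel" unfolding gk(3)
        by (intro borel_measurable_sum borel_measurable_scaleR borel_measurable_indicator) auto
      ultimately have "(\<lambda>r. ennreal ((indicator {0..s} r * g k r \<omega> - indicator {0..s} r *\<^sub>R f r \<omega>)\<^sup>2)) \<in> borel_measurable borel" by measurable
      also have "(\<lambda>r. ennreal ((indicator {0..s} r * g k r \<omega> - indicator {0..s} r *\<^sub>R f r \<omega>)\<^sup>2)) = (\<lambda>r. ennreal ((g k r \<omega> - f r \<omega>)\<^sup>2) * indicator {0..s} r)"
        by (auto simp: fun_eq_iff indicator_def)
      finally have meas: "(\<lambda>r. ennreal ((g k r \<omega> - f r \<omega>)\<^sup>2) * indicator {0..s} r) \<in> borel_measurable lborel" by simp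
      have "set_nn_integral lborel {0..s} (\<lambda>r. ennreal ((g k r \<omega> - fm r \<omega>)\<^sup>2))
          \<le> (\<integral>\<^sup>+r. ennreal 2 * (ennreal ((g k r \<omega> - f r \<omega>)\<^sup>2) * indicator {0..s} r) + ennreal (2 * \<eta>\<^sup>2) * indicator {0..s} r \<partial>lborel)"
      proof (intro nn_integral_mono)
        fix r
        show "ennreal ((g k r \<omega> - fm r \<omega>)\<^sup>2) * indicator {0..s} r \<le> ennreal 2 * (ennreal ((g k r \<omega> - f r \<omega>)\<^sup>2) * indicator {0..s} r) + ennreal (2 * \<eta>\<^sup>2) * indicator {0..s} r"
        proof (cases "r \<in> {0..s}")
          case True
          have "ennreal ((g k r \<omega> - fm r \<omega>)\<^sup>2) \<le> ennreal (2 * (g k r \<omega> - f r \<omega>)\<^sup>2 + 2 * \<eta>\<^sup>2)"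
            by (rule ennreal_leI[OF pw[OF True]])
          also have "\<dots> = ennreal 2 * ennreal ((g k r \<omega> - f r \<omega>)\<^sup>2) + ennreal (2 * \<eta>\<^sup>2)"
            by (subst ennreal_plus) (auto simp: ennreal_mult)
          finally show ?thesis using True by simp
        qed simp
      qed
      also have "\<dots> = ennreal 2 * set_nn_integral lborel {0..s} (\<lambda>r. ennreal ((g k r \<omega> - f r \<omega>)\<^sup>2)) + ennreal (2 * \<eta>\<^sup>2) * emeasure lborel {0..s}"
        using meas by (subst nn_integral_add) (auto simp: nn_integral_cmult nn_integral_cmult_indicator)
      also have "\<dots> \<le> ennreal 2 * ennreal (\<delta> / 4) + ennreal (2 * \<eta>\<^sup>2) * ennreal s"
        using small s by (intro add_mono mult_left_mono) auto
      also have "\<dots> = ennreal (2 * (\<delta> / 4) + 2 * \<eta>\<^sup>2 * s)"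
      proof -
        have "ennreal (2 * (\<delta> / 4)) = ennreal 2 * ennreal (\<delta> / 4)"
          "ennreal (2 * \<eta>\<^sup>2 * s) = ennreal (2 * \<eta>\<^sup>2) * ennreal s"
          using \<delta>(1) s by (intro ennreal_mult; simp)+
        moreover have "ennreal (2 * (\<delta> / 4) + 2 * \<eta>\<^sup>2 * s) = ennreal (2 * (\<delta> / 4)) + ennreal (2 * \<eta>\<^sup>2 * s)"
          by (rule ennreal_plus) (use \<delta>(1) s in auto)
        ultimately show ?thesis by (simp only:)
      qed
      also have "2 * (\<delta> / 4) + 2 * \<eta>\<^sup>2 * s = \<delta>" using \<eta>(2) s by (simp add: field_simps)
      finally show False using *(1) by auto
    qed
    have SM: "S m \<in> borel_measurable M"
      using simple_ito_prob_norm_le(1)[OF order_refl simp_m, of 1 "space M"] by auto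
    have "prob_norm (\<lambda>\<omega>. I k \<omega> - S m \<omega>) \<le> sqrt \<delta> + prob (A \<union> B)"
      by (rule simple_ito_prob_norm_le(2)[OF order_refl diff \<delta>(1) _ sub]) (use A B in auto)
    also have "prob (A \<union> B) \<le> prob A + prob B" using A B by (intro measure_Un_le) auto
    finally have 1: "prob_norm (\<lambda>\<omega>. I k \<omega> - S m \<omega>) < 3 * (\<epsilon> / 5)" using A(2) B(2) \<delta>(2) by linarith
    have "prob_norm (\<lambda>\<omega>. S m \<omega> - X \<omega>) = prob_norm (\<lambda>\<omega>. (I k \<omega> - X \<omega>) - (I k \<omega> - S m \<omega>))"
      by (simp add: algebra_simps)
    also have "\<dots> \<le> prob_norm (\<lambda>\<omega>. I k \<omega> - X \<omega>) + prob_norm (\<lambda>\<omega>. I k \<omega> - S m \<omega>)"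
      using IM X SM by (intro prob_norm_diff) auto
    finally show ?thesis using 1 kN1 \<epsilon> by linarith
  qed
  then show "\<exists>no. \<forall>n\<ge>no. norm (prob_norm (\<lambda>\<omega>. S n \<omega> - X \<omega>) - 0) < \<epsilon>"
    by (auto simp: abs_of_nonneg[OF prob_norm_nonneg])
qed

end

section \<open>The scalar linear equation\<close>

text \<open>Truncation turns an adapted coefficient into a bounded adapted one, as the second-moment
  estimates demand, and agrees with it wherever the path bounds hold.\<close>

definition clamp_abs :: "real \<Rightarrow> real \<Rightarrow> real" where
  "clamp_abs K x = max (- K) (min K x)"

lemma clamp_abs_le: "0 \<le> K \<Longrightarrow> \<bar>clamp_abs K x\<bar> \<le> K"
  by (auto simp: clamp_abs_def)

lemma clamp_abs_id: "\<bar>x\<bar> \<le> K \<Longrightarrow> clamp_abs K x = x"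
  by (auto simp: clamp_abs_def)

lemma borel_measurable_clamp_abs [measurable (raw)]:
  "f \<in> borel_measurable N \<Longrightarrow> (\<lambda>x. clamp_abs K (f x)) \<in> borel_measurable N"
  unfolding clamp_abs_def by (intro borel_measurable_max borel_measurable_min borel_measurable_const)

text \<open>For summing \<open>n\<close> equal one-step contributions at step size
  \<open>t / n\<close>: what is \<open>o(h)\<close> per step disappears in total.\<close>

lemma tendsto_nat_mult_deriv:
  fixes f :: "real \<Rightarrow> real"
  assumes "f 0 = 0" "(f has_real_derivative D) (at 0)" "t > 0"
  shows "(\<lambda>n. real n * f (t / real n)) \<longlonglongrightarrow> t * D"
proof -
  have "((\<lambda>h. f h / h) \<longlongrightarrow> D) (at 0)"
    using DERIV_D[OF assms(2)] assms(1) by simp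
  moreover have "filterlim (\<lambda>n. t / real n) (at 0) sequentially"
    unfolding filterlim_at
  proof
    show "\<forall>\<^sub>F n in sequentially. t / real n \<in> UNIV \<and> t / real n \<noteq> 0"
      using eventually_gt_at_top[of 0] by eventually_elim (use assms in auto)
    show "(\<lambda>n. t / real n) \<longlonglongrightarrow> 0" by (rule lim_const_over_n)
  qed
  ultimately have "(\<lambda>n. f (t / real n) / (t / real n)) \<longlonglongrightarrow> D"
    by (rule filterlim_compose)
  then have "(\<lambda>n. t * (f (t / real n) / (t / real n))) \<longlonglongrightarrow> t * D" by (rule tendsto_mult_left)
  moreover have "eventually (\<lambda>n. t * (f (t / real n) / (t / real n)) = real n * f (t / real n)) sequentially"
    using eventually_gt_at_top[of 0] by eventually_elim (use assms in \<open>auto simp: field_simps\<close>)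
  ultimately show ?thesis by (rule Lim_transform_eventually)
qed

text \<open>Let \<open>R\<^sub>s = exp (-(\<beta>\<^sub>0 - \<beta>\<^sub>1\<^sup>2/2) s - \<beta>\<^sub>1 W\<^sub>s)\<close>. Over a time step \<open>h\<close> with noise increment \<open>x\<close>, \<open>R\<close> is multiplied
  by \<open>recip_step h x\<close>, and an Euler step of the equation times this factor is \<open>1 + euler_defect h x\<close>.
  The Gaussian expectations of \<open>euler_defect\<close>, of its square and of \<open>(recip_step - 1)\<^sup>2\<close> are
  \<open>defect_mean\<close>, \<open>defect_square\<close> and \<open>recip_step_square\<close>; the first two are \<open>o(h)\<close>, which is what makes
  \<open>R v\<close> constant.\<close>

context
  fixes \<beta>0 \<beta>1 :: real
begin

definition recip_step :: "real \<Rightarrow> real \<Rightarrow> real" where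
  "recip_step h x = exp (- (\<beta>0 - \<beta>1\<^sup>2 / 2) * h - \<beta>1 * x)"

definition euler_defect :: "real \<Rightarrow> real \<Rightarrow> real" where
  "euler_defect h x = (1 + \<beta>0 * h + \<beta>1 * x) * recip_step h x - 1"

definition defect_mean :: "real \<Rightarrow> real" where
  "defect_mean h = exp (- (\<beta>0 - \<beta>1\<^sup>2 / 2) * h) * (exp ((- \<beta>1)\<^sup>2 * h / 2) * ((1 + \<beta>0 * h) + \<beta>1 * (- \<beta>1 * h))) - 1"

definition defect_square :: "real \<Rightarrow> real" where
  "defect_square h = exp (- 2 * (\<beta>0 - \<beta>1\<^sup>2 / 2) * h) * (exp ((- 2 * \<beta>1)\<^sup>2 * h / 2) *
     ((1 + \<beta>0 * h)\<^sup>2 + (2 * (1 + \<beta>0 * h) * \<beta>1) * (- 2 * \<beta>1 * h) + \<beta>1\<^sup>2 * ((- 2 * \<beta>1 * h)\<^sup>2 + h))) - 2 * (defect_mean h + 1) + 1"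

definition recip_step_square :: "real \<Rightarrow> real" where
  "recip_step_square h = exp (- 2 * (\<beta>0 - \<beta>1\<^sup>2 / 2) * h) * exp ((- 2 * \<beta>1)\<^sup>2 * h / 2)
     - 2 * (exp (- (\<beta>0 - \<beta>1\<^sup>2 / 2) * h) * exp ((- \<beta>1)\<^sup>2 * h / 2)) + 1"

text \<open>Collecting exponents, the mean is \<open>(1 + a * h) * exp (- a * h) - 1\<close> with
  \<open>a = \<beta>0 - \<beta>1\<^sup>2\<close>, whose linear terms cancel. This cancellation is
  what fixes the correction \<open>\<beta>1\<^sup>2 / 2\<close> in
  \<open>recip_step\<close>.\<close>

lemma defect_mean_deriv: "(defect_mean has_real_derivative 0) (at 0)"
  unfolding defect_mean_def [abs_def]
  by (rule derivative_eq_intros refl numeral_neq_zero)+ (simp add: power2_eq_square field_simps)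

text \<open>In the leading term \<open>exp ((3 * \<beta>1\<^sup>2 - 2 * \<beta>0) * h)\<close> meets
  a polynomial \<open>1 + (2 * \<beta>0 - 3 * \<beta>1\<^sup>2) * h\<close> up to second
  order.\<close>

lemma defect_square_deriv: "(defect_square has_real_derivative 0) (at 0)"
  unfolding defect_square_def [abs_def]
  by (rule derivative_eq_intros refl numeral_neq_zero defect_mean_deriv)+ (simp add: power2_eq_square field_simps)

lemma recip_step_square_deriv: "(recip_step_square has_real_derivative \<beta>1\<^sup>2) (at 0)"
  unfolding recip_step_square_def [abs_def]
  by (rule derivative_eq_intros refl numeral_neq_zero)+ (simp add: power2_eq_square field_simps)

lemma defect_0: "defect_mean 0 = 0" "defect_square 0 = 0" "recip_step_square 0 = 0"
  by (auto simp: defect_mean_def defect_square_def recip_step_square_def)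

lemma borel_measurable_euler_defect [measurable]: "euler_defect h \<in> borel_measurable borel"
  unfolding euler_defect_def [abs_def] recip_step_def by measurable

lemma borel_measurable_recip_step [measurable]: "recip_step h \<in> borel_measurable borel"
  unfolding recip_step_def [abs_def] by measurable

end

section \<open>Moments of one Euler step\<close>

context brownian begin

context
  fixes a b :: real and \<beta>0 \<beta>1 :: real
  assumes ab: "0 \<le> a" "a < b"
begin

lemma increment_euler_defect: "has_bochner_integral M (\<lambda>\<omega>. euler_defect \<beta>0 \<beta>1 (b - a) (W b \<omega> - W a \<omega>)) (defect_mean \<beta>0 \<beta>1 (b - a))"
proof -
  let ?h = "b - a" and ?X = "\<lambda>\<omega>. W b \<omega> - W a \<omega>"
  have "has_bochner_integral M (\<lambda>\<omega>. exp (- (\<beta>0 - \<beta>1\<^sup>2 / 2) * ?h) *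
      (((1 + \<beta>0 * ?h) + \<beta>1 * ?X \<omega> + 0 * (?X \<omega>)\<^sup>2) * exp (- \<beta>1 * ?X \<omega>)) - 1)
    (exp (- (\<beta>0 - \<beta>1\<^sup>2 / 2) * ?h) * (exp ((- \<beta>1)\<^sup>2 * ?h / 2) * ((1 + \<beta>0 * ?h) + \<beta>1 * (- \<beta>1 * ?h) + 0 * ((- \<beta>1 * ?h)\<^sup>2 + ?h))) - 1)"
    by (intro has_bochner_integral_diff has_bochner_integral_mult_right increment_exp_quadratic ab)
       (simp add: has_bochner_integral_iff prob_space)
  moreover have "exp (- (\<beta>0 - \<beta>1\<^sup>2 / 2) * ?h) *
      (((1 + \<beta>0 * ?h) + \<beta>1 * x + 0 * x\<^sup>2) * exp (- \<beta>1 * x)) - 1 = euler_defect \<beta>0 \<beta>1 ?h x" for x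
  proof -
    have "recip_step \<beta>0 \<beta>1 ?h x = exp (- (\<beta>0 - \<beta>1\<^sup>2 / 2) * ?h) * exp (- \<beta>1 * x)"
      by (simp add: recip_step_def exp_add[symmetric])
    then show ?thesis by (simp add: euler_defect_def)
  qed
  ultimately show ?thesis by (simp add: defect_mean_def)
qed

text \<open>The square of the defect \<open>d\<close> is expanded as
  \<open>(d + 1)\<^sup>2 - 2 * (d + 1) + 1\<close>: the first term is, up to a constant factor, a
  quadratic polynomial times \<open>exp (- 2 * \<beta>1 * x)\<close>, and the second has its mean
  from the previous lemma.\<close>

lemma increment_euler_defect_square: "has_bochner_integral M (\<lambda>\<omega>. (euler_defect \<beta>0 \<beta>1 (b - a) (W b \<omega> - W a \<omega>))\<^sup>2) (defect_square \<beta>0 \<beta>1 (b - a))"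
proof -
  let ?h = "b - a" and ?X = "\<lambda>\<omega>. W b \<omega> - W a \<omega>"
  have "has_bochner_integral M (\<lambda>\<omega>. exp (- 2 * (\<beta>0 - \<beta>1\<^sup>2 / 2) * ?h) *
      (((1 + \<beta>0 * ?h)\<^sup>2 + (2 * (1 + \<beta>0 * ?h) * \<beta>1) * ?X \<omega> + \<beta>1\<^sup>2 * (?X \<omega>)\<^sup>2) * exp ((- 2 * \<beta>1) * ?X \<omega>))
      - 2 * (euler_defect \<beta>0 \<beta>1 ?h (?X \<omega>) + 1) + 1)
    (defect_square \<beta>0 \<beta>1 ?h)"
    unfolding defect_square_def
    by (intro has_bochner_integral_diff has_bochner_integral_add has_bochner_integral_mult_right increment_exp_quadratic increment_euler_defect ab)
       (simp_all add: has_bochner_integral_iff prob_space)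
  moreover have "exp (- 2 * (\<beta>0 - \<beta>1\<^sup>2 / 2) * ?h) *
      (((1 + \<beta>0 * ?h)\<^sup>2 + (2 * (1 + \<beta>0 * ?h) * \<beta>1) * x + \<beta>1\<^sup>2 * x\<^sup>2) * exp ((- 2 * \<beta>1) * x))
      - 2 * (euler_defect \<beta>0 \<beta>1 ?h x + 1) + 1 = (euler_defect \<beta>0 \<beta>1 ?h x)\<^sup>2" for x
  proof -
    have "(recip_step \<beta>0 \<beta>1 ?h x)\<^sup>2 = exp (- 2 * (\<beta>0 - \<beta>1\<^sup>2 / 2) * ?h) * exp ((- 2 * \<beta>1) * x)"
      by (simp add: recip_step_def exp_add[symmetric] power2_eq_square algebra_simps)
    then have "exp (- 2 * (\<beta>0 - \<beta>1\<^sup>2 / 2) * ?h) *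
      (((1 + \<beta>0 * ?h)\<^sup>2 + (2 * (1 + \<beta>0 * ?h) * \<beta>1) * x + \<beta>1\<^sup>2 * x\<^sup>2) * exp ((- 2 * \<beta>1) * x))
      = (1 + \<beta>0 * ?h + \<beta>1 * x)\<^sup>2 * (recip_step \<beta>0 \<beta>1 ?h x)\<^sup>2"
      by (simp add: power2_eq_square algebra_simps)
    also have "\<dots> = (euler_defect \<beta>0 \<beta>1 ?h x + 1)\<^sup>2" by (simp add: euler_defect_def power_mult_distrib)
    finally show ?thesis by (simp add: power2_eq_square algebra_simps)
  qed
  ultimately show ?thesis by simp
qed

lemma increment_recip_step: "has_bochner_integral M (\<lambda>\<omega>. (recip_step \<beta>0 \<beta>1 (b - a) (W b \<omega> - W a \<omega>) - 1)\<^sup>2) (recip_step_square \<beta>0 \<beta>1 (b - a))"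
proof -
  let ?h = "b - a" and ?X = "\<lambda>\<omega>. W b \<omega> - W a \<omega>"
  have "has_bochner_integral M (\<lambda>\<omega>. exp (- 2 * (\<beta>0 - \<beta>1\<^sup>2 / 2) * ?h) * exp ((- 2 * \<beta>1) * ?X \<omega>)
      - 2 * (exp (- (\<beta>0 - \<beta>1\<^sup>2 / 2) * ?h) * exp (- \<beta>1 * ?X \<omega>)) + 1) (recip_step_square \<beta>0 \<beta>1 ?h)"
    unfolding recip_step_square_def
    by (intro has_bochner_integral_diff has_bochner_integral_add has_bochner_integral_mult_right increment_exp ab)
       (simp add: has_bochner_integral_iff prob_space)
  moreover have "exp (- 2 * (\<beta>0 - \<beta>1\<^sup>2 / 2) * ?h) * exp ((- 2 * \<beta>1) * x)
      - 2 * (exp (- (\<beta>0 - \<beta>1\<^sup>2 / 2) * ?h) * exp (- \<beta>1 * x)) + 1 = (recip_step \<beta>0 \<beta>1 ?h x - 1)\<^sup>2" for x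
  proof -
    have "(recip_step \<beta>0 \<beta>1 ?h x)\<^sup>2 = exp (- 2 * (\<beta>0 - \<beta>1\<^sup>2 / 2) * ?h) * exp ((- 2 * \<beta>1) * x)"
      by (simp add: recip_step_def exp_add[symmetric] power2_eq_square algebra_simps)
    moreover have "recip_step \<beta>0 \<beta>1 ?h x = exp (- (\<beta>0 - \<beta>1\<^sup>2 / 2) * ?h) * exp (- \<beta>1 * x)"
      by (simp add: recip_step_def exp_add[symmetric])
    ultimately show ?thesis by (simp add: power2_diff)
  qed
  ultimately show ?thesis by simp
qed

end

section \<open>Error sums on a uniform grid\<close>

lemma integrable_bounded_square:
  fixes X :: "'w \<Rightarrow> real"
  assumes "X \<in> borel_measurable M" "\<And>\<omega>. \<omega> \<in> space M \<Longrightarrow> \<bar>X \<omega>\<bar> \<le> K"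
  shows "integrable M (\<lambda>\<omega>. (X \<omega>)\<^sup>2)" "expectation (\<lambda>\<omega>. (X \<omega>)\<^sup>2) \<le> K\<^sup>2"
proof -
  have le: "(X \<omega>)\<^sup>2 \<le> K\<^sup>2" if "\<omega> \<in> space M" for \<omega>
    using power_mono[OF assms(2)[OF that], of 2] by simp
  show i: "integrable M (\<lambda>\<omega>. (X \<omega>)\<^sup>2)"
    by (rule integrable_const_bound[of _ "K\<^sup>2"]) (use le assms(1) in auto)
  have "expectation (\<lambda>\<omega>. (X \<omega>)\<^sup>2) \<le> expectation (\<lambda>_. K\<^sup>2)"
    using i le by (intro integral_mono) auto
  then show "expectation (\<lambda>\<omega>. (X \<omega>)\<^sup>2) \<le> K\<^sup>2" by (simp add: prob_space)
qed

text \<open>Uniform-grid form of the orthogonality relation. The separate bound \<open>v'\<close>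
  allows the exact second moment \<open>v\<close>, which may be a variance, to be replaced by the
  larger raw second moment.\<close>

lemma orthogonal_sum_bound:
  fixes c :: "nat \<Rightarrow> 'w \<Rightarrow> real" and \<psi> :: "real \<Rightarrow> real"
  assumes a: "0 \<le> a" and h: "0 < h"
    and c: "\<And>i. i < n \<Longrightarrow> c i \<in> borel_measurable (F (a + real i * h))"
    and K: "\<And>i \<omega>. i < n \<Longrightarrow> \<omega> \<in> space M \<Longrightarrow> \<bar>c i \<omega>\<bar> \<le> K"
    and \<psi>: "\<psi> \<in> borel_measurable borel"
    and m1: "\<And>s. 0 \<le> s \<Longrightarrow> has_bochner_integral M (\<lambda>\<omega>. \<psi> (W (s + h) \<omega> - W s \<omega>)) 0"
    and m2: "\<And>s. 0 \<le> s \<Longrightarrow> has_bochner_integral M (\<lambda>\<omega>. (\<psi> (W (s + h) \<omega> - W s \<omega>))\<^sup>2) v"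
    and v: "v \<le> v'" "0 \<le> v'"
  defines "S \<equiv> \<lambda>\<omega>. \<Sum>i<n. c i \<omega> * \<psi> (W (a + real (Suc i) * h) \<omega> - W (a + real i * h) \<omega>)"
  shows "S \<in> borel_measurable M" "integrable M (\<lambda>\<omega>. (S \<omega>)\<^sup>2)" "expectation (\<lambda>\<omega>. (S \<omega>)\<^sup>2) \<le> real n * K\<^sup>2 * v'"
proof -
  have eq: "a + real (Suc i) * h = (a + real i * h) + h" for i by (simp add: algebra_simps)
  have pos: "0 \<le> a + real i * h" for i using a h by simp
  have cM: "c i \<in> borel_measurable M" if "i < n" for i by (rule measurable_F[OF c[OF that]])
  have "W (a + real i * h) \<in> borel_measurable M" for i by (rule W_measurable[OF pos])
  then show "S \<in> borel_measurable M"
    unfolding S_def using cM \<psi>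
    by (intro borel_measurable_sum borel_measurable_times measurable_compose[OF borel_measurable_diff \<psi>])
      (auto simp del: of_nat_Suc)
  have "has_bochner_integral M (\<lambda>\<omega>. (S \<omega>)\<^sup>2) (\<Sum>i<n. expectation (\<lambda>\<omega>. (c i \<omega>)\<^sup>2) * v)"
    unfolding S_def
  proof (rule orthogonal_sum[where tp="\<lambda>i. a + real i * h" and \<psi>="\<lambda>_. \<psi>"])
    show "has_bochner_integral M (\<lambda>\<omega>. \<psi> (W (a + real (Suc i) * h) \<omega> - W (a + real i * h) \<omega>)) 0" for i
      unfolding eq by (rule m1[OF pos])
    show "has_bochner_integral M (\<lambda>\<omega>. (\<psi> (W (a + real (Suc i) * h) \<omega> - W (a + real i * h) \<omega>))\<^sup>2) v" for i
      unfolding eq by (rule m2[OF pos])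
  qed (use a h c K \<psi> in \<open>auto\<close>)
  then show "integrable M (\<lambda>\<omega>. (S \<omega>)\<^sup>2)" and
    E: "expectation (\<lambda>\<omega>. (S \<omega>)\<^sup>2) \<le> real n * K\<^sup>2 * v'"
  proof -
    assume *: "has_bochner_integral M (\<lambda>\<omega>. (S \<omega>)\<^sup>2) (\<Sum>i<n. expectation (\<lambda>\<omega>. (c i \<omega>)\<^sup>2) * v)"
    then show "integrable M (\<lambda>\<omega>. (S \<omega>)\<^sup>2)" by (simp add: has_bochner_integral_iff)
    have "expectation (\<lambda>\<omega>. (S \<omega>)\<^sup>2) = (\<Sum>i<n. expectation (\<lambda>\<omega>. (c i \<omega>)\<^sup>2) * v)"
      using * by (simp add: has_bochner_integral_iff)
    also have "\<dots> \<le> (\<Sum>i<n. K\<^sup>2 * v')"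
    proof (intro sum_mono)
      fix i assume "i \<in> {..<n}"
      then have "expectation (\<lambda>\<omega>. (c i \<omega>)\<^sup>2) \<le> K\<^sup>2" using integrable_bounded_square(2)[OF cM K] by auto
      moreover have "0 \<le> expectation (\<lambda>\<omega>. (c i \<omega>)\<^sup>2)" by (intro Bochner_Integration.integral_nonneg) auto
      ultimately show "expectation (\<lambda>\<omega>. (c i \<omega>)\<^sup>2) * v \<le> K\<^sup>2 * v'"
        using v by (meson mult_left_mono mult_right_mono order_trans)
    qed
    finally show "expectation (\<lambda>\<omega>. (S \<omega>)\<^sup>2) \<le> real n * K\<^sup>2 * v'" by simp
  qed
qed

text \<open>The defect is split into its mean and a centred part. The centred sum is orthogonal and
  costs the square root of \<open>n\<close> second moments; the means add up linearly. With
  \<open>h = t / n\<close> both bounds vanish as \<open>n\<close> grows, because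
  \<open>defect_square\<close> and \<open>defect_mean\<close> are \<open>o(h)\<close>.\<close>

lemma euler_error_prob_norm_le:
  fixes X :: "nat \<Rightarrow> 'w \<Rightarrow> real"
  assumes h: "0 < h" and K: "0 \<le> K" and X: "\<And>i. i < n \<Longrightarrow> X i \<in> borel_measurable (F (real i * h))"
    and bound: "\<And>i \<omega>. i < n \<Longrightarrow> \<omega> \<in> space M \<Longrightarrow> \<bar>X i \<omega>\<bar> \<le> K"
  shows "prob_norm (\<lambda>\<omega>. \<Sum>i<n. X i \<omega> * euler_defect \<beta>0 \<beta>1 h (W (real (Suc i) * h) \<omega> - W (real i * h) \<omega>))
     \<le> K * sqrt (real n * defect_square \<beta>0 \<beta>1 h) + K * \<bar>real n * defect_mean \<beta>0 \<beta>1 h\<bar>"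
proof -
  let ?z1 = "defect_mean \<beta>0 \<beta>1 h" and ?z2 = "defect_square \<beta>0 \<beta>1 h" and ?\<zeta> = "euler_defect \<beta>0 \<beta>1 h"
  define S where "S \<omega> = (\<Sum>i<n. X i \<omega> * (?\<zeta> (W (0 + real (Suc i) * h) \<omega> - W (0 + real i * h) \<omega>) - ?z1))" for \<omega>
  have i1: "has_bochner_integral M (\<lambda>\<omega>. ?\<zeta> (W (s + h) \<omega> - W s \<omega>)) ?z1" if "0 \<le> s" for s
    using increment_euler_defect[of s "s + h"] that h by simp
  have i2: "has_bochner_integral M (\<lambda>\<omega>. (?\<zeta> (W (s + h) \<omega> - W s \<omega>))\<^sup>2) ?z2" if "0 \<le> s" for s
    using increment_euler_defect_square[of s "s + h"] that h by simp
  have z2: "0 \<le> ?z2"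
  proof -
    have "?z2 = expectation (\<lambda>\<omega>. (?\<zeta> (W (0 + h) \<omega> - W 0 \<omega>))\<^sup>2)" using i2[of 0] by (simp add: has_bochner_integral_iff)
    then show ?thesis by (simp add: Bochner_Integration.integral_nonneg)
  qed
  note S = orthogonal_sum_bound[where a=0 and h=h and n=n and c=X and K=K and \<psi>="\<lambda>x. ?\<zeta> x - ?z1" and v="?z2 - ?z1\<^sup>2" and v'="?z2"]
  have S': "S \<in> borel_measurable M" "integrable M (\<lambda>\<omega>. (S \<omega>)\<^sup>2)" "expectation (\<lambda>\<omega>. (S \<omega>)\<^sup>2) \<le> real n * K\<^sup>2 * ?z2"
  proof -
    have A: "has_bochner_integral M (\<lambda>\<omega>. ?\<zeta> (W (s + h) \<omega> - W s \<omega>) - ?z1) 0" if "0 \<le> s" for s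
    proof -
      have "has_bochner_integral M (\<lambda>\<omega>. ?\<zeta> (W (s + h) \<omega> - W s \<omega>) - ?z1) (?z1 - ?z1)"
        by (intro has_bochner_integral_diff i1 that) (simp add: has_bochner_integral_iff prob_space)
      then show ?thesis by simp
    qed
    have B: "has_bochner_integral M (\<lambda>\<omega>. (?\<zeta> (W (s + h) \<omega> - W s \<omega>) - ?z1)\<^sup>2) (?z2 - ?z1\<^sup>2)" if "0 \<le> s" for s
    proof -
      have "has_bochner_integral M (\<lambda>\<omega>. (?\<zeta> (W (s + h) \<omega> - W s \<omega>))\<^sup>2 - (2 * ?z1) * ?\<zeta> (W (s + h) \<omega> - W s \<omega>) + ?z1\<^sup>2)
         (?z2 - (2 * ?z1) * ?z1 + ?z1\<^sup>2)"
        by (intro has_bochner_integral_diff has_bochner_integral_add has_bochner_integral_mult_right i1 i2 that)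
           (simp add: has_bochner_integral_iff prob_space)
      moreover have "(\<lambda>\<omega>. (?\<zeta> (W (s + h) \<omega> - W s \<omega>))\<^sup>2 - (2 * ?z1) * ?\<zeta> (W (s + h) \<omega> - W s \<omega>) + ?z1\<^sup>2)
         = (\<lambda>\<omega>. (?\<zeta> (W (s + h) \<omega> - W s \<omega>) - ?z1)\<^sup>2)"
        by (rule ext) (simp add: power2_diff)
      moreover have "?z2 - (2 * ?z1) * ?z1 + ?z1\<^sup>2 = ?z2 - ?z1\<^sup>2" by (simp add: power2_eq_square)
      ultimately show ?thesis by simp
    qed
    note prem = h X bound A B z2
    show "S \<in> borel_measurable M" unfolding S_def[abs_def] by (rule S(1)) (use prem in simp_all)
    show "integrable M (\<lambda>\<omega>. (S \<omega>)\<^sup>2)" unfolding S_def by (rule S(2)) (use prem in simp_all)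
    show "expectation (\<lambda>\<omega>. (S \<omega>)\<^sup>2) \<le> real n * K\<^sup>2 * ?z2" unfolding S_def by (rule S(3)) (use prem in simp_all)
  qed
  define T where "T \<omega> = (\<Sum>i<n. X i \<omega> * ?z1)" for \<omega>
  have XM: "X i \<in> borel_measurable M" if "i < n" for i by (rule measurable_F[OF X[OF that]])
  have TM: "T \<in> borel_measurable M"
    unfolding T_def using XM by (intro borel_measurable_sum borel_measurable_times) auto
  have Tb: "\<bar>T \<omega>\<bar> \<le> K * \<bar>real n * ?z1\<bar>" if "\<omega> \<in> space M" for \<omega>
  proof -
    have "\<bar>T \<omega>\<bar> \<le> (\<Sum>i<n. \<bar>X i \<omega> * ?z1\<bar>)" unfolding T_def by (rule sum_abs)
    also have "\<dots> \<le> (\<Sum>i<n. K * \<bar>?z1\<bar>)"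
      using bound that by (intro sum_mono) (auto simp: abs_mult intro!: mult_right_mono)
    finally show ?thesis by (simp add: abs_mult algebra_simps)
  qed
  have "prob_norm T \<le> prob_norm (\<lambda>_. K * \<bar>real n * ?z1\<bar>)"
    using Tb TM K by (intro prob_norm_mono AE_I2) auto
  also have "\<dots> \<le> K * \<bar>real n * ?z1\<bar>"
    using prob_norm_le_expectation[of "\<lambda>_. K * \<bar>real n * ?z1\<bar>"] K by (simp add: prob_space abs_mult)
  finally have T: "prob_norm T \<le> K * \<bar>real n * ?z1\<bar>" .
  have "prob_norm S \<le> sqrt (real n * K\<^sup>2 * ?z2)"
    using prob_norm_le_sqrt[OF S'(1,2)] S'(3) by (meson order_trans real_sqrt_le_mono)
  also have "\<dots> = K * sqrt (real n * ?z2)"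
    using K by (simp add: real_sqrt_mult)
  finally have "prob_norm S \<le> K * sqrt (real n * ?z2)" .
  moreover have "(\<lambda>\<omega>. \<Sum>i<n. X i \<omega> * ?\<zeta> (W (real (Suc i) * h) \<omega> - W (real i * h) \<omega>)) = (\<lambda>\<omega>. S \<omega> + T \<omega>)"
    unfolding S_def T_def by (rule ext) (simp add: sum.distrib[symmetric] algebra_simps)
  ultimately show ?thesis using prob_norm_add[OF S'(1) TM] T by simp
qed

end

lemma set_integral_increment_close:
  fixes v :: "real \<Rightarrow> real"
  assumes ab: "0 \<le> a" "a \<le> b" "b \<le> t" and cont: "continuous_on {0..t} v"
    and close: "\<And>r. r \<in> {a..b} \<Longrightarrow> \<bar>v r - v a\<bar> \<le> \<eta>"
  shows "\<bar>(LBINT r:{0..b}. v r) - (LBINT r:{0..a}. v r) - (b - a) * v a\<bar> \<le> \<eta> * (b - a)"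
proof -
  have co: "continuous_on {x..y} v" if "0 \<le> x" "y \<le> t" for x y
    using cont by (rule continuous_on_subset) (use that in auto)
  have eq: "(LBINT r:{0..x}. v r) = integral {0..x} v" if "x \<le> t" for x
    by (intro set_borel_integral_eq_integral borel_integrable_atLeastAtMost' co that) simp
  have "integral {0..a} v + integral {a..b} v = integral {0..b} v"
    using ab by (intro Henstock_Kurzweil_Integration.integral_combine integrable_continuous_real co) auto
  moreover have "integral {a..b} v \<le> integral {a..b} (\<lambda>_. v a + \<eta>)"
    using ab close by (intro integral_le integrable_continuous_real co continuous_intros) (auto simp: abs_le_iff algebra_simps)
  moreover have "integral {a..b} (\<lambda>_. v a - \<eta>) \<le> integral {a..b} v"
    using ab close by (intro integral_le integrable_continuous_real co continuous_intros) (auto simp: abs_le_iff algebra_simps)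
  moreover have "integral {a..b} (\<lambda>_. v a + \<eta>) = (b - a) * v a + \<eta> * (b - a)"
    "integral {a..b} (\<lambda>_. v a - \<eta>) = (b - a) * v a - \<eta> * (b - a)"
    using ab by (auto simp: algebra_simps)
  ultimately show ?thesis using eq[of a] eq[of b] ab by (simp add: abs_le_iff)
qed

context brownian begin

text \<open>\<open>e i\<close> is the noise error on the coarse cell \<open>i\<close>, sampled on
  the fine grid, and its weight \<open>Rh i * Q i\<close> looks into the future of the cell's left
  end. Writing \<open>Q i = 1 + (Q i - 1)\<close> separates an adapted part \<open>A\<close>, a
  single orthogonal sum over the fine grid, from a part \<open>B\<close> in which \<open>e i\<close>
  and \<open>Q i - 1\<close> are both small in mean square. The total is of order \<eta>, and the
  fine grid enters the bound only through \<open>h\<close>.\<close>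

lemma noise_error_prob_norm_le:
  fixes v :: "real \<Rightarrow> 'w \<Rightarrow> real" and Rh :: "nat \<Rightarrow> 'w \<Rightarrow> real" and \<beta>0 \<beta>1 :: real
  assumes g: "0 < g" and k: "0 < k" and K: "0 \<le> K" and \<eta>: "0 < \<eta>"
    and v: "\<And>l. l < n * k \<Longrightarrow> v (real l * g) \<in> borel_measurable (F (real l * g))"
    and Rh: "\<And>i. i < n \<Longrightarrow> Rh i \<in> borel_measurable (F (real (i * k) * g))"
    and bound: "\<And>i \<omega>. i < n \<Longrightarrow> \<omega> \<in> space M \<Longrightarrow> \<bar>Rh i \<omega>\<bar> \<le> K"
  defines "h \<equiv> real k * g"
  defines "e \<equiv> \<lambda>i \<omega>. \<Sum>l=i*k..<i*k+k. clamp_abs \<eta> (v (real l * g) \<omega> - v (real (i * k) * g) \<omega>)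
              * (W (real (Suc l) * g) \<omega> - W (real l * g) \<omega>)"
  defines "Q \<equiv> \<lambda>i \<omega>. recip_step \<beta>0 \<beta>1 h (W (real (Suc i * k) * g) \<omega> - W (real (i * k) * g) \<omega>)"
  shows "prob_norm (\<lambda>\<omega>. \<Sum>i<n. Rh i \<omega> * e i \<omega> * Q i \<omega>)
    \<le> K * \<eta> * sqrt (real n * h) + K * \<eta> * (real n * h + real n * recip_step_square \<beta>0 \<beta>1 h) / 2"
    and "\<And>i. i < n \<Longrightarrow> e i \<in> borel_measurable M"
proof -
  have h: "0 < h" using g k by (simp add: h_def)
  have WM: "W (real l * g) \<in> borel_measurable M" for l using g by simp
  have RM: "Rh i \<in> borel_measurable M" if "i < n" for i by (rule measurable_F[OF Rh[OF that]])
  have QM: "Q i \<in> borel_measurable M" for i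
    unfolding Q_def using WM by (intro measurable_compose[OF _ borel_measurable_recip_step] borel_measurable_diff)
  have lnk: "i * k + j < n * k" if "i < n" "j < k" for i j
  proof -
    have "i * k + j < Suc i * k" using that by simp
    also have "\<dots> \<le> n * k" using that by (intro mult_le_mono1) simp
    finally show ?thesis .
  qed
  have clamp_meas: "(\<lambda>\<omega>. clamp_abs \<eta> (v (real l * g) \<omega> - v (real (i * k) * g) \<omega>)) \<in> borel_measurable (F (real l * g))"
    if "i * k \<le> l" "l < n * k" for i l
  proof -
    have "real (i * k) * g \<le> real l * g" using that(1) g by (intro mult_right_mono) (simp_all only: of_nat_le_iff less_imp_le)
    moreover have "i * k < n * k" using that by (rule le_less_trans)
    ultimately have "v (real (i * k) * g) \<in> borel_measurable (F (real l * g))"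
      by (intro measurable_nat_filt_mono[OF v])
    then show ?thesis by (intro borel_measurable_clamp_abs borel_measurable_diff v that(2))
  qed
  have idm: "(\<lambda>x::real. x) \<in> borel_measurable borel" by simp
  have m1: "has_bochner_integral M (\<lambda>\<omega>. W (s + g) \<omega> - W s \<omega>) 0" if "0 \<le> s" for s
    using increment_mean[of s "s + g"] that g by simp
  have m2: "has_bochner_integral M (\<lambda>\<omega>. (W (s + g) \<omega> - W s \<omega>)\<^sup>2) g" if "0 \<le> s" for s
    using increment_square[of s "s + g"] that g by simp
  have e_eq: "e i = (\<lambda>\<omega>. \<Sum>j<k. clamp_abs \<eta> (v (real (j + i * k) * g) \<omega> - v (real (i * k) * g) \<omega>)
       * (W (real (i * k) * g + real (Suc j) * g) \<omega> - W (real (i * k) * g + real j * g) \<omega>))" for i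
  proof
    fix \<omega>
    let ?f = "\<lambda>l. clamp_abs \<eta> (v (real l * g) \<omega> - v (real (i * k) * g) \<omega>) * (W (real (Suc l) * g) \<omega> - W (real l * g) \<omega>)"
    have "e i \<omega> = (\<Sum>l=0 + i*k..<k + i*k. ?f l)" by (simp add: e_def add.commute)
    also have "\<dots> = (\<Sum>j=0..<k. ?f (j + i * k))" by (rule sum.shift_bounds_nat_ivl)
    also have "\<dots> = (\<Sum>j<k. ?f (j + i * k))" by (simp add: atLeast0LessThan)
    finally show "e i \<omega> = (\<Sum>j<k. clamp_abs \<eta> (v (real (j + i * k) * g) \<omega> - v (real (i * k) * g) \<omega>)
       * (W (real (i * k) * g + real (Suc j) * g) \<omega> - W (real (i * k) * g + real j * g) \<omega>))"
      by (simp add: algebra_simps)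
  qed
  have e: "e i \<in> borel_measurable M \<and> integrable M (\<lambda>\<omega>. (e i \<omega>)\<^sup>2) \<and> expectation (\<lambda>\<omega>. (e i \<omega>)\<^sup>2) \<le> \<eta>\<^sup>2 * h"
    if i: "i < n" for i
  proof -
    have c: "(\<lambda>\<omega>. clamp_abs \<eta> (v (real (j + i * k) * g) \<omega> - v (real (i * k) * g) \<omega>))
        \<in> borel_measurable (F (real (i * k) * g + real j * g))" if "j < k" for j
    proof -
      have "real (i * k) * g + real j * g = real (j + i * k) * g" by (simp add: algebra_simps)
      moreover have "j + i * k < n * k" using lnk[OF i that] by simp
      ultimately show ?thesis using clamp_meas[of i "j + i * k"] by (simp only: le_add2)
    qed
    have b: "\<bar>clamp_abs \<eta> (v (real (j + i * k) * g) \<omega> - v (real (i * k) * g) \<omega>)\<bar> \<le> \<eta>" for j \<omega>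
      by (rule clamp_abs_le) (use \<eta> in simp)
    have a: "0 \<le> real (i * k) * g" using g by simp
    note r = orthogonal_sum_bound[where a="real (i * k) * g" and h=g and n=k and K=\<eta> and \<psi>="\<lambda>x. x" and v=g and v'=g,
      OF a g c b idm m1 m2]
    show ?thesis unfolding e_eq
      using r(1) r(2) r(3) g by (auto simp: h_def mult_ac)
  qed
  then show "\<And>i. i < n \<Longrightarrow> e i \<in> borel_measurable M" by blast
  define A where "A \<omega> = (\<Sum>i<n. Rh i \<omega> * e i \<omega>)" for \<omega>
  \<comment> \<open>Index \<open>l\<close> of the fine grid lies in the coarse cell
    \<open>l div k\<close>, so the double sum becomes one sum over \<open>n * k\<close> fine
    steps.\<close>
  define c where "c l \<omega> = Rh (l div k) \<omega> * clamp_abs \<eta> (v (real l * g) \<omega> - v (real (l div k * k) * g) \<omega>)" for l \<omega>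
  have A_eq: "A = (\<lambda>\<omega>. \<Sum>l<n * k. c l \<omega> * (W (0 + real (Suc l) * g) \<omega> - W (0 + real l * g) \<omega>))"
  proof
    fix \<omega>
    have "A \<omega> = (\<Sum>i<n. \<Sum>l=i*k..<i*k+k. c l \<omega> * (W (0 + real (Suc l) * g) \<omega> - W (0 + real l * g) \<omega>))"
      unfolding A_def e_def sum_distrib_left
    proof (intro sum.cong refl)
      fix i l assume "l \<in> {i*k..<i*k+k}"
      then have "l div k = i" using k by (intro div_nat_eqI) (auto simp: mult.commute)
      then show "Rh i \<omega> * (clamp_abs \<eta> (v (real l * g) \<omega> - v (real (i * k) * g) \<omega>) * (W (real (Suc l) * g) \<omega> - W (real l * g) \<omega>))
        = c l \<omega> * (W (0 + real (Suc l) * g) \<omega> - W (0 + real l * g) \<omega>)"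
        by (simp add: c_def)
    qed
    also have "\<dots> = (\<Sum>l<n * k. c l \<omega> * (W (0 + real (Suc l) * g) \<omega> - W (0 + real l * g) \<omega>))"
      by (rule sum.nat_group)
    finally show "A \<omega> = (\<Sum>l<n * k. c l \<omega> * (W (0 + real (Suc l) * g) \<omega> - W (0 + real l * g) \<omega>))" .
  qed
  have dk: "l div k < n" "l div k * k \<le> l" if "l < n * k" for l
    using that k by (auto simp: less_mult_imp_div_less)
  have cm: "c l \<in> borel_measurable (F (0 + real l * g))" if l: "l < n * k" for l
  proof -
    have "Rh (l div k) \<in> borel_measurable (F (real l * g))"
      using dk[OF l] g by (intro measurable_nat_filt_mono[OF Rh]) (auto intro!: mult_right_mono simp del: of_nat_mult)
    then show ?thesis unfolding c_def using clamp_meas[of "l div k" l] dk[OF l] l by (simp add: borel_measurable_times)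
  qed
  have cb: "\<bar>c l \<omega>\<bar> \<le> K * \<eta>" if "l < n * k" "\<omega> \<in> space M" for l \<omega>
    unfolding c_def abs_mult using that dk bound[of "l div k" \<omega>] \<eta> K by (intro mult_mono clamp_abs_le) auto
  note r = orthogonal_sum_bound[where a=0 and h=g and n="n * k" and K="K * \<eta>" and c=c and \<psi>="\<lambda>x. x" and v=g and v'=g,
      OF order_refl g cm cb idm m1 m2 order_refl less_imp_le[OF g]]
  have AM: "A \<in> borel_measurable M" unfolding A_eq by (rule r(1))
  have "prob_norm A \<le> sqrt (expectation (\<lambda>\<omega>. (A \<omega>)\<^sup>2))"
    unfolding A_eq by (rule prob_norm_le_sqrt[OF r(1,2)])
  also have "\<dots> \<le> sqrt ((K * \<eta>)\<^sup>2 * (real n * h))"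
    unfolding A_eq using r(3) by (intro real_sqrt_le_mono) (simp add: h_def mult_ac)
  also have "\<dots> = K * \<eta> * sqrt (real n * h)" using K \<eta> by (simp add: real_sqrt_mult)
  finally have pA: "prob_norm A \<le> K * \<eta> * sqrt (real n * h)" .
  have Q2: "has_bochner_integral M (\<lambda>\<omega>. (Q i \<omega> - 1)\<^sup>2) (recip_step_square \<beta>0 \<beta>1 h)" for i
  proof -
    have "real (Suc i * k) * g - real (i * k) * g = h" by (simp add: h_def algebra_simps)
    moreover have "real (i * k) * g < real (Suc i * k) * g" using g k by (intro mult_strict_right_mono) auto
    ultimately show ?thesis unfolding Q_def
      using increment_recip_step[of "real (i * k) * g" "real (Suc i * k) * g" \<beta>0 \<beta>1] g by simp
  qed
  define B where "B \<omega> = (\<Sum>i<n. Rh i \<omega> * e i \<omega> * (Q i \<omega> - 1))" for \<omega>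
  define D where "D \<omega> = (\<Sum>i<n. K * ((e i \<omega>)\<^sup>2 / \<eta> + \<eta> * (Q i \<omega> - 1)\<^sup>2) / 2)" for \<omega>
  have iD: "integrable M (\<lambda>\<omega>. K * ((e i \<omega>)\<^sup>2 / \<eta> + \<eta> * (Q i \<omega> - 1)\<^sup>2) / 2)" if "i < n" for i
    using e[OF that] Q2[of i] by (auto simp: has_bochner_integral_iff)
  then have D_int: "integrable M D" unfolding D_def by (intro Bochner_Integration.integrable_sum) auto
  have D0: "0 \<le> D \<omega>" for \<omega> unfolding D_def using K \<eta> by (intro sum_nonneg) auto
  have BM: "B \<in> borel_measurable M"
    unfolding B_def using RM e QM by (intro borel_measurable_sum borel_measurable_times borel_measurable_diff) auto
  have "prob_norm B \<le> prob_norm D"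
  proof (rule prob_norm_mono[OF BM _ AE_I2])
    show "D \<in> borel_measurable M" using D_int by auto
    fix \<omega> assume \<omega>: "\<omega> \<in> space M"
    have "\<bar>B \<omega>\<bar> \<le> (\<Sum>i<n. \<bar>Rh i \<omega> * e i \<omega> * (Q i \<omega> - 1)\<bar>)" unfolding B_def by (rule sum_abs)
    also have "\<dots> \<le> D \<omega>" unfolding D_def
    proof (intro sum_mono)
      fix i assume i: "i \<in> {..<n}"
      let ?x = "e i \<omega>" and ?y = "Q i \<omega> - 1"
      have "\<bar>Rh i \<omega> * ?x * ?y\<bar> \<le> K * \<bar>?x * ?y\<bar>"
        using bound[of i \<omega>] i \<omega> by (simp add: abs_mult mult.assoc mult_right_mono)
      \<comment> \<open>Young's inequality weighted by \<eta>: the second moment of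
        \<open>e i\<close> is at most \<open>\<eta>\<^sup>2 * h\<close> and that of
        \<open>Q i - 1\<close> is of order \<open>h\<close>, so both terms come out of order
        \<open>\<eta> * h\<close>.\<close>
      also have "\<bar>?x * ?y\<bar> \<le> (?x\<^sup>2 / \<eta> + \<eta> * ?y\<^sup>2) / 2"
      proof -
        have "0 \<le> (\<bar>?x\<bar> - \<eta> * \<bar>?y\<bar>)\<^sup>2" by simp
        also have "\<dots> = ?x\<^sup>2 + \<eta>\<^sup>2 * ?y\<^sup>2 - 2 * \<eta> * \<bar>?x * ?y\<bar>"
          by (simp add: power2_diff power_mult_distrib abs_mult)
        finally have "2 * \<eta> * \<bar>?x * ?y\<bar> \<le> ?x\<^sup>2 + \<eta>\<^sup>2 * ?y\<^sup>2" by simp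
        then have "2 * \<eta> * \<bar>?x * ?y\<bar> / (2 * \<eta>) \<le> (?x\<^sup>2 + \<eta>\<^sup>2 * ?y\<^sup>2) / (2 * \<eta>)"
          using \<eta> by (intro divide_right_mono) auto
        then show ?thesis using \<eta> by (simp add: add_divide_distrib power2_eq_square)
      qed
      finally show "\<bar>Rh i \<omega> * ?x * ?y\<bar> \<le> K * (?x\<^sup>2 / \<eta> + \<eta> * ?y\<^sup>2) / 2"
        using K by (simp add: mult_left_mono)
    qed
    finally show "\<bar>B \<omega>\<bar> \<le> \<bar>D \<omega>\<bar>" using D0[of \<omega>] by simp
  qed
  also have "prob_norm D \<le> expectation D"
    using prob_norm_le_expectation[OF D_int] D0 by simp
  also have "expectation D = (\<Sum>i<n. expectation (\<lambda>\<omega>. K * ((e i \<omega>)\<^sup>2 / \<eta> + \<eta> * (Q i \<omega> - 1)\<^sup>2) / 2))"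
    unfolding D_def using iD by (intro Bochner_Integration.integral_sum) auto
  also have "\<dots> \<le> (\<Sum>i<n. K * (\<eta> * h + \<eta> * recip_step_square \<beta>0 \<beta>1 h) / 2)"
  proof (intro sum_mono)
    fix i assume i: "i \<in> {..<n}"
    have "expectation (\<lambda>\<omega>. K * ((e i \<omega>)\<^sup>2 / \<eta> + \<eta> * (Q i \<omega> - 1)\<^sup>2) / 2)
        = K * (expectation (\<lambda>\<omega>. (e i \<omega>)\<^sup>2) / \<eta> + \<eta> * recip_step_square \<beta>0 \<beta>1 h) / 2"
      using e[of i] i Q2[of i] by (simp add: has_bochner_integral_iff)
    also have "expectation (\<lambda>\<omega>. (e i \<omega>)\<^sup>2) / \<eta> \<le> \<eta> * h"
      using e[of i] i \<eta> by (simp add: field_simps power2_eq_square)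
    finally show "expectation (\<lambda>\<omega>. K * ((e i \<omega>)\<^sup>2 / \<eta> + \<eta> * (Q i \<omega> - 1)\<^sup>2) / 2) \<le> K * (\<eta> * h + \<eta> * recip_step_square \<beta>0 \<beta>1 h) / 2"
      using K by (simp add: mult_left_mono)
  qed
  also have "\<dots> = K * \<eta> * (real n * h + real n * recip_step_square \<beta>0 \<beta>1 h) / 2"
    by (simp add: algebra_simps)
  finally have pB: "prob_norm B \<le> K * \<eta> * (real n * h + real n * recip_step_square \<beta>0 \<beta>1 h) / 2" .
  have "(\<lambda>\<omega>. \<Sum>i<n. Rh i \<omega> * e i \<omega> * Q i \<omega>) = (\<lambda>\<omega>. A \<omega> + B \<omega>)"
    unfolding A_def B_def by (rule ext) (simp add: sum.distrib[symmetric] algebra_simps)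
  then show "prob_norm (\<lambda>\<omega>. \<Sum>i<n. Rh i \<omega> * e i \<omega> * Q i \<omega>)
    \<le> K * \<eta> * sqrt (real n * h) + K * \<eta> * (real n * h + real n * recip_step_square \<beta>0 \<beta>1 h) / 2"
    using prob_norm_add[OF AM BM] pA pB by simp
qed

text \<open>Taking \<open>i * k\<close> Riemann points on the interval from 0 to
  \<open>i * h\<close> gives mesh \<open>h / k\<close> for every \<open>i\<close>. So the sums for
  all coarse points share one fine grid, and their consecutive differences are sums over single
  coarse cells.\<close>

lemma riemann_increments_converge:
  fixes v Y :: "real \<Rightarrow> 'w \<Rightarrow> real" and t \<beta>1 :: real
  assumes t: "0 < t"
    and ad: "\<And>r. r \<in> {0..t} \<Longrightarrow> v r \<in> borel_measurable (F r)"
    and cont: "AE \<omega> in M. continuous_on {0..t} (\<lambda>r. v r \<omega>)"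
    and ito: "\<And>s. s \<in> {0<..t} \<Longrightarrow> is_ito_integral M W 0 s (\<lambda>r \<omega>. \<beta>1 * v r \<omega>) (Y s)"
    and Y0: "\<And>\<omega>. Y 0 \<omega> = 0"
    and n: "0 < n" and i: "i \<le> n"
  defines "h \<equiv> t / real n"
  shows "(\<lambda>k. prob_norm (\<lambda>\<omega>. (\<Sum>l<i * k. \<beta>1 * v (real l * (h / real k)) \<omega>
            * (W (real (Suc l) * (h / real k)) \<omega> - W (real l * (h / real k)) \<omega>)) - Y (real i * h) \<omega>)) \<longlonglongrightarrow> 0"
proof (cases "i = 0")
  case True
  then show ?thesis by (simp add: Y0 prob_norm_def)
next
  case False
  define s where "s = real i * h"
  have h: "0 < h" using t n by (simp add: h_def)
  have "real i * h \<le> real n * h" using i h by (intro mult_right_mono) auto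
  moreover have "real n * h = t" using n by (simp add: h_def)
  ultimately have s: "0 < s" "s \<le> t" using False h by (auto simp: s_def)
  have "(\<lambda>m. prob_norm (\<lambda>\<omega>. (\<Sum>j<m. \<beta>1 * v (real j * s / real m) \<omega> *
      (W (real (Suc j) * s / real m) \<omega> - W (real j * s / real m) \<omega>)) - Y s \<omega>)) \<longlonglongrightarrow> 0"
  proof (rule ito_integral_riemann_sums[OF s(1)])
    show "(\<lambda>\<omega>. \<beta>1 * v r \<omega>) \<in> borel_measurable (F r)" if "r \<in> {0..s}" for r
      using ad[of r] that s by simp
    show "AE \<omega> in M. continuous_on {0..s} (\<lambda>r. \<beta>1 * v r \<omega>)"
      using cont by eventually_elim (use s in \<open>auto intro!: continuous_intros intro: continuous_on_subset\<close>)
    show "is_ito_integral M W 0 s (\<lambda>r \<omega>. \<beta>1 * v r \<omega>) (Y s)" using ito s by simp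
  qed
  moreover have "filterlim (\<lambda>k. i * k) at_top sequentially"
    using False by (intro filterlim_at_top_mono[OF filterlim_ident]) auto
  ultimately have lim: "(\<lambda>k. prob_norm (\<lambda>\<omega>. (\<Sum>j<i * k. \<beta>1 * v (real j * s / real (i * k)) \<omega> *
      (W (real (Suc j) * s / real (i * k)) \<omega> - W (real j * s / real (i * k)) \<omega>)) - Y s \<omega>)) \<longlonglongrightarrow> 0"
    by (rule filterlim_compose)
  have "x * s / real (i * k) = x * (h / real k)" for x and k :: nat
    using False by (simp add: s_def)
  with lim show ?thesis by (simp only: s_def[symmetric])
qed

text \<open>The increments of \<open>R * v\<close> over the coarse grid consist of an Euler defect,
  a noise error and a drift error. Their sums \<open>T1\<close>, \<open>T2\<close> and
  \<open>T3\<close> are made small by choosing, in this order, the path bound \<open>K\<close>, the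
  tolerance \<eta>, the coarse mesh and the fine mesh. \<open>Y\<close> carries no path regularity,
  so it is used at finitely many grid points only.\<close>

lemma scalar_linear_sde:
  fixes v Y :: "real \<Rightarrow> 'w \<Rightarrow> real" and t \<beta>0 \<beta>1 :: real
  assumes t: "0 < t"
    and ad: "\<And>r. r \<in> {0..t} \<Longrightarrow> v r \<in> borel_measurable (F r)"
    and cont: "AE \<omega> in M. continuous_on {0..t} (\<lambda>r. v r \<omega>)"
    and ito: "\<And>s. s \<in> {0<..t} \<Longrightarrow> is_ito_integral M W 0 s (\<lambda>r \<omega>. \<beta>1 * v r \<omega>) (Y s)"
    and Y0: "\<And>\<omega>. Y 0 \<omega> = 0"
    and eq: "\<And>s. s \<in> {0<..t} \<Longrightarrow> AE \<omega> in M. v s \<omega> = v 0 \<omega> + \<beta>0 * (LBINT r:{0..s}. v r \<omega>) + Y s \<omega>"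
  shows "AE \<omega> in M. v t \<omega> = v 0 \<omega> * exp ((\<beta>0 - \<beta>1\<^sup>2 / 2) * t + \<beta>1 * W t \<omega>)"
proof -
  define R where "R r \<omega> = exp (- (\<beta>0 - \<beta>1\<^sup>2 / 2) * r - \<beta>1 * W r \<omega>)" for r \<omega>
  have Rad: "R r \<in> borel_measurable (F r)" if "0 \<le> r" for r
  proof -
    have [measurable]: "W r \<in> borel_measurable (F r)" using that by (rule W_adapted) simp
    show ?thesis unfolding R_def[abs_def] by measurable
  qed
  have RM: "R r \<in> borel_measurable M" if "0 \<le> r" for r by (rule measurable_F[OF Rad[OF that]])
  have vM: "v r \<in> borel_measurable M" if "r \<in> {0..t}" for r by (rule measurable_F[OF ad[OF that]])
  have YM: "Y s \<in> borel_measurable M" if "s \<in> {0..t}" for s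
  proof (cases "s = 0")
    case True
    then have "Y s = (\<lambda>_. 0)" using Y0 by auto
    then show ?thesis by simp
  next
    case False then show ?thesis using ito[of s] that by (auto simp: is_ito_integral_def)
  qed
  have Rcont: "AE \<omega> in M. continuous_on {0..t} (\<lambda>r. R r \<omega>)"
    using W_continuous by eventually_elim (auto simp: R_def intro!: continuous_intros intro: continuous_on_subset)
  have Rvcont: "AE \<omega> in M. continuous_on {0..t} (\<lambda>r. R r \<omega> * v r \<omega>)"
    using Rcont cont by eventually_elim (intro continuous_on_mult)
  define Z where "Z \<omega> = R t \<omega> * v t \<omega> - R 0 \<omega> * v 0 \<omega>" for \<omega>
  have ZM: "Z \<in> borel_measurable M"
    unfolding Z_def[abs_def] using t by (intro borel_measurable_diff borel_measurable_times RM vM) auto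
  have small: "prob_norm Z \<le> 10 * \<epsilon>" if \<epsilon>: "\<epsilon> > 0" for \<epsilon>
  proof -
    obtain K1 B1 where K1: "1 \<le> K1" "B1 \<in> events" "prob B1 < \<epsilon>" "\<And>\<omega> r. \<omega> \<in> space M - B1 \<Longrightarrow> r \<in> {0..t} \<Longrightarrow> \<bar>R r \<omega>\<bar> \<le> K1"
      using continuous_process_bounded[OF _ Rcont \<epsilon>] RM by auto
    obtain K2 B2 where K2: "1 \<le> K2" "B2 \<in> events" "prob B2 < \<epsilon>" "\<And>\<omega> r. \<omega> \<in> space M - B2 \<Longrightarrow> r \<in> {0..t} \<Longrightarrow> \<bar>R r \<omega> * v r \<omega>\<bar> \<le> K2"
      using continuous_process_bounded[OF _ Rvcont \<epsilon>] RM vM by (auto simp: borel_measurable_times)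
    define K where "K = max K1 K2"
    have K: "1 \<le> K" "K1 \<le> K" "K2 \<le> K" using K1(1) by (auto simp: K_def)
    \<comment> \<open>\<open>C\<close> collects the factors of \<open>K * \<eta>\<close> in the
      bounds for \<open>T2\<close> and \<open>T3\<close>; the final 1 keeps it positive. Then
      \<open>K * \<eta> * C = \<epsilon>\<close>, and together with eight further errors of size
      \<epsilon> the total stays below \<open>10 * \<epsilon>\<close>.\<close>
    define C where "C = \<bar>\<beta>0\<bar> * t + max 1 \<bar>\<beta>1\<bar> * (sqrt t + (t + (t * \<beta>1\<^sup>2 + 1)) / 2) + 1"
    have C: "1 \<le> C" using t by (auto simp: C_def)
    define \<eta> where "\<eta> = \<epsilon> / (K * C)"
    have \<eta>: "0 < \<eta>" using \<epsilon> K C by (simp add: \<eta>_def)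
    have K\<eta>: "K * \<eta> * C = \<epsilon>" using K C by (simp add: \<eta>_def)
    obtain \<rho> B3 where B3: "\<rho> > 0" "B3 \<in> events" "prob B3 < \<epsilon>"
      "\<And>\<omega>. \<omega> \<in> space M - B3 \<Longrightarrow> continuous_on {0..t} (\<lambda>r. v r \<omega>)"
      "\<And>\<omega> r r'. \<omega> \<in> space M - B3 \<Longrightarrow> r \<in> {0..t} \<Longrightarrow> r' \<in> {0..t} \<Longrightarrow> \<bar>r - r'\<bar> < \<rho> \<Longrightarrow> \<bar>v r \<omega> - v r' \<omega>\<bar> \<le> \<eta>"
      using continuous_process_oscillation[OF vM cont \<epsilon> \<eta>] by auto
    have l1: "(\<lambda>n. K * \<bar>real n * defect_mean \<beta>0 \<beta>1 (t / real n)\<bar>) \<longlonglongrightarrow> K * \<bar>t * 0\<bar>"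
      by (intro tendsto_mult_left tendsto_rabs tendsto_nat_mult_deriv defect_0 defect_mean_deriv t)
    have l2: "(\<lambda>n. K * sqrt (real n * defect_square \<beta>0 \<beta>1 (t / real n))) \<longlonglongrightarrow> K * sqrt (t * 0)"
      by (intro tendsto_mult_left tendsto_real_sqrt tendsto_nat_mult_deriv defect_0 defect_square_deriv t)
    have l3: "(\<lambda>n. real n * recip_step_square \<beta>0 \<beta>1 (t / real n)) \<longlonglongrightarrow> t * \<beta>1\<^sup>2"
      by (intro tendsto_nat_mult_deriv defect_0 recip_step_square_deriv t)
    have l4: "(\<lambda>n. t / real n) \<longlonglongrightarrow> 0" by (rule lim_const_over_n)
    have "eventually (\<lambda>n. K * \<bar>real n * defect_mean \<beta>0 \<beta>1 (t / real n)\<bar> < \<epsilon>) sequentially"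
      using order_tendstoD(2)[OF l1, of \<epsilon>] \<epsilon> by simp
    moreover have "eventually (\<lambda>n. K * sqrt (real n * defect_square \<beta>0 \<beta>1 (t / real n)) < \<epsilon>) sequentially"
      using order_tendstoD(2)[OF l2, of \<epsilon>] \<epsilon> by simp
    moreover have "eventually (\<lambda>n. real n * recip_step_square \<beta>0 \<beta>1 (t / real n) < t * \<beta>1\<^sup>2 + 1) sequentially"
      using order_tendstoD(2)[OF l3, of "t * \<beta>1\<^sup>2 + 1"] by simp
    moreover have "eventually (\<lambda>n. t / real n < \<rho>) sequentially"
      using order_tendstoD(2)[OF l4 B3(1)] .
    ultimately have "eventually (\<lambda>n. 0 < n \<and> K * \<bar>real n * defect_mean \<beta>0 \<beta>1 (t / real n)\<bar> < \<epsilon> \<and> K * sqrt (real n * defect_square \<beta>0 \<beta>1 (t / real n)) < \<epsilon> \<and>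
      real n * recip_step_square \<beta>0 \<beta>1 (t / real n) < t * \<beta>1\<^sup>2 + 1 \<and> t / real n < \<rho>) sequentially"
      using eventually_gt_at_top[of 0] by eventually_elim simp
    then obtain n where n0: "0 < n" and nz1: "K * \<bar>real n * defect_mean \<beta>0 \<beta>1 (t / real n)\<bar> < \<epsilon>"
      and nz2: "K * sqrt (real n * defect_square \<beta>0 \<beta>1 (t / real n)) < \<epsilon>"
      and nz3: "real n * recip_step_square \<beta>0 \<beta>1 (t / real n) < t * \<beta>1\<^sup>2 + 1" and n\<rho>: "t / real n < \<rho>"
      by (auto simp: eventually_sequentially)
    define h where "h = t / real n"
    have h: "0 < h" "real n * h = t" using t n0 by (auto simp: h_def)
    define \<tau> where "\<tau> i = real i * h" for i
    have \<tau>0: "\<tau> 0 = 0" "\<tau> n = t" using h by (auto simp: \<tau>_def)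
    have \<tau>: "\<tau> i \<in> {0..t}" if "i \<le> n" for i
    proof -
      have "real i * h \<le> real n * h" using that h by (intro mult_right_mono) auto
      then show ?thesis using h by (auto simp: \<tau>_def)
    qed
    have \<tau>d: "\<tau> (Suc i) - \<tau> i = h" for i by (simp add: \<tau>_def algebra_simps)
    define \<Delta> where "\<Delta> i \<omega> = W (\<tau> (Suc i)) \<omega> - W (\<tau> i) \<omega>" for i \<omega>
    \<comment> \<open>The one-step relation is \<open>v (\<tau> (Suc i)) = v (\<tau> i) * (1 +
      \<beta>0 * h + \<beta>1 * \<Delta> i) + e i + d i\<close>, with noise error \<open>e\<close>
      and drift error \<open>d\<close>; multiplying the first term by \<open>recip_step\<close>
      produces the defect.\<close>
    define e where "e i \<omega> = Y (\<tau> (Suc i)) \<omega> - Y (\<tau> i) \<omega> - \<beta>1 * v (\<tau> i) \<omega> * \<Delta> i \<omega>" for i \<omega>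
    define d where "d i \<omega> = v (\<tau> (Suc i)) \<omega> - v (\<tau> i) \<omega> - \<beta>0 * h * v (\<tau> i) \<omega> - (Y (\<tau> (Suc i)) \<omega> - Y (\<tau> i) \<omega>)" for i \<omega>
    have Rq: "R (\<tau> (Suc i)) \<omega> = R (\<tau> i) \<omega> * recip_step \<beta>0 \<beta>1 h (\<Delta> i \<omega>)" for i \<omega>
      unfolding R_def recip_step_def \<Delta>_def exp_add[symmetric]
      by (rule arg_cong[where f=exp]) (simp add: \<tau>_def algebra_simps)
    have \<Delta>M: "\<Delta> i \<in> borel_measurable M" for i
      unfolding \<Delta>_def[abs_def] \<tau>_def using h by (intro borel_measurable_diff W_measurable) auto
    have eM: "e i \<in> borel_measurable M" if "i < n" for i
      unfolding e_def[abs_def] using that \<tau> \<Delta>M by (intro borel_measurable_diff borel_measurable_times YM vM) auto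
    have dM: "d i \<in> borel_measurable M" if "i < n" for i
      unfolding d_def[abs_def] using that \<tau> by (intro borel_measurable_diff borel_measurable_times YM vM) auto
    have RM': "R (\<tau> i) \<in> borel_measurable M" for i using h by (intro RM) (simp add: \<tau>_def)
    define T1 where "T1 \<omega> = (\<Sum>i<n. R (\<tau> i) \<omega> * v (\<tau> i) \<omega> * euler_defect \<beta>0 \<beta>1 h (\<Delta> i \<omega>))" for \<omega>
    define T2 where "T2 \<omega> = (\<Sum>i<n. R (\<tau> (Suc i)) \<omega> * e i \<omega>)" for \<omega>
    define T3 where "T3 \<omega> = (\<Sum>i<n. R (\<tau> (Suc i)) \<omega> * d i \<omega>)" for \<omega>
    have \<zeta>M: "(\<lambda>\<omega>. euler_defect \<beta>0 \<beta>1 h (\<Delta> i \<omega>)) \<in> borel_measurable M" for i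
      by (rule measurable_compose[OF \<Delta>M borel_measurable_euler_defect])
    have T1M: "T1 \<in> borel_measurable M" unfolding T1_def[abs_def]
      using \<tau> by (intro borel_measurable_sum borel_measurable_times RM' vM \<zeta>M) auto
    have T2M: "T2 \<in> borel_measurable M" unfolding T2_def[abs_def]
      using eM by (intro borel_measurable_sum borel_measurable_times RM') auto
    have T3M: "T3 \<in> borel_measurable M" unfolding T3_def[abs_def]
      using dM by (intro borel_measurable_sum borel_measurable_times RM') auto
    have Zeq: "Z \<omega> = T1 \<omega> + (T2 \<omega> + T3 \<omega>)" for \<omega>
    proof -
      have "Z \<omega> = (\<Sum>i<n. R (\<tau> (Suc i)) \<omega> * v (\<tau> (Suc i)) \<omega> - R (\<tau> i) \<omega> * v (\<tau> i) \<omega>)"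
        by (subst sum_lessThan_telescope) (simp add: Z_def \<tau>0)
      also have "\<dots> = (\<Sum>i<n. R (\<tau> i) \<omega> * v (\<tau> i) \<omega> * euler_defect \<beta>0 \<beta>1 h (\<Delta> i \<omega>) + (R (\<tau> (Suc i)) \<omega> * e i \<omega> + R (\<tau> (Suc i)) \<omega> * d i \<omega>))"
      proof (intro sum.cong refl)
        fix i
        have vs: "v (\<tau> (Suc i)) \<omega> = v (\<tau> i) \<omega> * (1 + \<beta>0 * h + \<beta>1 * \<Delta> i \<omega>) + e i \<omega> + d i \<omega>"
          by (simp add: e_def d_def algebra_simps)
        show "R (\<tau> (Suc i)) \<omega> * v (\<tau> (Suc i)) \<omega> - R (\<tau> i) \<omega> * v (\<tau> i) \<omega>
          = R (\<tau> i) \<omega> * v (\<tau> i) \<omega> * euler_defect \<beta>0 \<beta>1 h (\<Delta> i \<omega>) + (R (\<tau> (Suc i)) \<omega> * e i \<omega> + R (\<tau> (Suc i)) \<omega> * d i \<omega>)"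
          unfolding vs euler_defect_def Rq by (simp add: algebra_simps)
      qed
      finally show ?thesis by (simp add: T1_def T2_def T3_def sum.distrib)
    qed
    have p1: "prob_norm T1 \<le> 3 * \<epsilon>"
    proof -
      let ?T1' = "\<lambda>\<omega>. \<Sum>i<n. clamp_abs K (R (\<tau> i) \<omega> * v (\<tau> i) \<omega>) * euler_defect \<beta>0 \<beta>1 h (W (real (Suc i) * h) \<omega> - W (real i * h) \<omega>)"
      have T1'M: "?T1' \<in> borel_measurable M"
        using \<zeta>M \<tau> unfolding \<Delta>_def \<tau>_def
        by (intro borel_measurable_sum borel_measurable_times borel_measurable_clamp_abs RM'[unfolded \<tau>_def] vM) auto
      have "prob_norm T1 \<le> prob_norm ?T1' + prob B2"
      proof (intro prob_norm_le_AE AE_I2 impI T1M T1'M K2(2))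
        fix \<omega> assume \<omega>: "\<omega> \<in> space M" "\<omega> \<notin> B2"
        have "clamp_abs K (R (\<tau> i) \<omega> * v (\<tau> i) \<omega>) = R (\<tau> i) \<omega> * v (\<tau> i) \<omega>" if "i < n" for i
          using K2(4)[of \<omega> "\<tau> i"] \<tau>[of i] that \<omega> K by (intro clamp_abs_id) auto
        then show "\<bar>T1 \<omega>\<bar> \<le> \<bar>?T1' \<omega>\<bar>" by (simp add: T1_def \<Delta>_def \<tau>_def del: of_nat_Suc)
      qed
      also have "prob_norm ?T1' \<le> K * sqrt (real n * defect_square \<beta>0 \<beta>1 h) + K * \<bar>real n * defect_mean \<beta>0 \<beta>1 h\<bar>"
      proof (rule euler_error_prob_norm_le[OF h(1)])
        show "(\<lambda>\<omega>. clamp_abs K (R (\<tau> i) \<omega> * v (\<tau> i) \<omega>)) \<in> borel_measurable (F (real i * h))" if "i < n" for i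
          using \<tau>[of i] that unfolding \<tau>_def by (intro borel_measurable_clamp_abs borel_measurable_times Rad ad) auto
      qed (use K in \<open>auto intro: clamp_abs_le\<close>)
      finally show ?thesis using nz1 nz2 K2(3) unfolding h_def by linarith
    qed
    \<comment> \<open>The equation holds almost surely for each time; finitely many grid points
      allow one null set. At time 0 it is trivial.\<close>
    have AEeq: "AE \<omega> in M. \<forall>i\<in>{..n}. v (\<tau> i) \<omega> = v 0 \<omega> + \<beta>0 * (LBINT r:{0..\<tau> i}. v r \<omega>) + Y (\<tau> i) \<omega>"
    proof (rule AE_finite_allI)
      fix i assume i: "i \<in> {..n}"
      show "AE \<omega> in M. v (\<tau> i) \<omega> = v 0 \<omega> + \<beta>0 * (LBINT r:{0..\<tau> i}. v r \<omega>) + Y (\<tau> i) \<omega>"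
      proof (cases "i = 0")
        case True
        have "(LBINT r:{0::real..0}. v r \<omega>) = 0" for \<omega>
          using set_borel_integral_eq_integral(2)[OF borel_integrable_atLeastAtMost'[of 0 0 "\<lambda>r. v r \<omega>"]] by simp
        then show ?thesis using True by (simp add: \<tau>0 Y0)
      next
        case False
        then have "0 < \<tau> i" using h by (simp add: \<tau>_def)
        then show ?thesis using \<tau>[of i] i by (intro eq) auto
      qed
    qed simp
    \<comment> \<open>Each drift error carries a factor \<open>h\<close> besides \<eta>, so they add
      up to a multiple of \<open>\<eta> * t\<close>, whatever the number of cells.\<close>
    have p3: "prob_norm T3 \<le> K * \<bar>\<beta>0\<bar> * \<eta> * t + 2 * \<epsilon>"
    proof -
      have "prob_norm T3 \<le> prob_norm (\<lambda>_. K * \<bar>\<beta>0\<bar> * \<eta> * t) + prob (B1 \<union> B3)"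
      proof (rule prob_norm_le_AE[OF T3M])
        show "AE \<omega> in M. \<omega> \<notin> B1 \<union> B3 \<longrightarrow> \<bar>T3 \<omega>\<bar> \<le> \<bar>K * \<bar>\<beta>0\<bar> * \<eta> * t\<bar>"
          using AEeq AE_space
        proof eventually_elim
          case (elim \<omega>)
          show ?case
          proof
            assume \<omega>: "\<omega> \<notin> B1 \<union> B3"
            have "\<bar>R (\<tau> (Suc i)) \<omega> * d i \<omega>\<bar> \<le> K * (\<bar>\<beta>0\<bar> * (\<eta> * h))" if i: "i < n" for i
            proof -
              have "d i \<omega> = \<beta>0 * ((LBINT r:{0..\<tau> (Suc i)}. v r \<omega>) - (LBINT r:{0..\<tau> i}. v r \<omega>) - (\<tau> (Suc i) - \<tau> i) * v (\<tau> i) \<omega>)"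
                using elim(1) i unfolding d_def \<tau>d by (simp add: algebra_simps)
              moreover have "\<bar>(LBINT r:{0..\<tau> (Suc i)}. v r \<omega>) - (LBINT r:{0..\<tau> i}. v r \<omega>) - (\<tau> (Suc i) - \<tau> i) * v (\<tau> i) \<omega>\<bar> \<le> \<eta> * (\<tau> (Suc i) - \<tau> i)"
              proof (rule set_integral_increment_close)
                show "0 \<le> \<tau> i" "\<tau> i \<le> \<tau> (Suc i)" "\<tau> (Suc i) \<le> t" using \<tau>[of i] \<tau>[of "Suc i"] i \<tau>d[of i] h by auto
                show "continuous_on {0..t} (\<lambda>r. v r \<omega>)" using B3(4) \<omega> elim(2) by auto
                show "\<bar>v r \<omega> - v (\<tau> i) \<omega>\<bar> \<le> \<eta>" if "r \<in> {\<tau> i..\<tau> (Suc i)}" for r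
                  using that \<tau>[of i] \<tau>[of "Suc i"] i \<tau>d[of i] n\<rho> \<omega> elim(2) unfolding h_def by (intro B3(5)) auto
              qed
              ultimately have "\<bar>d i \<omega>\<bar> \<le> \<bar>\<beta>0\<bar> * (\<eta> * h)" unfolding \<tau>d by (simp add: abs_mult mult_left_mono)
              moreover have "\<bar>R (\<tau> (Suc i)) \<omega>\<bar> \<le> K" using K1(4)[of \<omega> "\<tau> (Suc i)"] \<tau>[of "Suc i"] i \<omega> elim(2) K by auto
              ultimately show ?thesis unfolding abs_mult using K by (intro mult_mono) auto
            qed
            then have "(\<Sum>i<n. \<bar>R (\<tau> (Suc i)) \<omega> * d i \<omega>\<bar>) \<le> (\<Sum>i<n. K * (\<bar>\<beta>0\<bar> * (\<eta> * h)))" by (intro sum_mono) auto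
            then have "\<bar>T3 \<omega>\<bar> \<le> (\<Sum>i<n. K * (\<bar>\<beta>0\<bar> * (\<eta> * h)))"
              unfolding T3_def using sum_abs[of "\<lambda>i. R (\<tau> (Suc i)) \<omega> * d i \<omega>" "{..<n}"] by linarith
            also have "\<dots> = K * \<bar>\<beta>0\<bar> * \<eta> * (real n * h)" by simp
            finally show "\<bar>T3 \<omega>\<bar> \<le> \<bar>K * \<bar>\<beta>0\<bar> * \<eta> * t\<bar>" unfolding h(2) by linarith
          qed
        qed
      qed (use K1 B3 in auto)
      also have "prob_norm (\<lambda>_. K * \<bar>\<beta>0\<bar> * \<eta> * t) \<le> K * \<bar>\<beta>0\<bar> * \<eta> * t"
        using prob_norm_le_expectation[of "\<lambda>_. K * \<bar>\<beta>0\<bar> * \<eta> * t"] K \<eta> t by (simp add: prob_space abs_mult)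
      also have "prob (B1 \<union> B3) \<le> prob B1 + prob B3" using K1 B3 by (intro measure_Un_le) auto
      finally show ?thesis using K1(3) B3(3) by linarith
    qed
    define G where "G i k \<omega> = (\<Sum>l<i * k. \<beta>1 * v (real l * (h / real k)) \<omega> * (W (real (Suc l) * (h / real k)) \<omega> - W (real l * (h / real k)) \<omega>))" for i k \<omega>
    have grid: "real l * (h / real k) \<in> {0..t}" if "l \<le> n * k" for l k
    proof (cases "k = 0")
      case False
      have "real l * (h / real k) \<le> real (n * k) * (h / real k)" using that h by (intro mult_right_mono) (simp_all only: of_nat_le_iff divide_nonneg_nonneg of_nat_0_le_iff less_imp_le)
      also have "\<dots> = t" using False h(2) by simp
      finally show ?thesis using h by simp
    qed (use t in simp)
    have GM: "G i k \<in> borel_measurable M" if "i \<le> n" for i k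
      unfolding G_def[abs_def]
    proof (intro borel_measurable_sum borel_measurable_times borel_measurable_diff borel_measurable_const)
      fix l assume "l \<in> {..<i * k}"
      then have "l < i * k" by simp
      also have "i * k \<le> n * k" using that by (rule mult_le_mono1)
      finally have l: "l < n * k" .
      show "v (real l * (h / real k)) \<in> borel_measurable M" using l by (intro vM grid) simp
      show "W (real (Suc l) * (h / real k)) \<in> borel_measurable M" "W (real l * (h / real k)) \<in> borel_measurable M"
        using h by (auto intro!: W_measurable)
    qed
    have Glim: "(\<lambda>k. prob_norm (\<lambda>\<omega>. G i k \<omega> - Y (\<tau> i) \<omega>)) \<longlonglongrightarrow> 0" if "i \<le> n" for i
      unfolding G_def \<tau>_def h_def by (rule riemann_increments_converge[OF t ad cont ito Y0 n0 that])
    \<comment> \<open>The weight \<open>R\<close> is unbounded here, so the convergence rests on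
      tightness.\<close>
    have Elim: "(\<lambda>k. prob_norm (\<lambda>\<omega>. R (\<tau> (Suc i)) \<omega> * ((G (Suc i) k \<omega> - Y (\<tau> (Suc i)) \<omega>) - (G i k \<omega> - Y (\<tau> i) \<omega>)))) \<longlonglongrightarrow> 0"
      if i: "i < n" for i
    proof (rule prob_norm_mult_tendsto_0[OF RM'])
      have m: "(\<lambda>\<omega>. G j k \<omega> - Y (\<tau> j) \<omega>) \<in> borel_measurable M" if "j \<le> n" for j k
        using that by (intro borel_measurable_diff GM YM \<tau>)
      show "(\<lambda>\<omega>. (G (Suc i) k \<omega> - Y (\<tau> (Suc i)) \<omega>) - (G i k \<omega> - Y (\<tau> i) \<omega>)) \<in> borel_measurable M" for k
        using i by (intro borel_measurable_diff[OF m m]) auto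
      have lim: "(\<lambda>k. prob_norm (\<lambda>\<omega>. G (Suc i) k \<omega> - Y (\<tau> (Suc i)) \<omega>) + prob_norm (\<lambda>\<omega>. G i k \<omega> - Y (\<tau> i) \<omega>)) \<longlonglongrightarrow> 0"
        using tendsto_add[OF Glim[of "Suc i"] Glim[of i]] i by simp
      show "(\<lambda>k. prob_norm (\<lambda>\<omega>. (G (Suc i) k \<omega> - Y (\<tau> (Suc i)) \<omega>) - (G i k \<omega> - Y (\<tau> i) \<omega>))) \<longlonglongrightarrow> 0"
        by (rule tendsto_sandwich[OF _ _ tendsto_const lim])
           (use i in \<open>auto intro!: always_eventually prob_norm_nonneg prob_norm_diff m\<close>)
    qed
    \<comment> \<open>\<open>n\<close> is fixed by now, so finitely many convergences are met by one
      \<open>k\<close>.\<close>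
    have "(\<lambda>k. \<Sum>i<n. prob_norm (\<lambda>\<omega>. R (\<tau> (Suc i)) \<omega> * ((G (Suc i) k \<omega> - Y (\<tau> (Suc i)) \<omega>) - (G i k \<omega> - Y (\<tau> i) \<omega>)))) \<longlonglongrightarrow> (\<Sum>i<n. 0)"
      using Elim by (intro tendsto_sum) auto
    then have "eventually (\<lambda>k. (\<Sum>i<n. prob_norm (\<lambda>\<omega>. R (\<tau> (Suc i)) \<omega> * ((G (Suc i) k \<omega> - Y (\<tau> (Suc i)) \<omega>) - (G i k \<omega> - Y (\<tau> i) \<omega>)))) < \<epsilon>) sequentially"
      using order_tendstoD(2)[of _ 0 sequentially \<epsilon>] \<epsilon> by simp
    then have "eventually (\<lambda>k. 0 < k \<and> (\<Sum>i<n. prob_norm (\<lambda>\<omega>. R (\<tau> (Suc i)) \<omega> * ((G (Suc i) k \<omega> - Y (\<tau> (Suc i)) \<omega>) - (G i k \<omega> - Y (\<tau> i) \<omega>)))) < \<epsilon>) sequentially"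
      using eventually_gt_at_top[of 0] by eventually_elim simp
    then obtain k where k: "0 < k" and
      kE: "(\<Sum>i<n. prob_norm (\<lambda>\<omega>. R (\<tau> (Suc i)) \<omega> * ((G (Suc i) k \<omega> - Y (\<tau> (Suc i)) \<omega>) - (G i k \<omega> - Y (\<tau> i) \<omega>)))) < \<epsilon>"
      by (auto simp: eventually_sequentially)
    define g where "g = h / real k"
    have g: "0 < g" "real k * g = h" using h k by (auto simp: g_def)
    have ikg: "real (i * k) * g = \<tau> i" for i using g(2) by (simp add: \<tau>_def mult.assoc)
    \<comment> \<open>\<open>Eh\<close> and \<open>Rh\<close> carry the truncations that the noise
      estimate requires. Off \<open>B1 \<union> B3\<close> the coarse mesh keeps the differences of
      \<open>v\<close> within \<eta> and \<open>R\<close> within \<open>K\<close>, so nothing is cut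
      there.\<close>
    define Eh where "Eh i \<omega> = (\<Sum>l=i*k..<i*k+k. clamp_abs \<eta> (v (real l * g) \<omega> - v (real (i * k) * g) \<omega>) * (W (real (Suc l) * g) \<omega> - W (real l * g) \<omega>))" for i \<omega>
    define Rh where "Rh i \<omega> = clamp_abs K (R (\<tau> i) \<omega>)" for i \<omega>
    have Rhm: "Rh i \<in> borel_measurable (F (real (i * k) * g))" for i
      unfolding Rh_def[abs_def] ikg using h by (intro borel_measurable_clamp_abs Rad) (simp add: \<tau>_def)
    have vm: "v (real l * g) \<in> borel_measurable (F (real l * g))" if "l < n * k" for l
      unfolding g_def using that by (intro ad grid) simp
    have Rhb: "\<bar>Rh i \<omega>\<bar> \<le> K" for i \<omega> unfolding Rh_def using K by (intro clamp_abs_le) simp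
    have K0: "0 \<le> K" using K by simp
    note noise1 = noise_error_prob_norm_le(1)[where v=v and Rh=Rh and K=K and ?\<beta>0.0=\<beta>0 and ?\<beta>1.0=\<beta>1 and n=n,
        OF g(1) k K0 \<eta> vm Rhm Rhb, unfolded g(2) ikg]
    note noise2 = noise_error_prob_norm_le(2)[where v=v and Rh=Rh and K=K and n=n,
        OF g(1) k K0 \<eta> vm Rhm Rhb, unfolded g(2) ikg]
    define U where "U \<omega> = (\<Sum>i<n. Rh i \<omega> * Eh i \<omega> * recip_step \<beta>0 \<beta>1 h (\<Delta> i \<omega>))" for \<omega>
    have EhM: "Eh i \<in> borel_measurable M" if "i < n" for i
      unfolding Eh_def[abs_def] ikg by (rule noise2) (use that in auto)
    have RhM: "Rh i \<in> borel_measurable M" for i by (rule measurable_F[OF Rhm])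
    have UM: "U \<in> borel_measurable M" unfolding U_def[abs_def]
      using EhM RhM by (intro borel_measurable_sum borel_measurable_times measurable_compose[OF \<Delta>M borel_measurable_recip_step]) auto
    have pU: "prob_norm U \<le> K * \<eta> * sqrt t + K * \<eta> * (t + real n * recip_step_square \<beta>0 \<beta>1 h) / 2"
      using noise1 unfolding U_def[abs_def] \<Delta>_def h(2) Eh_def ikg by blast
    define E where "E i \<omega> = G (Suc i) k \<omega> - G i k \<omega> - \<beta>1 * v (\<tau> i) \<omega> * \<Delta> i \<omega>" for i \<omega>
    have E_eq: "E i \<omega> = \<beta>1 * (\<Sum>l=i*k..<i*k+k. (v (real l * g) \<omega> - v (real (i * k) * g) \<omega>) * (W (real (Suc l) * g) \<omega> - W (real l * g) \<omega>))" for i \<omega>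
    proof -
      let ?w = "\<lambda>l. W (real (Suc l) * g) \<omega> - W (real l * g) \<omega>"
      have "G (Suc i) k \<omega> = (\<Sum>l=0..<i*k. \<beta>1 * v (real l * g) \<omega> * ?w l) + (\<Sum>l=i*k..<i*k+k. \<beta>1 * v (real l * g) \<omega> * ?w l)"
        unfolding G_def g_def[symmetric] by (subst sum.atLeastLessThan_concat) (auto simp: atLeast0LessThan add.commute)
      moreover have "G i k \<omega> = (\<Sum>l=0..<i*k. \<beta>1 * v (real l * g) \<omega> * ?w l)"
        unfolding G_def g_def[symmetric] by (simp add: atLeast0LessThan)
      moreover have "\<Delta> i \<omega> = (\<Sum>l=i*k..<i*k+k. ?w l)"
      proof -
        have "(\<Sum>l=i*k..<i*k+k. ?w l) = W (real (i*k+k) * g) \<omega> - W (real (i*k) * g) \<omega>"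
          by (rule sum_Suc_diff') simp
        also have "real (i*k+k) * g = \<tau> (Suc i)" using ikg[of "Suc i"] by (simp add: add.commute)
        finally show ?thesis by (simp only: \<Delta>_def ikg)
      qed
      ultimately show ?thesis unfolding E_def ikg
        by (simp add: sum_distrib_left sum_subtractf[symmetric] algebra_simps)
    qed
    have EM: "E i \<in> borel_measurable M" if "i < n" for i
      unfolding E_def[abs_def] using that \<tau> by (intro borel_measurable_diff borel_measurable_times GM vM \<Delta>M) auto
    define V where "V \<omega> = (\<Sum>i<n. R (\<tau> (Suc i)) \<omega> * E i \<omega>)" for \<omega>
    have VM: "V \<in> borel_measurable M" unfolding V_def[abs_def]
      using EM by (intro borel_measurable_sum borel_measurable_times RM') auto
    have pV: "prob_norm V \<le> prob_norm (\<lambda>\<omega>. \<beta>1 * U \<omega>) + prob (B1 \<union> B3)"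
    proof (intro prob_norm_le_AE AE_I2 impI VM)
      fix \<omega> assume \<omega>: "\<omega> \<in> space M" "\<omega> \<notin> B1 \<union> B3"
      have "R (\<tau> (Suc i)) \<omega> * E i \<omega> = \<beta>1 * (Rh i \<omega> * Eh i \<omega> * recip_step \<beta>0 \<beta>1 h (\<Delta> i \<omega>))" if i: "i < n" for i
      proof -
        have "Rh i \<omega> = R (\<tau> i) \<omega>" unfolding Rh_def
          using K1(4)[of \<omega> "\<tau> i"] \<tau>[of i] i \<omega> K by (intro clamp_abs_id) auto
        moreover have "E i \<omega> = \<beta>1 * Eh i \<omega>"
          unfolding E_eq Eh_def
        proof (intro arg_cong2[where f="(*)"] sum.cong refl clamp_abs_id[symmetric])
          fix l assume l: "l \<in> {i*k..<i*k+k}"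
          have "l \<le> Suc i * k" using l by simp
          also have "\<dots> \<le> n * k" using i by (intro mult_le_mono1) simp
          finally have ln: "real l * g \<in> {0..t}" unfolding g_def by (rule grid)
          have "real (i * k) * g \<le> real l * g" using l g by (intro mult_right_mono) (auto simp del: of_nat_mult)
          moreover have "real l * g < real (i * k + k) * g" using l g by (intro mult_strict_right_mono) (auto simp del: of_nat_mult of_nat_add)
          moreover have "real (i * k + k) * g = real (i * k) * g + h" using g(2) by (simp add: algebra_simps)
          ultimately have "\<bar>real l * g - real (i * k) * g\<bar> < h" by linarith
          then show "\<bar>v (real l * g) \<omega> - v (real (i * k) * g) \<omega>\<bar> \<le> \<eta>"
            using ln \<omega> \<tau>[of i] i n\<rho> unfolding ikg h_def[symmetric] by (intro B3(5)) auto
        qed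
        ultimately show ?thesis by (simp add: Rq)
      qed
      then show "\<bar>V \<omega>\<bar> \<le> \<bar>\<beta>1 * U \<omega>\<bar>" by (simp add: V_def U_def sum_distrib_left)
    qed (use UM K1 B3 in auto)
    have p2: "prob_norm T2 \<le> 3 * \<epsilon> + K * \<eta> * (max 1 \<bar>\<beta>1\<bar> * (sqrt t + (t + (t * \<beta>1\<^sup>2 + 1)) / 2))"
    proof -
      let ?X = "\<lambda>i \<omega>. R (\<tau> (Suc i)) \<omega> * ((G (Suc i) k \<omega> - Y (\<tau> (Suc i)) \<omega>) - (G i k \<omega> - Y (\<tau> i) \<omega>))"
      have XM: "?X i \<in> borel_measurable M" if "i < n" for i
        using that by (intro borel_measurable_times borel_measurable_diff RM' GM YM \<tau>) auto
      \<comment> \<open>\<open>e i\<close> equals \<open>E i\<close> minus the difference of the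
        Riemann errors at the two ends of the cell.\<close>
      have "T2 = (\<lambda>\<omega>. V \<omega> - (\<Sum>i<n. ?X i \<omega>))"
        unfolding T2_def V_def sum_subtractf[symmetric]
        by (intro ext sum.cong refl) (simp add: e_def E_def algebra_simps)
      then have "prob_norm T2 \<le> prob_norm V + prob_norm (\<lambda>\<omega>. \<Sum>i<n. ?X i \<omega>)"
        using prob_norm_diff[OF VM, of "\<lambda>\<omega>. \<Sum>i<n. ?X i \<omega>"] XM by simp
      also have "prob_norm (\<lambda>\<omega>. \<Sum>i<n. ?X i \<omega>) \<le> (\<Sum>i<n. prob_norm (?X i))"
        using XM by (intro prob_norm_sum) auto
      finally have "prob_norm T2 \<le> prob_norm V + \<epsilon>" using kE by linarith
      moreover have "prob (B1 \<union> B3) \<le> prob B1 + prob B3" using K1 B3 by (intro measure_Un_le) auto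
      moreover have "prob_norm (\<lambda>\<omega>. \<beta>1 * U \<omega>) \<le> K * \<eta> * (max 1 \<bar>\<beta>1\<bar> * (sqrt t + (t + (t * \<beta>1\<^sup>2 + 1)) / 2))"
      proof -
        have "prob_norm (\<lambda>\<omega>. \<beta>1 * U \<omega>) \<le> max 1 \<bar>\<beta>1\<bar> * prob_norm U" by (rule prob_norm_cmult[OF UM])
        also have "\<dots> \<le> max 1 \<bar>\<beta>1\<bar> * (K * \<eta> * (sqrt t + (t + (t * \<beta>1\<^sup>2 + 1)) / 2))"
        proof (intro mult_left_mono)
          have "K * \<eta> * (t + real n * recip_step_square \<beta>0 \<beta>1 h) \<le> K * \<eta> * (t + (t * \<beta>1\<^sup>2 + 1))"
            using nz3 K \<eta> unfolding h_def by (intro mult_left_mono) auto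
          then have "K * \<eta> * sqrt t + K * \<eta> * (t + real n * recip_step_square \<beta>0 \<beta>1 h) / 2
              \<le> K * \<eta> * sqrt t + K * \<eta> * (t + (t * \<beta>1\<^sup>2 + 1)) / 2"
            by (intro add_left_mono divide_right_mono) auto
          also have "\<dots> = K * \<eta> * (sqrt t + (t + (t * \<beta>1\<^sup>2 + 1)) / 2)"
            by (simp only: distrib_left times_divide_eq_right)
          finally show "prob_norm U \<le> K * \<eta> * (sqrt t + (t + (t * \<beta>1\<^sup>2 + 1)) / 2)"
            using pU by linarith
        qed simp
        finally show ?thesis by (simp only: mult.left_commute)
      qed
      ultimately show ?thesis using pV K1(3) B3(3) by linarith
    qed
    have "prob_norm Z \<le> prob_norm T1 + (prob_norm T2 + prob_norm T3)"
    proof -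
      have "prob_norm Z = prob_norm (\<lambda>\<omega>. T1 \<omega> + (T2 \<omega> + T3 \<omega>))" by (simp add: Zeq[abs_def])
      also have "\<dots> \<le> prob_norm T1 + prob_norm (\<lambda>\<omega>. T2 \<omega> + T3 \<omega>)"
        using T1M T2M T3M by (intro prob_norm_add) auto
      also have "prob_norm (\<lambda>\<omega>. T2 \<omega> + T3 \<omega>) \<le> prob_norm T2 + prob_norm T3"
        using T2M T3M by (intro prob_norm_add) auto
      finally show ?thesis by simp
    qed
    also have "\<dots> \<le> 8 * \<epsilon> + K * \<eta> * C"
    proof -
      have "K * \<eta> * C = K * \<bar>\<beta>0\<bar> * \<eta> * t + K * \<eta> * (max 1 \<bar>\<beta>1\<bar> * (sqrt t + (t + (t * \<beta>1\<^sup>2 + 1)) / 2)) + K * \<eta>"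
        by (simp add: C_def algebra_simps)
      moreover have "0 < K * \<eta>" using K \<eta> by simp
      ultimately show ?thesis using p1 p2 p3 by linarith
    qed
    finally show ?thesis using K\<eta> \<epsilon> by linarith
  qed
  have "prob_norm Z \<le> 0"
  proof (rule field_le_epsilon[of "prob_norm Z" 0])
    fix \<epsilon> :: real assume "0 < \<epsilon>"
    with small[of "\<epsilon> / 10"] show "prob_norm Z \<le> 0 + \<epsilon>" by simp
  qed
  then have "AE \<omega> in M. Z \<omega> = 0"
    using prob_norm_nonneg[of Z] by (intro prob_norm_eq_0 ZM) simp
  then show ?thesis using W_0
  proof eventually_elim
    case (elim \<omega>)
    have "R t \<omega> * exp ((\<beta>0 - \<beta>1\<^sup>2 / 2) * t + \<beta>1 * W t \<omega>) = 1"
      by (simp add: R_def exp_add[symmetric] algebra_simps)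
    \<comment> \<open>The initial factor \<open>R 0\<close> is 1 only almost surely, through
      \<open>W 0 = 0\<close>.\<close>
    moreover have "v 0 \<omega> = R t \<omega> * v t \<omega>" using elim by (simp add: Z_def R_def)
    ultimately show ?case by (metis mult.assoc mult.commute mult_1)
  qed
qed

end

section \<open>Strongly continuous semigroups\<close>

text \<open>Banach-Steinhaus through the Baire category theorem: the closed sets \<open>C k\<close>
  cover the space, so one of them contains a ball. A short vector is the difference of two points of
  that ball, and linearity gives the bound.\<close>

lemma uniform_boundedness:
  fixes f :: "nat \<Rightarrow> 'a::banach \<Rightarrow> 'b::real_normed_vector"
  assumes lin: "\<And>n. bounded_linear (f n)" and bdd: "\<And>x. \<exists>b. \<forall>n. norm (f n x) \<le> b"
  shows "\<exists>B. \<forall>n x. norm (f n x) \<le> B * norm x"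
proof -
  define C where "C k = {x. \<forall>n. norm (f n x) \<le> real k}" for k :: nat
  have cl: "closed (C k)" for k
  proof -
    have "C k = (\<Inter>n. {x. norm (f n x) \<le> real k})" by (auto simp: C_def)
    moreover have "closed {x. norm (f n x) \<le> real k}" for n
      by (intro closed_Collect_le continuous_intros linear_continuous_on lin)
    ultimately show ?thesis by auto
  qed
  have "\<exists>k. interior (C k) \<noteq> {}"
  proof (rule ccontr)
    assume "\<not> ?thesis"
    then have "euclidean interior_of \<Union>(range C) = {}"
      using cl by (intro Baire_category_alt) (auto simp: completely_metrizable_space_euclidean)
    moreover have "\<Union>(range C) = UNIV"
    proof -
      have "\<exists>k. x \<in> C k" for x
      proof -
        obtain b where "\<And>n. norm (f n x) \<le> b" using bdd by blast
        moreover obtain k where "b \<le> real k" using real_arch_simple by blast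
        ultimately show ?thesis by (auto simp: C_def intro: order_trans)
      qed
      then show ?thesis by auto
    qed
    ultimately show False by simp
  qed
  then obtain k x0 e where e: "e > 0" "ball x0 e \<subseteq> C k" by (auto simp: mem_interior)
  have "norm (f n x) \<le> (4 * real k / e) * norm x" for n x
  proof (cases "x = 0")
    case True then show ?thesis using lin[of n] by (simp add: linear_simps)
  next
    case False
    interpret bounded_linear "f n" by (rule lin)
    \<comment> \<open>Scales \<open>x\<close> to length \<open>e / 2\<close>, which keeps the
      shifted centre inside the ball; \<open>2 * k / c\<close> then yields the constant
      \<open>4 * k / e\<close>.\<close>
    define c where "c = e / (2 * norm x)"
    have c: "c > 0" using e False by (simp add: c_def)
    have "x0 + c *\<^sub>R x \<in> ball x0 e" "x0 \<in> ball x0 e" using e False by (simp_all add: dist_norm c_def)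
    then have "norm (f n (x0 + c *\<^sub>R x)) \<le> real k" "norm (f n x0) \<le> real k"
      using e(2) unfolding C_def by blast+
    moreover have "c *\<^sub>R f n x = f n (x0 + c *\<^sub>R x) - f n x0" by (simp add: add scaleR)
    ultimately have "norm (c *\<^sub>R f n x) \<le> 2 * real k" using norm_triangle_ineq4[of "f n (x0 + c *\<^sub>R x)" "f n x0"] by simp
    then have "c * norm (f n x) \<le> 2 * real k" using c by simp
    then have "norm (f n x) \<le> 2 * real k / c" using c by (simp add: field_simps)
    also have "\<dots> = (4 * real k / e) * norm x" using False e by (simp add: c_def)
    finally show ?thesis .
  qed
  then show ?thesis by blast
qed

text \<open>A generator provides right derivatives only. After subtracting
  \<open>\<epsilon> * s\<close>, the set where \<open>g\<close> is nonpositive is compact and has a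
  last point; if that came before \<open>t\<close>, the right derivative, being below \<epsilon>,
  would push the set further.\<close>

lemma nonincreasing_right_derivative:
  fixes f :: "real \<Rightarrow> real"
  assumes cont: "continuous_on {0..} f" and t: "0 \<le> t"
    and der: "\<And>s. 0 \<le> s \<Longrightarrow> \<exists>d\<le>0. ((\<lambda>h. (f (s + h) - f s) / h) \<longlongrightarrow> d) (at_right 0)"
  shows "f t \<le> f 0"
proof (rule field_le_epsilon)
  fix \<epsilon>' :: real assume \<epsilon>': "0 < \<epsilon>'"
  define \<epsilon> where "\<epsilon> = \<epsilon>' / (t + 1)"
  have \<epsilon>: "\<epsilon> > 0" using \<epsilon>' t by (simp add: \<epsilon>_def)
  define g where "g s = f s - f 0 - \<epsilon> * s" for s
  have "g t \<le> 0"
  proof (rule ccontr)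
    assume gt: "\<not> g t \<le> 0"
    define S where "S = {s \<in> {0..t}. g s \<le> 0}"
    have gc: "continuous_on {0..t} g" unfolding g_def
      by (intro continuous_intros continuous_on_subset[OF cont]) auto
    have "compact S" unfolding S_def
      using continuous_closed_preimage[OF gc closed_atLeastAtMost closed_atMost[of 0]]
      by (auto simp: compact_eq_bounded_closed vimage_def Int_def intro: bounded_subset[OF bounded_closed_interval])
    moreover have "0 \<in> S" using t by (simp add: S_def g_def)
    ultimately obtain c where c: "c \<in> S" "\<And>s. s \<in> S \<Longrightarrow> s \<le> c"
      using compact_attains_sup[of S] by auto
    have ct: "0 \<le> c" "c < t" "g c \<le> 0" using c(1) gt by (auto simp: S_def less_le)
    obtain d where d: "d \<le> 0" "((\<lambda>h. (f (c + h) - f c) / h) \<longlongrightarrow> d) (at_right 0)" using der[OF ct(1)] by blast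
    have "eventually (\<lambda>h. (f (c + h) - f c) / h < \<epsilon>) (at_right 0)"
      using order_tendstoD(2)[OF d(2), of \<epsilon>] d(1) \<epsilon> by simp
    moreover have "eventually (\<lambda>h::real. h \<in> {0<..<t - c}) (at_right 0)"
      using eventually_at_right_real[of 0 "t - c"] ct by simp
    ultimately have "eventually (\<lambda>h. h \<in> {0<..<t - c} \<and> (f (c + h) - f c) / h < \<epsilon>) (at_right 0)"
      by eventually_elim simp
    then obtain h where h: "h \<in> {0<..<t - c}" "(f (c + h) - f c) / h < \<epsilon>"
      using eventually_happens[of _ "at_right (0::real)"] by auto
    have "f (c + h) - f c < \<epsilon> * h" using h by (simp add: field_simps)
    then have "g (c + h) \<le> 0" using ct(3) by (simp add: g_def algebra_simps)
    then have "c + h \<in> S" using h ct by (auto simp: S_def)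
    with c(2)[of "c + h"] h show False by auto
  qed
  moreover have "\<epsilon> * t \<le> \<epsilon>'" using \<epsilon>' t by (simp add: \<epsilon>_def field_simps)
  ultimately show "f t \<le> f 0 + \<epsilon>'" by (simp add: g_def)
qed

context
  fixes T :: "real \<Rightarrow> 'h::banach \<Rightarrow> 'h" and D :: "'h set" and G :: "'h \<Rightarrow> 'h"
  assumes gen: "generates_C0_semigroup T D G"
begin

lemma semigroup_linear: "0 \<le> t \<Longrightarrow> bounded_linear (T t)"
  and semigroup_0: "T 0 x = x"
  and semigroup_add: "0 \<le> s \<Longrightarrow> 0 \<le> t \<Longrightarrow> T (s + t) x = T s (T t x)"
  and semigroup_tendsto: "((\<lambda>t. T t x) \<longlongrightarrow> x) (at_right 0)"
  and generator_domain: "x \<in> D \<longleftrightarrow> (\<exists>z. ((\<lambda>h. (1 / h) *\<^sub>R (T h x - x)) \<longlongrightarrow> z) (at_right 0))"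
  and generator: "x \<in> D \<Longrightarrow> ((\<lambda>h. (1 / h) *\<^sub>R (T h x - x)) \<longlongrightarrow> G x) (at_right 0)"
  using gen unfolding generates_C0_semigroup_def by blast+

lemma semigroup_near_0:
  assumes "\<epsilon> > 0"
  shows "\<exists>d>0. \<forall>h\<in>{0..<d}. norm (T h x - x) < \<epsilon>"
proof -
  have "eventually (\<lambda>h. dist (T h x) x < \<epsilon>) (at_right 0)"
    using semigroup_tendsto[of x] assms by (rule tendstoD)
  then obtain d where d: "d > 0" "\<And>h. 0 < h \<Longrightarrow> h < d \<Longrightarrow> dist (T h x) x < \<epsilon>"
    unfolding eventually_at_right_field by auto
  then have "norm (T h x - x) < \<epsilon>" if "h \<in> {0..<d}" for h
    using that assms semigroup_0[of x] by (cases "h = 0") (auto simp: dist_norm)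
  with d(1) show ?thesis by blast
qed

text \<open>A failure would give times \<open>h n\<close> tending to 0 at which no bound
  \<open>n\<close> on the operator holds. Strong continuity at 0 bounds the orbit of each vector
  along these times, so Banach-Steinhaus gives a contradiction.\<close>

lemma semigroup_locally_bounded: "\<exists>d>0. \<exists>B\<ge>0. \<forall>h\<in>{0..d}. \<forall>x. norm (T h x) \<le> B * norm x"
proof (rule ccontr)
  assume neg: "\<not> ?thesis"
  have "\<exists>h x. h \<in> {0..1 / real (Suc n)} \<and> norm (T h x) > real n * norm x" for n
    using neg[simplified, rule_format, of "1 / real (Suc n)" "real n"] by (auto simp: not_le)
  then obtain h x where hx: "\<And>n. h n \<in> {0..1 / real (Suc n)}" "\<And>n. norm (T (h n) (x n)) > real n * norm (x n)"
    by metis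
  have "\<exists>B. \<forall>n z. norm (T (h n) z) \<le> B * norm z"
  proof (rule uniform_boundedness)
    show "bounded_linear (T (h n))" for n using hx(1)[of n] by (intro semigroup_linear) auto
    fix z
    obtain d where d: "d > 0" "\<And>s. s \<in> {0..<d} \<Longrightarrow> norm (T s z - z) < 1" using semigroup_near_0[of 1 z] by auto
    obtain N where N: "1 / real (Suc N) < d" using d(1) nat_approx_posE by blast
    have *: "norm (T (h n) z) \<le> norm z + 1" if "n \<ge> N" for n
    proof -
      have "1 / real (Suc n) \<le> 1 / real (Suc N)" using that by (intro divide_left_mono) auto
      then have "h n \<in> {0..<d}" using hx(1)[of n] N by auto
      then have "norm (T (h n) z - z) < 1" by (rule d(2))
      then show ?thesis using norm_triangle_ineq2[of "T (h n) z" z] by linarith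
    qed
    show "\<exists>b. \<forall>n. norm (T (h n) z) \<le> b"
    proof (intro exI allI)
      fix n
      \<comment> \<open>The tail is bounded through continuity at 0; the finite sum takes care of
        the indices below \<open>N\<close>.\<close>
      show "norm (T (h n) z) \<le> (norm z + 1) + (\<Sum>m<N. norm (T (h m) z))"
      proof (cases "n \<ge> N")
        case True
        then show ?thesis using *[OF True] sum_nonneg[of "{..<N}" "\<lambda>m. norm (T (h m) z)"] by simp
      next
        case False
        then have "norm (T (h n) z) \<le> (\<Sum>m<N. norm (T (h m) z))" by (intro member_le_sum) auto
        then show ?thesis using norm_ge_zero[of z] by linarith
      qed
    qed
  qed
  then obtain B where B: "\<And>n z. norm (T (h n) z) \<le> B * norm z" by blast
  obtain n where n: "B \<le> real n" using real_arch_simple by blast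
  have "real n * norm (x n) < B * norm (x n)" using hx(2)[of n] B[of n "x n"] by linarith
  moreover have "B * norm (x n) \<le> real n * norm (x n)" using n by (intro mult_right_mono) auto
  ultimately show False by simp
qed

text \<open>From the right, the fixed operator \<open>T s\<close> acts on a vector tending to 0.
  From the left the operator \<open>T s'\<close> moves with \<open>s'\<close>; writing
  \<open>s' = (s - \<delta>) + (\<delta> - u)\<close> reduces it to one fixed operator after a
  member of the locally bounded family near 0.\<close>

lemma semigroup_continuous: "continuous_on {0..} (\<lambda>s. T s x)"
  unfolding continuous_on_iff
proof safe
  fix s \<epsilon> :: real assume s: "0 \<le> s" and \<epsilon>: "0 < \<epsilon>"
  obtain d B where d: "d > 0" and B: "0 \<le> B" "\<And>h z. h \<in> {0..d} \<Longrightarrow> norm (T h z) \<le> B * norm z"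
    using semigroup_locally_bounded by blast
  define \<delta> where "\<delta> = min d s"
  have \<delta>: "0 \<le> \<delta>" "\<delta> \<le> d" "\<delta> \<le> s" using d s by (auto simp: \<delta>_def)
  obtain C1 where C1: "C1 > 0" "\<And>z. norm (T s z) \<le> norm z * C1"
    using bounded_linear.pos_bounded[OF semigroup_linear[OF s]] by blast
  obtain C2 where C2: "C2 > 0" "\<And>z. norm (T (s - \<delta>) z) \<le> norm z * C2"
    using bounded_linear.pos_bounded[OF semigroup_linear[of "s - \<delta>"]] \<delta> by auto
  define C where "C = C1 + C2 * B + 1"
  have "0 \<le> C2 * B" using C2(1) B(1) by simp
  then have C: "C > 0" "C1 \<le> C" "C2 * B \<le> C" using C1(1) unfolding C_def by linarith+
  obtain \<rho> where \<rho>: "\<rho> > 0" "\<And>h. h \<in> {0..<\<rho>} \<Longrightarrow> norm (T h x - x) < \<epsilon> / C"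
    using semigroup_near_0[of "\<epsilon> / C" x] \<epsilon> C by auto
  define r where "r = (if s = 0 then \<rho> else min \<rho> \<delta>)"
  have r: "r > 0" using \<rho> d s by (auto simp: r_def \<delta>_def)
  have "dist (T s' x) (T s x) < \<epsilon>" if s': "0 \<le> s'" "dist s' s < r" for s'
  proof (cases "s \<le> s'")
    case True
    have "T s' x - T s x = T s (T (s' - s) x - x)"
      using semigroup_add[of s "s' - s" x] s True semigroup_linear[OF s] by (simp add: linear_diff[OF bounded_linear.linear, OF semigroup_linear[OF s]])
    then have "dist (T s' x) (T s x) \<le> norm (T (s' - s) x - x) * C1"
      using C1(2) by (simp add: dist_norm)
    also have "\<dots> \<le> norm (T (s' - s) x - x) * C" using C by (intro mult_left_mono) auto
    also have "\<dots> < \<epsilon> / C * C"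
      using \<rho>(2)[of "s' - s"] s' True C by (intro mult_strict_right_mono) (auto simp: r_def dist_real_def split: if_splits)
    finally show ?thesis using C by simp
  next
    case False
    define u where "u = s - s'"
    have u: "0 < u" "u < \<rho>" "u \<le> \<delta>" using False s' s by (auto simp: u_def r_def dist_real_def split: if_splits)
    have s'eq: "s' = (s - \<delta>) + (\<delta> - u)" and seq: "s = ((s - \<delta>) + (\<delta> - u)) + u" by (auto simp: u_def)
    have "T s x = T s' (T u x)" using semigroup_add[of s' u x] u s' by (simp add: u_def)
    then have "T s x - T s' x = T s' (T u x - x)" by (simp add: linear_diff[OF bounded_linear.linear, OF semigroup_linear[OF s'(1)]])
    also have "\<dots> = T (s - \<delta>) (T (\<delta> - u) (T u x - x))"
      using semigroup_add[of "s - \<delta>" "\<delta> - u"] \<delta> u s'eq by simp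
    finally have "dist (T s x) (T s' x) \<le> norm (T (\<delta> - u) (T u x - x)) * C2"
      using C2(2) by (simp add: dist_norm)
    then have "dist (T s' x) (T s x) \<le> norm (T (\<delta> - u) (T u x - x)) * C2" by (simp only: dist_commute)
    also have "\<dots> \<le> (B * norm (T u x - x)) * C2"
      using B(2)[of "\<delta> - u"] u \<delta> C2 by (intro mult_right_mono) auto
    also have "\<dots> = norm (T u x - x) * (C2 * B)" by simp
    also have "\<dots> \<le> norm (T u x - x) * C" using C by (intro mult_left_mono) auto
    also have "\<dots> < \<epsilon> / C * C" using \<rho>(2)[of u] u C by (intro mult_strict_right_mono) auto
    finally show ?thesis using C by simp
  qed
  then show "\<exists>d>0. \<forall>x'\<in>{0..}. dist x' s < d \<longrightarrow> dist (T x' x) (T s x) < \<epsilon>"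
    using r by auto
qed

lemma semigroup_domain:
  assumes "0 \<le> s" "x \<in> D"
  shows "T s x \<in> D"
proof -
  interpret bounded_linear "T s" by (rule semigroup_linear[OF assms(1)])
  have "((\<lambda>h. T s ((1 / h) *\<^sub>R (T h x - x))) \<longlongrightarrow> T s (G x)) (at_right 0)"
    by (rule tendsto[OF generator[OF assms(2)]])
  moreover have "eventually (\<lambda>h. T s ((1 / h) *\<^sub>R (T h x - x)) = (1 / h) *\<^sub>R (T h (T s x) - T s x)) (at_right 0)"
    using eventually_at_right_less[of 0]
  proof eventually_elim
    case (elim h)
    then have "T s (T h x) = T h (T s x)"
      using semigroup_add[of s h x] semigroup_add[of h s x] assms by (simp add: add.commute)
    then show ?case by (simp add: scaleR diff)
  qed
  ultimately have "((\<lambda>h. (1 / h) *\<^sub>R (T h (T s x) - T s x)) \<longlongrightarrow> T s (G x)) (at_right 0)"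
    by (rule Lim_transform_eventually)
  then show ?thesis unfolding generator_domain by blast
qed

end

text \<open>An energy estimate: on the domain the right derivative of
  \<open>(norm (T s x))\<^sup>2 * exp (2 * c * s)\<close> is
  \<open>2 * exp (2 * c * s) * (c * (norm z)\<^sup>2 - inner (A z) z)\<close> with
  \<open>z = T s x\<close>, which coercivity makes nonpositive. Density of \<open>D\<close> extends
  the bound.\<close>

lemma semigroup_exponential_decay:
  fixes T :: "real \<Rightarrow> 'h::{real_inner,banach} \<Rightarrow> 'h"
  assumes gen: "generates_C0_semigroup T D (\<lambda>x. - A x)" and dense: "closure D = UNIV"
    and coercive: "\<And>x. x \<in> D \<Longrightarrow> c * (norm x)\<^sup>2 \<le> inner (A x) x" and t: "0 \<le> t"
  shows "norm (T t x) \<le> exp (- c * t) * norm x"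
proof -
  have D: "norm (T t x) \<le> exp (- c * t) * norm x" if x: "x \<in> D" for x
  proof -
    define f where "f s = (norm (T s x))\<^sup>2 * exp (2 * c * s)" for s
    have "f t \<le> f 0"
    proof (rule nonincreasing_right_derivative[OF _ t])
      show "continuous_on {0..} f" unfolding f_def
        by (intro continuous_intros semigroup_continuous[OF gen])
      fix s :: real assume s: "0 \<le> s"
      define z where "z = T s x"
      have zD: "z \<in> D" unfolding z_def by (rule semigroup_domain[OF gen s x])
      have T0: "((\<lambda>h. T h z) \<longlongrightarrow> z) (at_right 0)" by (rule semigroup_tendsto[OF gen])
      have quot: "((\<lambda>h. (1 / h) *\<^sub>R (T h z - z)) \<longlongrightarrow> - A z) (at_right 0)" by (rule generator[OF gen zD])
      \<comment> \<open>The quotient of squared norms is an inner product of the difference quotient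
        with \<open>T h z + z\<close>, whose two factors converge separately.\<close>
      have "((\<lambda>h. inner ((1 / h) *\<^sub>R (T h z - z)) (T h z + z)) \<longlongrightarrow> inner (- A z) (z + z)) (at_right 0)"
        by (intro tendsto_inner tendsto_add T0 quot tendsto_const)
      moreover have E: "((\<lambda>h. exp (2 * c * (s + h))) \<longlongrightarrow> exp (2 * c * (s + 0))) (at_right 0)"
        by (intro tendsto_intros)
      ultimately have l1: "((\<lambda>h. inner ((1 / h) *\<^sub>R (T h z - z)) (T h z + z) * exp (2 * c * (s + h))) \<longlongrightarrow> inner (- A z) (z + z) * exp (2 * c * (s + 0))) (at_right 0)"
        by (rule tendsto_mult)
      have "((\<lambda>h. exp (2 * c * (s + h))) has_real_derivative 2 * c * exp (2 * c * s)) (at 0)"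
        by (auto intro!: derivative_eq_intros)
      then have "((\<lambda>h. (exp (2 * c * (s + h)) - exp (2 * c * s)) / h) \<longlongrightarrow> 2 * c * exp (2 * c * s)) (at 0)"
        using DERIV_D by fastforce
      then have "((\<lambda>h. (exp (2 * c * (s + h)) - exp (2 * c * s)) / h) \<longlongrightarrow> 2 * c * exp (2 * c * s)) (at_right 0)"
        by (rule filterlim_mono) (auto intro: at_le)
      then have l2: "((\<lambda>h. (norm z)\<^sup>2 * ((exp (2 * c * (s + h)) - exp (2 * c * s)) / h)) \<longlongrightarrow> (norm z)\<^sup>2 * (2 * c * exp (2 * c * s))) (at_right 0)"
        by (intro tendsto_mult tendsto_const)
      define d where "d = inner (- A z) (z + z) * exp (2 * c * (s + 0)) + (norm z)\<^sup>2 * (2 * c * exp (2 * c * s))"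
      have "((\<lambda>h. inner ((1 / h) *\<^sub>R (T h z - z)) (T h z + z) * exp (2 * c * (s + h))
           + (norm z)\<^sup>2 * ((exp (2 * c * (s + h)) - exp (2 * c * s)) / h)) \<longlongrightarrow> d) (at_right 0)"
        unfolding d_def by (rule tendsto_add[OF l1 l2])
      moreover have "eventually (\<lambda>h. inner ((1 / h) *\<^sub>R (T h z - z)) (T h z + z) * exp (2 * c * (s + h))
           + (norm z)\<^sup>2 * ((exp (2 * c * (s + h)) - exp (2 * c * s)) / h) = (f (s + h) - f s) / h) (at_right 0)"
        using eventually_at_right_less[of 0]
      proof eventually_elim
        case (elim h)
        have Th: "T (s + h) x = T h z" using semigroup_add[OF gen, of h s x] elim s by (simp add: z_def add.commute)
        have i: "inner ((1 / h) *\<^sub>R (T h z - z)) (T h z + z) = ((norm (T h z))\<^sup>2 - (norm z)\<^sup>2) / h"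
          by (simp add: power2_norm_eq_inner inner_add_right inner_diff_left inner_commute[of z "T h z"] diff_divide_distrib)
        have "(a - b) / h * e1 + b * ((e1 - e0) / h) = (a * e1 - b * e0) / h" for a b e0 e1 :: real
          by (simp add: diff_divide_distrib algebra_simps)
        then show ?case unfolding i by (simp only: f_def Th z_def[symmetric])
      qed
      ultimately have "((\<lambda>h. (f (s + h) - f s) / h) \<longlongrightarrow> d) (at_right 0)"
        by (rule Lim_transform_eventually)
      moreover have "d \<le> 0"
      proof -
        have "d = 2 * exp (2 * c * s) * (c * (norm z)\<^sup>2 - inner (A z) z)"
          by (simp add: d_def inner_add_right algebra_simps)
        moreover have "c * (norm z)\<^sup>2 - inner (A z) z \<le> 0" using coercive[OF zD] by simp
        ultimately show ?thesis by (simp add: mult_nonneg_nonpos)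
      qed
      ultimately show "\<exists>d\<le>0. ((\<lambda>h. (f (s + h) - f s) / h) \<longlongrightarrow> d) (at_right 0)" by blast
    qed
    then have le: "(norm (T t x))\<^sup>2 * exp (2 * c * t) \<le> (norm x)\<^sup>2" by (simp add: f_def semigroup_0[OF gen])
    have "(norm (T t x) * exp (c * t))\<^sup>2 = (norm (T t x))\<^sup>2 * exp (2 * c * t)"
      by (simp add: power_mult_distrib exp_double[symmetric] mult.assoc)
    with le have "(norm (T t x) * exp (c * t))\<^sup>2 \<le> (norm x)\<^sup>2" by simp
    then have "norm (T t x) * exp (c * t) \<le> norm x" by (rule power2_le_imp_le) simp
    then show ?thesis by (simp add: exp_minus field_simps)
  qed
  have "closed {x. norm (T t x) \<le> exp (- c * t) * norm x}"
    by (intro closed_Collect_le continuous_intros linear_continuous_on semigroup_linear[OF gen t])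
  then have "closure D \<subseteq> {x. norm (T t x) \<le> exp (- c * t) * norm x}"
    using D by (intro closure_minimal) auto
  then show ?thesis using dense by auto
qed

text \<open>Strong continuity alone does not handle a moving argument. The difference is split into
  \<open>T (t - r)\<close> applied to \<open>y r - y r0\<close>, controlled by a bound uniform in
  \<open>r\<close>, and a difference on the orbit of the fixed vector \<open>y r0\<close>. The
  constant \<open>exp (\<bar>c\<bar> * t)\<close> is such a bound for either sign of
  \<open>c\<close>.\<close>

lemma semigroup_path_continuous:
  fixes T :: "real \<Rightarrow> 'h::{real_inner,banach} \<Rightarrow> 'h"
  assumes gen: "generates_C0_semigroup T D G"
    and decay: "\<And>s x. 0 \<le> s \<Longrightarrow> norm (T s x) \<le> exp (- c * s) * norm x"
    and y: "continuous_on {0..t} y"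
  shows "continuous_on {0..t} (\<lambda>r. T (t - r) (y r))"
  unfolding continuous_on_def
proof
  fix r0 assume r0: "r0 \<in> {0..t}"
  have Tc: "continuous_on {0..t} (\<lambda>r. T (t - r) (y r0))"
    by (rule continuous_on_compose2[OF semigroup_continuous[OF gen]]) (auto intro!: continuous_intros)
  have yl: "(y \<longlongrightarrow> y r0) (at r0 within {0..t})" using y r0 by (auto simp: continuous_on_def)
  have Tl: "((\<lambda>r. T (t - r) (y r0)) \<longlongrightarrow> T (t - r0) (y r0)) (at r0 within {0..t})"
    using Tc r0 by (auto simp: continuous_on_def)
  have "((\<lambda>r. exp (\<bar>c\<bar> * t) * norm (y r - y r0) + norm (T (t - r) (y r0) - T (t - r0) (y r0))) \<longlongrightarrow>
      exp (\<bar>c\<bar> * t) * norm (y r0 - y r0) + norm (T (t - r0) (y r0) - T (t - r0) (y r0))) (at r0 within {0..t})"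
    by (intro tendsto_intros yl Tl)
  then have lim: "((\<lambda>r. exp (\<bar>c\<bar> * t) * norm (y r - y r0) + norm (T (t - r) (y r0) - T (t - r0) (y r0))) \<longlongrightarrow> 0) (at r0 within {0..t})"
    by simp
  have "((\<lambda>r. norm (T (t - r) (y r) - T (t - r0) (y r0))) \<longlongrightarrow> 0) (at r0 within {0..t})"
  proof (rule tendsto_sandwich[OF _ _ tendsto_const lim])
    show "eventually (\<lambda>r. norm (T (t - r) (y r) - T (t - r0) (y r0))
      \<le> exp (\<bar>c\<bar> * t) * norm (y r - y r0) + norm (T (t - r) (y r0) - T (t - r0) (y r0))) (at r0 within {0..t})"
      unfolding eventually_at_topological
    proof (intro exI[of _ UNIV] conjI ballI impI)
      fix r assume r: "r \<in> {0..t}"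
      then have tr: "0 \<le> t - r" by simp
      have "T (t - r) (y r) - T (t - r0) (y r0) = T (t - r) (y r - y r0) + (T (t - r) (y r0) - T (t - r0) (y r0))"
        by (simp add: linear_diff[OF bounded_linear.linear, OF semigroup_linear[OF gen tr]])
      then have "norm (T (t - r) (y r) - T (t - r0) (y r0)) \<le> norm (T (t - r) (y r - y r0)) + norm (T (t - r) (y r0) - T (t - r0) (y r0))"
        by (metis norm_triangle_ineq)
      moreover have "norm (T (t - r) (y r - y r0)) \<le> exp (\<bar>c\<bar> * t) * norm (y r - y r0)"
      proof -
        have "- c * (t - r) \<le> \<bar>c\<bar> * (t - r)" using tr by (intro mult_right_mono) auto
        also have "\<dots> \<le> \<bar>c\<bar> * t" using r by (intro mult_left_mono) auto
        finally have "exp (- c * (t - r)) * norm (y r - y r0) \<le> exp (\<bar>c\<bar> * t) * norm (y r - y r0)"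
          by (intro mult_right_mono) auto
        with decay[OF tr, of "y r - y r0"] show ?thesis by linarith
      qed
      ultimately show "norm (T (t - r) (y r) - T (t - r0) (y r0))
        \<le> exp (\<bar>c\<bar> * t) * norm (y r - y r0) + norm (T (t - r) (y r0) - T (t - r0) (y r0))" by linarith
    qed auto
  qed auto
  then show "((\<lambda>r. T (t - r) (y r)) \<longlongrightarrow> T (t - r0) (y r0)) (at r0 within {0..t})"
    by (subst Lim_null) (rule tendsto_norm_zero_cancel)
qed

text \<open>Positivity bounds the Rayleigh quotients below by 0; only then is \<open>Inf\<close> a
  genuine lower bound.\<close>

lemma principal_eigenvalue_le:
  assumes "positive_definite_op D A" "x \<in> D"
  shows "principal_eigenvalue D A * (norm x)\<^sup>2 \<le> inner (A x) x"
proof (cases "x = 0")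
  case True
  then show ?thesis by simp
next
  case False
  have "bdd_below {inner (A \<phi>) \<phi> / (norm \<phi>)\<^sup>2 | \<phi>. \<phi> \<in> D \<and> \<phi> \<noteq> 0}"
    using assms(1) by (intro bdd_belowI[of _ 0]) (auto simp: positive_definite_op_def less_imp_le)
  then have "principal_eigenvalue D A \<le> inner (A x) x / (norm x)\<^sup>2"
    unfolding principal_eigenvalue_def using assms(2) False by (intro cInf_lower) auto
  then show ?thesis using False by (simp add: field_simps)
qed

section \<open>Growth of Brownian motion\<close>

context brownian begin

text \<open>Doob's maximal inequality for the exponential martingale: the martingale is stopped when it
  first reaches level \<open>c\<close> on the grid, which preserves its mean.\<close>

lemma exp_martingale_maximal:
  fixes a :: real
  assumes g: "0 < g" and c: "0 < c"
  defines "E \<equiv> \<lambda>j \<omega>. exp (a * W (real j * g) \<omega> - a\<^sup>2 * (real j * g) / 2)"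
  shows "prob {\<omega>\<in>space M. \<exists>j\<le>N. c \<le> E j \<omega>} \<le> 1 / c"
proof -
  \<comment> \<open>The stopped process: frozen once it has reached \<open>c\<close>, equal to
    \<open>E\<close> until then. An early passage of the level is therefore still visible in
    \<open>s N\<close>.\<close>
  define s where "s = rec_nat (E 0) (\<lambda>j u \<omega>. if c \<le> u \<omega> then u \<omega> else E (Suc j) \<omega>)"
  have s0: "s 0 = E 0" and sSuc: "s (Suc j) \<omega> = (if c \<le> s j \<omega> then s j \<omega> else E (Suc j) \<omega>)" for j \<omega>
    by (simp_all add: s_def)
  have run: "s j \<omega> = E j \<omega>" if "s j \<omega> < c" for j \<omega>
    using that by (cases j) (auto simp: s0 sSuc split: if_splits)
  have pos: "0 < s j \<omega>" for j \<omega>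
    using c by (induction j) (auto simp: s0 sSuc E_def)
  have stay: "c \<le> s (j + i) \<omega>" if "c \<le> s j \<omega>" for i j \<omega>
    using that by (induction i) (auto simp: sSuc)
  have hit: "c \<le> s N \<omega>" if "j \<le> N" "c \<le> E j \<omega>" for j \<omega>
  proof -
    have "c \<le> s j \<omega>" using that(2) run[of j \<omega>] by (cases "s j \<omega> < c") auto
    from stay[OF this, of "N - j"] that(1) show ?thesis by simp
  qed
  have Ead: "E j \<in> borel_measurable (F (real j * g))" for j
  proof -
    have [measurable]: "W (real j * g) \<in> borel_measurable (F (real j * g))" using g by (intro W_adapted) auto
    show ?thesis unfolding E_def by measurable
  qed
  have "s j \<in> borel_measurable (F (real j * g)) \<and> has_bochner_integral M (s j) 1" for j
  proof (induction j)
    case 0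
    have "AE \<omega> in M. E 0 \<omega> = 1" using W_0 by eventually_elim (simp add: E_def)
    moreover have "has_bochner_integral M (\<lambda>_. 1 :: real) 1" by (simp add: has_bochner_integral_iff prob_space)
    ultimately have "has_bochner_integral M (E 0) 1"
      using measurable_F[OF Ead[of 0]] by (subst has_bochner_integral_cong_AE[of _ _ "\<lambda>_. 1"]) auto
    then show ?case using Ead[of 0] by (simp add: s0)
  next
    case (Suc j)
    let ?a = "real j * g" and ?b = "real (Suc j) * g"
    have ab: "0 \<le> ?a" "?a < ?b" "?b - ?a = g" using g by (auto simp: algebra_simps)
    have sm: "s j \<in> borel_measurable (F ?a)" and si: "has_bochner_integral M (s j) 1" using Suc by auto
    \<comment> \<open>The ratio of consecutive values of \<open>E\<close>, as a function of the
      increment; the compensating factor gives it mean 1.\<close>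
    define D where "D x = exp (a * x) * exp (- (a\<^sup>2 * g / 2))" for x
    have ED: "E (Suc j) \<omega> = E j \<omega> * D (W ?b \<omega> - W ?a \<omega>)" for \<omega>
      unfolding E_def D_def exp_add[symmetric] by (rule arg_cong[where f=exp]) (simp add: algebra_simps add_divide_distrib)
    have Dm: "D \<in> borel_measurable borel" unfolding D_def[abs_def] by measurable
    have "has_bochner_integral M (\<lambda>\<omega>. D (W ?b \<omega> - W ?a \<omega>)) (exp (a\<^sup>2 * g / 2) * exp (- (a\<^sup>2 * g / 2)))"
      using has_bochner_integral_mult_left[OF increment_exp[OF ab(1,2), of a]] unfolding D_def ab(3) by simp
    then have Di: "integrable M (\<lambda>\<omega>. D (W ?b \<omega> - W ?a \<omega>))" "expectation (\<lambda>\<omega>. D (W ?b \<omega> - W ?a \<omega>)) = 1"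
      by (auto simp: has_bochner_integral_iff exp_minus)
    define A where "A = {\<omega>\<in>space M. c \<le> s j \<omega>}"
    have AF: "A \<in> sets (F ?a)"
      using measurable_sets[OF sm, of "{c..}"] by (simp add: A_def vimage_def Int_def conj_commute)
    then have Ae: "A \<in> events" using sets_F_subset by blast
    have i1: "integrable M (\<lambda>\<omega>. indicator A \<omega> * s j \<omega>)" "integrable M (\<lambda>\<omega>. indicator (space M - A) \<omega> * s j \<omega>)"
      using si Ae by (auto simp: has_bochner_integral_iff intro!: integrable_mult_indicator[where 'b=real, simplified])
    have m2: "(\<lambda>\<omega>. indicator (space M - A) \<omega> * s j \<omega>) \<in> borel_measurable (F ?a)"
    proof -
      have "space M - A \<in> sets (F ?a)" using sets.compl_sets[OF AF] by simp
      then show ?thesis using sm by (intro borel_measurable_times borel_measurable_indicator)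
    qed
    \<comment> \<open>Only the part not yet stopped is multiplied by \<open>D\<close>, and its
      coefficient is known at time \<open>?a\<close>, so the mean is preserved.\<close>
    have eq: "s (Suc j) \<omega> = indicator A \<omega> * s j \<omega> + (indicator (space M - A) \<omega> * s j \<omega>) * D (W ?b \<omega> - W ?a \<omega>)" if "\<omega> \<in> space M" for \<omega>
      using that run[of j \<omega>] ED[of \<omega>] by (auto simp: sSuc A_def indicator_def)
    have int: "integrable M (\<lambda>\<omega>. (indicator (space M - A) \<omega> * s j \<omega>) * D (W ?b \<omega> - W ?a \<omega>))"
      by (rule integrable_mult_increment[OF ab(1,2) m2 i1(2) Dm Di(1)])
    have "expectation (\<lambda>\<omega>. indicator A \<omega> * s j \<omega> + (indicator (space M - A) \<omega> * s j \<omega>) * D (W ?b \<omega> - W ?a \<omega>))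
      = expectation (\<lambda>\<omega>. indicator A \<omega> * s j \<omega>) + expectation (\<lambda>\<omega>. indicator (space M - A) \<omega> * s j \<omega>)"
      using i1 int expectation_mult_increment[OF ab(1,2) m2 i1(2) Dm Di(1)] Di(2) by simp
    also have "\<dots> = expectation (\<lambda>\<omega>. indicator A \<omega> * s j \<omega> + indicator (space M - A) \<omega> * s j \<omega>)"
      using i1 by simp
    also have "\<dots> = expectation (s j)"
      by (intro Bochner_Integration.integral_cong) (auto simp: indicator_def)
    finally have "has_bochner_integral M (\<lambda>\<omega>. indicator A \<omega> * s j \<omega> + (indicator (space M - A) \<omega> * s j \<omega>) * D (W ?b \<omega> - W ?a \<omega>)) 1"
      using si i1 int by (simp add: has_bochner_integral_iff)
    then have "has_bochner_integral M (s (Suc j)) 1"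
      by (subst has_bochner_integral_cong[OF refl eq refl])
    moreover have "s (Suc j) \<in> borel_measurable (F ?b)"
    proof -
      have [measurable]: "s j \<in> borel_measurable (F ?b)" using ab by (intro measurable_nat_filt_mono[OF sm]) auto
      have [measurable]: "E (Suc j) \<in> borel_measurable (F ?b)" by (rule Ead)
      have "s (Suc j) = (\<lambda>\<omega>. if c \<le> s j \<omega> then s j \<omega> else E (Suc j) \<omega>)" by (rule ext) (rule sSuc)
      then show ?thesis by (simp only:) measurable
    qed
    ultimately show ?case by simp
  qed
  then have sN: "s N \<in> borel_measurable M" "integrable M (s N)" "expectation (s N) = 1"
    using measurable_F by (auto simp: has_bochner_integral_iff)
  have "prob {\<omega>\<in>space M. \<exists>j\<le>N. c \<le> E j \<omega>} \<le> prob {\<omega>\<in>space M. c \<le> s N \<omega>}"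
    using sN(1) hit by (intro finite_measure_mono) auto
  also have "\<dots> \<le> expectation (s N) / c"
    using sN c pos by (intro integral_Markov_inequality_measure[where A="{}"]) (auto simp: less_imp_le)
  finally show ?thesis using sN(3) by simp
qed

text \<open>The maximal inequality is uniform in the grid. Along dyadic grids the events of reaching
  a level increase with \<open>m\<close>, so the bound \<open>1 / c\<close> passes to their union,
  and letting the level grow leaves a null event. Continuity covers the remaining times.\<close>

lemma exp_martingale_bounded:
  "AE \<omega> in M. \<exists>C. \<forall>t\<ge>0. exp (a * W t \<omega> - a\<^sup>2 * t / 2) \<le> C"
proof -
  define E where "E t \<omega> = exp (a * W t \<omega> - a\<^sup>2 * t / 2)" for t \<omega>
  \<comment> \<open>The \<open>4^m\<close> steps of length \<open>1 / 2^m\<close> reach time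
    \<open>2^m\<close>, so mesh and horizon improve together.\<close>
  define S where "S c m = {\<omega>\<in>space M. \<exists>j\<le>4^m. real c \<le> E (real j * (1 / 2^m)) \<omega>}" for c m :: nat
  have EM: "E t \<in> borel_measurable M" if "0 \<le> t" for t
  proof -
    have [measurable]: "W t \<in> borel_measurable M" using that by simp
    show ?thesis unfolding E_def[abs_def] by measurable
  qed
  have SM: "S c m \<in> events" for c m
  proof -
    have "S c m = (\<Union>j\<in>{..4^m}. {\<omega>\<in>space M. real c \<le> E (real j * (1 / 2^m)) \<omega>})" by (auto simp: S_def)
    moreover have "{\<omega>\<in>space M. real c \<le> E (real j * (1 / 2^m)) \<omega>} \<in> events" for j
      by (intro borel_measurable_le borel_measurable_const EM) auto
    ultimately show ?thesis by auto
  qed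
  have Sp: "prob (S c m) \<le> 1 / real c" if "0 < c" for c m
    unfolding S_def E_def using that by (intro exp_martingale_maximal) auto
  have Sinc: "incseq (S c)" for c
  proof (rule incseq_SucI, rule subsetI)
    fix m \<omega> assume "\<omega> \<in> S c m"
    then obtain j where j: "\<omega> \<in> space M" "j \<le> 4^m" "real c \<le> E (real j * (1 / 2^m)) \<omega>" by (auto simp: S_def)
    have "2 * j \<le> 4 ^ Suc m" using j(2) by simp
    moreover have "real (2 * j) * (1 / 2 ^ Suc m) = real j * (1 / 2^m)" by simp
    ultimately show "\<omega> \<in> S c (Suc m)" using j unfolding S_def by (metis (mono_tags, lifting) mem_Collect_eq)
  qed
  have Up: "prob (\<Union>m. S c m) \<le> 1 / real c" if "0 < c" for c
    using finite_Lim_measure_incseq[of "S c"] SM Sinc Sp[OF that]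
    by (intro LIMSEQ_le_const2[of "\<lambda>m. prob (S c m)"]) auto
  have "prob (\<Inter>c. \<Union>m. S (Suc c) m) = 0"
  proof -
    have "prob (\<Inter>c. \<Union>m. S (Suc c) m) \<le> 1 / real (Suc c)" for c
    proof -
      have "prob (\<Inter>c. \<Union>m. S (Suc c) m) \<le> prob (\<Union>m. S (Suc c) m)"
        using SM by (intro finite_measure_mono) auto
      with Up[of "Suc c"] show ?thesis by simp
    qed
    moreover have "(\<lambda>c. 1 / real (Suc c)) \<longlonglongrightarrow> 0" by (rule LIMSEQ_Suc[OF lim_const_over_n])
    ultimately have "prob (\<Inter>c. \<Union>m. S (Suc c) m) \<le> 0" by (intro LIMSEQ_le_const) auto
    then show ?thesis using measure_nonneg[of M "\<Inter>c. \<Union>m. S (Suc c) m"] by linarith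
  qed
  then have "AE \<omega> in M. \<omega> \<notin> (\<Inter>c. \<Union>m. S (Suc c) m)"
    using SM by (subst (asm) prob_eq_0) auto
  then show ?thesis using W_continuous AE_space
  proof eventually_elim
    case (elim \<omega>)
    then obtain c where c: "\<And>m. \<omega> \<notin> S c m" by auto
    have Ec: "continuous_on {0..} (\<lambda>t. E t \<omega>)" unfolding E_def
      using elim(2) by (intro continuous_intros) auto
    have "E t \<omega> \<le> real c" if t: "0 \<le> t" for t
    proof -
      \<comment> \<open>The dyadic point at or just below \<open>t\<close>. It belongs to the grid
        of \<open>S c m\<close> once \<open>2^m\<close> exceeds \<open>t\<close>, which is why the
        bound is obtained for \<open>m \<ge> m0\<close>.\<close>
      define r where "r m = real (nat \<lfloor>t * 2^m\<rfloor>) * (1 / 2^m)" for m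
      have r: "0 \<le> r m" "t - 1 / 2^m \<le> r m" "r m \<le> t" for m
      proof -
        have "real (nat \<lfloor>t * 2^m\<rfloor>) = of_int \<lfloor>t * 2^m\<rfloor>" using t by simp
        then have "real (nat \<lfloor>t * 2^m\<rfloor>) \<le> t * 2^m" "t * 2^m - 1 \<le> real (nat \<lfloor>t * 2^m\<rfloor>)" by linarith+
        then have "(t * 2^m - 1) / 2^m \<le> r m" "r m \<le> (t * 2^m) / 2^m"
          unfolding r_def times_divide_eq_right mult_1_right by (intro divide_right_mono; simp)+
        then show "t - 1 / 2^m \<le> r m" "r m \<le> t" by (auto simp: diff_divide_distrib)
        show "0 \<le> r m" by (simp add: r_def)
      qed
      have "(\<lambda>m. t - (1/2)^m) \<longlonglongrightarrow> t - 0" by (intro tendsto_intros LIMSEQ_power_zero) auto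
      then have "r \<longlonglongrightarrow> t"
        using r by (intro tendsto_sandwich[of "\<lambda>m. t - (1/2)^m" r sequentially "\<lambda>_. t"]) (auto simp: power_divide)
      then have lim: "(\<lambda>m. E (r m) \<omega>) \<longlonglongrightarrow> E t \<omega>"
        using Ec t r(1) by (auto simp: continuous_on_sequentially o_def)
      obtain m0 :: nat where m0: "t < 2 ^ m0" using real_arch_pow[of 2 t] by auto
      have "E (r m) \<omega> \<le> real c" if "m \<ge> m0" for m
      proof -
        have "(2::real) ^ m0 \<le> 2 ^ m" using that by (intro power_increasing) auto
        then have "t \<le> 2 ^ m" using m0 by linarith
        then have "t * 2 ^ m \<le> 2 ^ m * 2 ^ m" by (intro mult_right_mono) auto
        then have "real (nat \<lfloor>t * 2^m\<rfloor>) \<le> 2 ^ m * 2 ^ m" using t by (intro order_trans[OF of_nat_floor]) auto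
        also have "(2::real) ^ m * 2 ^ m = real (4 ^ m)" by (simp flip: power_mult_distrib)
        finally have "nat \<lfloor>t * 2^m\<rfloor> \<le> 4 ^ m" by (simp only: of_nat_le_iff)
        then have "\<not> real c \<le> E (real (nat \<lfloor>t * 2^m\<rfloor>) * (1 / 2^m)) \<omega>"
          using c[of m] elim(3) unfolding S_def by blast
        then show ?thesis by (simp add: r_def)
      qed
      then show ?thesis by (intro LIMSEQ_le_const2[OF lim]) auto
    qed
    then show ?case unfolding E_def by blast
  qed
qed

text \<open>Taking logarithms in the bound for the exponential martingale with parameter
  \<open>\<kappa> * b\<close> and dividing by \<kappa> leaves a line of slope
  \<open>\<kappa> * b\<^sup>2 / 2\<close>, which a small \<kappa> brings below \<epsilon>.\<close>

lemma brownian_sublinear_growth: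
  assumes \<epsilon>: "0 < \<epsilon>"
  shows "AE \<omega> in M. \<exists>C. \<forall>t\<ge>0. b * W t \<omega> \<le> C + \<epsilon> * t"
proof -
  \<comment> \<open>The 1 in the denominator covers \<open>b = 0\<close>.\<close>
  define \<kappa> where "\<kappa> = 2 * \<epsilon> / (b\<^sup>2 + 1)"
  have b1: "0 < b\<^sup>2 + 1" by (simp add: add_nonneg_pos)
  have \<kappa>: "0 < \<kappa>" using \<epsilon> b1 by (simp add: \<kappa>_def)
  have \<kappa>b: "\<kappa> * b\<^sup>2 / 2 \<le> \<epsilon>"
  proof -
    have "\<kappa> * b\<^sup>2 / 2 = \<epsilon> * (b\<^sup>2 / (b\<^sup>2 + 1))"
      using b1 by (simp add: \<kappa>_def field_simps)
    also have "\<dots> \<le> \<epsilon> * 1" using \<epsilon> b1 by (intro mult_left_mono) (auto simp: divide_le_eq)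
    finally show ?thesis by simp
  qed
  show ?thesis using exp_martingale_bounded[of "\<kappa> * b"]
  proof eventually_elim
    case (elim \<omega>)
    then obtain C where C: "\<And>t. 0 \<le> t \<Longrightarrow> exp (\<kappa> * b * W t \<omega> - (\<kappa> * b)\<^sup>2 * t / 2) \<le> C" by blast
    have Cpos: "0 < C" using C[of 0] less_le_trans[OF exp_gt_zero] by auto
    have "b * W t \<omega> \<le> ln C / \<kappa> + \<epsilon> * t" if t: "0 \<le> t" for t
    proof -
      have "\<kappa> * b * W t \<omega> - (\<kappa> * b)\<^sup>2 * t / 2 \<le> ln C"
        using C[OF t] Cpos by (simp add: ln_ge_iff)
      then have "\<kappa> * (b * W t \<omega>) \<le> ln C + \<kappa> * ((\<kappa> * b\<^sup>2 / 2) * t)" by (simp add: power2_eq_square algebra_simps)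
      also have "\<dots> \<le> ln C + \<kappa> * (\<epsilon> * t)"
        using \<kappa> \<kappa>b t by (intro add_left_mono mult_left_mono mult_right_mono) auto
      also have "\<dots> = \<kappa> * (ln C / \<kappa> + \<epsilon> * t)" using \<kappa> by (simp add: field_simps)
      finally show ?thesis using \<kappa> by (simp only: mult_le_cancel_left_pos)
    qed
    then show ?case by blast
  qed
qed

section \<open>Ito integrals over a single point and under bounded linear maps\<close>

lemma ito_integral_degenerate:
  assumes "is_ito_integral M W a a f X"
  shows "AE \<omega> in M. X \<omega> = 0"
proof -
  obtain g I where X: "X \<in> borel_measurable M" and gI: "\<And>n::nat. simple_ito M W a a (g n) (I n)"
    and I: "tendsto_zero_in_prob M (\<lambda>n \<omega>. ennreal (norm (I n \<omega> - X \<omega>)))"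
    using assms unfolding is_ito_integral_def by blast
  have "I n \<omega> = 0" for n \<omega>
  proof -
    obtain N tp \<xi> where s: "tp 0 = a" "tp N = a" "\<And>i. i < N \<Longrightarrow> tp i < tp (Suc i)"
      "I n \<omega> = (\<Sum>i<N. (W (tp (Suc i)) \<omega> - W (tp i) \<omega>) *\<^sub>R \<xi> i \<omega>)"
      using gI[of n] unfolding simple_ito_def by blast
    \<comment> \<open>Strictly increasing partition points with equal ends leave no cell, so every
      approximating integral is 0.\<close>
    have "N = 0" using s(1,2) strict_step_less[of N tp 0 N, OF s(3)] by (cases "N = 0") auto
    then show ?thesis using s(4) by simp
  qed
  then have "tendsto_zero_in_prob M (\<lambda>n \<omega>. ennreal \<bar>norm (X \<omega>)\<bar>)" using I by simp
  then have "(\<lambda>n. prob_norm (\<lambda>\<omega>. norm (X \<omega>))) \<longlonglongrightarrow> 0"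
    using X by (intro tendsto_zero_in_prob_prob_norm) auto
  then have "prob_norm (\<lambda>\<omega>. norm (X \<omega>)) = 0" by (simp add: LIMSEQ_const_iff)
  then have "AE \<omega> in M. norm (X \<omega>) = 0" using X by (intro prob_norm_eq_0) auto
  then show ?thesis by simp
qed

end

text \<open>No measurability is assumed: \<open>nn_integral\<close> is then a lower integral.\<close>

lemma nn_integral_cmult_le:
  fixes f :: "'a \<Rightarrow> ennreal"
  assumes c: "0 < c"
  shows "(\<integral>\<^sup>+x. ennreal c * f x \<partial>M) \<le> ennreal c * (\<integral>\<^sup>+x. f x \<partial>M)"
proof -
  have "integral\<^sup>S M g \<le> ennreal c * (\<integral>\<^sup>+x. f x \<partial>M)"
    if g: "simple_function M g" "g \<le> (\<lambda>x. ennreal c * f x)" for g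
  proof -
    have inv: "ennreal (1 / c) * (ennreal c * x) = x" "ennreal c * (ennreal (1 / c) * x) = x" for x :: ennreal
      using c by (simp_all add: mult.assoc[symmetric] ennreal_mult[symmetric])
    define g' where "g' x = ennreal (1 / c) * g x" for x
    have g': "simple_function M g'" unfolding g'_def[abs_def] using g(1) by (intro simple_function_mult) auto
    have "g' \<le> f"
    proof (rule le_funI)
      fix x
      have "g x \<le> ennreal c * f x" using g(2) by (rule le_funD)
      then have "g' x \<le> ennreal (1 / c) * (ennreal c * f x)" unfolding g'_def by (rule mult_left_mono) simp
      then show "g' x \<le> f x" by (simp only: inv)
    qed
    then have "integral\<^sup>S M g' \<le> (\<integral>\<^sup>+x. f x \<partial>M)"
      unfolding nn_integral_def using g' by (intro SUP_upper) auto
    then have "ennreal c * integral\<^sup>S M g' \<le> ennreal c * (\<integral>\<^sup>+x. f x \<partial>M)" by (rule mult_left_mono) simp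
    also have "ennreal c * integral\<^sup>S M g' = integral\<^sup>S M (\<lambda>x. ennreal c * g' x)"
      by (rule simple_integral_mult[OF g', symmetric])
    also have "(\<lambda>x. ennreal c * g' x) = g" by (simp only: g'_def inv)
    finally show ?thesis .
  qed
  then show ?thesis unfolding nn_integral_def[of M "\<lambda>x. ennreal c * f x"] by (intro SUP_least) auto
qed

lemma tendsto_zero_in_prob_mono:
  assumes lim: "tendsto_zero_in_prob M D" and K: "0 < K"
    and le: "\<And>n \<omega>. \<omega> \<in> space M \<Longrightarrow> D' n \<omega> \<le> ennreal K * D n \<omega>"
  shows "tendsto_zero_in_prob M D'"
  unfolding tendsto_zero_in_prob_def
proof (intro allI impI)
  fix \<epsilon> \<delta> :: real assume \<epsilon>: "0 < \<epsilon>" and \<delta>: "0 < \<delta>"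
  obtain N where N: "\<And>n. n \<ge> N \<Longrightarrow> \<exists>A\<in>sets M. {\<omega>\<in>space M. D n \<omega> > ennreal (\<epsilon> / K)} \<subseteq> A \<and> measure M A < \<delta>"
    using lim[unfolded tendsto_zero_in_prob_def, rule_format, of "\<epsilon> / K" \<delta>] \<epsilon> K \<delta> by auto
  have "{\<omega>\<in>space M. D' n \<omega> > ennreal \<epsilon>} \<subseteq> {\<omega>\<in>space M. D n \<omega> > ennreal (\<epsilon> / K)}" for n
  proof safe
    fix \<omega> assume \<omega>: "\<omega> \<in> space M" "ennreal \<epsilon> < D' n \<omega>"
    show "ennreal (\<epsilon> / K) < D n \<omega>"
    proof (rule ccontr)
      assume "\<not> ?thesis"
      then have "ennreal K * D n \<omega> \<le> ennreal K * ennreal (\<epsilon> / K)" by (intro mult_left_mono) auto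
      also have "\<dots> = ennreal \<epsilon>" using K \<epsilon> by (simp add: ennreal_mult[symmetric])
      finally show False using le[OF \<omega>(1), of n] \<omega>(2) by auto
    qed
  qed
  then show "\<exists>N. \<forall>n\<ge>N. \<exists>A\<in>sets M. {\<omega>\<in>space M. D' n \<omega> > ennreal \<epsilon>} \<subseteq> A \<and> measure M A < \<delta>"
    using N by (meson subset_trans)
qed

text \<open>\<open>L\<close> sends simple processes to simple processes on the same partition, and
  both approximation errors grow at most by a constant factor. The new integrand is prescribed on
  \<open>{a..b}\<close> only, because the semigroup law identifies it only there.\<close>

lemma ito_integral_bounded_linear:
  fixes L :: "'h::{banach,second_countable_topology} \<Rightarrow> 'k::{banach,second_countable_topology}"
  assumes L: "bounded_linear L" and ito: "is_ito_integral M W a b f X"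
    and f': "\<And>r \<omega>. r \<in> {a..b} \<Longrightarrow> f' r \<omega> = L (f r \<omega>)"
  shows "is_ito_integral M W a b f' (\<lambda>\<omega>. L (X \<omega>))"
proof -
  interpret bounded_linear L by (rule L)
  have Lm: "L \<in> borel_measurable borel"
    by (intro borel_measurable_continuous_onI linear_continuous_on L)
  obtain C where C: "0 < C" "\<And>x. norm (L x) \<le> norm x * C" using pos_bounded by blast
  obtain g I where X: "X \<in> borel_measurable M" and gI: "\<And>n. simple_ito M W a b (g n) (I n)"
    and g: "tendsto_zero_in_prob M (\<lambda>n \<omega>. set_nn_integral lborel {a..b} (\<lambda>s. ennreal ((norm (g n s \<omega> - f s \<omega>))\<^sup>2)))"
    and I: "tendsto_zero_in_prob M (\<lambda>n \<omega>. ennreal (norm (I n \<omega> - X \<omega>)))"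
    using ito unfolding is_ito_integral_def by blast
  show ?thesis unfolding is_ito_integral_def
  proof (intro conjI exI allI)
    show "(\<lambda>\<omega>. L (X \<omega>)) \<in> borel_measurable M" by (rule measurable_compose[OF X Lm])
    show "simple_ito M W a b (\<lambda>s \<omega>. L (g n s \<omega>)) (\<lambda>\<omega>. L (I n \<omega>))" for n
    proof -
      obtain N tp \<xi> where s: "tp 0 = a" "tp N = b" "\<And>i. i < N \<Longrightarrow> tp i < tp (Suc i)"
        "\<And>i. i < N \<Longrightarrow> \<xi> i \<in> borel_measurable (nat_filt M W (tp i))"
        "\<And>s \<omega>. g n s \<omega> = (\<Sum>i<N. indicator {tp i<..tp (Suc i)} s *\<^sub>R \<xi> i \<omega>)"
        "\<And>\<omega>. I n \<omega> = (\<Sum>i<N. (W (tp (Suc i)) \<omega> - W (tp i) \<omega>) *\<^sub>R \<xi> i \<omega>)"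
        using gI[of n] unfolding simple_ito_def by blast
      show ?thesis unfolding simple_ito_def
        by (intro exI[of _ N] exI[of _ tp] exI[of _ "\<lambda>i \<omega>. L (\<xi> i \<omega>)"])
           (use s in \<open>auto simp: sum scaleR intro!: measurable_compose[OF _ Lm]\<close>)
    qed
    show "tendsto_zero_in_prob M (\<lambda>n \<omega>. set_nn_integral lborel {a..b} (\<lambda>s. ennreal ((norm (L (g n s \<omega>) - f' s \<omega>))\<^sup>2)))"
    proof (rule tendsto_zero_in_prob_mono[OF g, of "C\<^sup>2"])
      fix n \<omega>
      have *: "ennreal ((norm (L (g n s \<omega>) - f' s \<omega>))\<^sup>2) * indicator {a..b} s
        \<le> ennreal (C\<^sup>2) * (ennreal ((norm (g n s \<omega> - f s \<omega>))\<^sup>2) * indicator {a..b} s)" for s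
      proof (cases "s \<in> {a..b}")
        case True
        have "norm (L (g n s \<omega>) - f' s \<omega>) = norm (L (g n s \<omega> - f s \<omega>))" by (simp add: f'[OF True] diff)
        also have "\<dots> \<le> norm (g n s \<omega> - f s \<omega>) * C" by (rule C(2))
        finally have "(norm (L (g n s \<omega>) - f' s \<omega>))\<^sup>2 \<le> (norm (g n s \<omega> - f s \<omega>) * C)\<^sup>2" by (rule power_mono) simp
        then have "ennreal ((norm (L (g n s \<omega>) - f' s \<omega>))\<^sup>2) \<le> ennreal (C\<^sup>2 * (norm (g n s \<omega> - f s \<omega>))\<^sup>2)"
          by (intro ennreal_leI) (simp add: power_mult_distrib mult.commute)
        then show ?thesis using True by (simp add: ennreal_mult)
      qed simp
      then have "set_nn_integral lborel {a..b} (\<lambda>s. ennreal ((norm (L (g n s \<omega>) - f' s \<omega>))\<^sup>2))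
        \<le> (\<integral>\<^sup>+s. ennreal (C\<^sup>2) * (ennreal ((norm (g n s \<omega> - f s \<omega>))\<^sup>2) * indicator {a..b} s) \<partial>lborel)"
        by (intro nn_integral_mono)
      also have "\<dots> \<le> ennreal (C\<^sup>2) * set_nn_integral lborel {a..b} (\<lambda>s. ennreal ((norm (g n s \<omega> - f s \<omega>))\<^sup>2))"
        using C by (intro nn_integral_cmult_le) simp
      finally show "set_nn_integral lborel {a..b} (\<lambda>s. ennreal ((norm (L (g n s \<omega>) - f' s \<omega>))\<^sup>2))
        \<le> ennreal (C\<^sup>2) * set_nn_integral lborel {a..b} (\<lambda>s. ennreal ((norm (g n s \<omega> - f s \<omega>))\<^sup>2))" .
    qed (use C in simp)
    show "tendsto_zero_in_prob M (\<lambda>n \<omega>. ennreal (norm (L (I n \<omega>) - L (X \<omega>))))"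
    proof (rule tendsto_zero_in_prob_mono[OF I C(1)])
      fix n \<omega>
      have "norm (L (I n \<omega>) - L (X \<omega>)) \<le> C * norm (I n \<omega> - X \<omega>)" using C(2)[of "I n \<omega> - X \<omega>"] by (simp add: diff mult.commute)
      then show "ennreal (norm (L (I n \<omega>) - L (X \<omega>))) \<le> ennreal C * ennreal (norm (I n \<omega> - X \<omega>))"
        using C(1) by (simp add: ennreal_mult[symmetric] ennreal_leI)
    qed
  qed
qed

section \<open>The mild solution\<close>

context brownian begin

text \<open>\<open>mild_solution\<close> contains no separate initial condition; it is the mild
  formula at time 0, where both integrals run over a single point.\<close>

lemma mild_solution_initial:
  assumes sol: "mild_solution M W T \<beta>0 \<beta>1 y0 y" and T0: "\<And>x. T 0 x = x"
  shows "AE \<omega> in M. y 0 \<omega> = y0 \<omega>"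
proof -
  obtain X where X: "is_ito_integral M W 0 0 (\<lambda>s \<omega>. T (0 - s) (\<beta>1 *\<^sub>R y s \<omega>)) X"
    "AE \<omega> in M. y 0 \<omega> = T 0 (y0 \<omega>) + set_lebesgue_integral lborel {0..0} (\<lambda>s. T (0 - s) (\<beta>0 *\<^sub>R y s \<omega>)) + X \<omega>"
    using sol unfolding mild_solution_def by blast
  have "set_lebesgue_integral lborel {0..0} (\<lambda>s. T (0 - s) (\<beta>0 *\<^sub>R y s \<omega>)) = 0" for \<omega>
    unfolding set_lebesgue_integral_def
    using AE_lborel_singleton[of 0] by (intro integral_eq_zero_AE) (auto elim!: eventually_mono)
  note 0 = this
  show ?thesis using X(2) ito_integral_degenerate[OF X(1)]
  proof eventually_elim
    case (elim \<omega>)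
    then show ?case unfolding 0 T0 by simp
  qed
qed

text \<open>\<open>Y s\<close> is the mild noise integral up to \<open>s\<close>, transported to
  time \<open>t\<close> and tested with \<open>z\<close>; its integrand becomes
  \<open>\<beta>1 * v r\<close>, the same for every \<open>s\<close>. \<open>decay\<close> enters
  through the path continuity of \<open>v\<close>. In the end \<open>z\<close> ranges over a
  countable dense set, so that one null set serves all test vectors.\<close>

lemma mild_solution_explicit:
  fixes T :: "real \<Rightarrow> 'h::{real_inner,banach,second_countable_topology} \<Rightarrow> 'h"
  assumes gen: "generates_C0_semigroup T D G"
    and decay: "\<And>s x. 0 \<le> s \<Longrightarrow> norm (T s x) \<le> exp (- c * s) * norm x"
    and sol: "mild_solution M W T \<beta>0 \<beta>1 y0 y" and t: "0 \<le> t"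
  shows "AE \<omega> in M. y t \<omega> = exp ((\<beta>0 - \<beta>1\<^sup>2 / 2) * t + \<beta>1 * W t \<omega>) *\<^sub>R T t (y0 \<omega>)"
proof (cases "t = 0")
  case True
  show ?thesis using mild_solution_initial[OF sol semigroup_0[OF gen]] W_0
    by eventually_elim (simp add: True semigroup_0[OF gen])
next
  case False
  with t have t0: "0 < t" by simp
  have yad: "y r \<in> borel_measurable (F r)" if "0 \<le> r" for r
    using sol that unfolding mild_solution_def by blast
  have ycont: "AE \<omega> in M. continuous_on {0..} (\<lambda>r. y r \<omega>)" using sol unfolding mild_solution_def by blast
  have "\<forall>s\<in>{0..}. \<exists>X. is_ito_integral M W 0 s (\<lambda>r \<omega>. T (s - r) (\<beta>1 *\<^sub>R y r \<omega>)) X \<and>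
      (AE \<omega> in M. y s \<omega> = T s (y0 \<omega>) + set_lebesgue_integral lborel {0..s} (\<lambda>r. T (s - r) (\<beta>0 *\<^sub>R y r \<omega>)) + X \<omega>)"
    using sol unfolding mild_solution_def by auto
  then obtain X where X: "\<And>s. 0 \<le> s \<Longrightarrow> is_ito_integral M W 0 s (\<lambda>r \<omega>. T (s - r) (\<beta>1 *\<^sub>R y r \<omega>)) (X s)"
    "\<And>s. 0 \<le> s \<Longrightarrow> AE \<omega> in M. y s \<omega> = T s (y0 \<omega>) + set_lebesgue_integral lborel {0..s} (\<lambda>r. T (s - r) (\<beta>0 *\<^sub>R y r \<omega>)) + X s \<omega>"
    unfolding bchoice_iff by auto
  have yinit: "AE \<omega> in M. y 0 \<omega> = y0 \<omega>" by (rule mild_solution_initial[OF sol semigroup_0[OF gen]])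
  have weak: "AE \<omega> in M. inner (y t \<omega>) z = inner (T t (y0 \<omega>)) z * exp ((\<beta>0 - \<beta>1\<^sup>2 / 2) * t + \<beta>1 * W t \<omega>)" for z
  proof -
    define v where "v r \<omega> = inner (T (t - r) (y r \<omega>)) z" for r \<omega>
    \<comment> \<open>The scalar lemma wants \<open>Y 0\<close> to vanish everywhere, whereas
      \<open>X 0\<close> is 0 only almost surely.\<close>
    define Y where "Y s \<omega> = (if s = 0 then 0 else inner (T (t - s) (X s \<omega>)) z)" for s \<omega>
    have L: "bounded_linear (\<lambda>x. inner (T (t - s) x) z)" if "s \<in> {0..t}" for s
      using that by (intro bounded_linear_compose[OF bounded_linear_inner_left semigroup_linear[OF gen]]) auto
    have TT: "T (t - s) (T (s - r) x) = T (t - r) x" if "r \<le> s" "s \<le> t" for r s x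
      using semigroup_add[OF gen, of "t - s" "s - r" x] that by simp
    have "AE \<omega> in M. v t \<omega> = v 0 \<omega> * exp ((\<beta>0 - \<beta>1\<^sup>2 / 2) * t + \<beta>1 * W t \<omega>)"
    proof (rule scalar_linear_sde[OF t0, where Y=Y])
      show "v r \<in> borel_measurable (F r)" if "r \<in> {0..t}" for r
        unfolding v_def[abs_def] using that
        by (intro measurable_compose[OF yad borel_measurable_continuous_onI[OF linear_continuous_on[OF L]]]) auto
      show "AE \<omega> in M. continuous_on {0..t} (\<lambda>r. v r \<omega>)"
        using ycont
      proof eventually_elim
        case (elim \<omega>)
        then have "continuous_on {0..t} (\<lambda>r. y r \<omega>)" by (rule continuous_on_subset) auto
        then show ?case unfolding v_def by (intro continuous_intros semigroup_path_continuous[OF gen decay])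
      qed
      show "Y 0 \<omega> = 0" for \<omega> by (simp add: Y_def)
      fix s assume s: "s \<in> {0<..t}"
      then have s': "0 \<le> s" "s \<le> t" "s \<in> {0..t}" by auto
      note Ls = L[OF s'(3)]
      have Ys: "Y s = (\<lambda>\<omega>. inner (T (t - s) (X s \<omega>)) z)" using s by (auto simp: Y_def)
      have Tsc: "T (t - s) (T (s - r) (b *\<^sub>R x)) = b *\<^sub>R T (t - r) x" if "r \<in> {0..s}" for r b x
        using TT[of r s "b *\<^sub>R x"] that s' linear_scale[OF bounded_linear.linear[OF semigroup_linear[OF gen, of "t - r"]]] by simp
      show "is_ito_integral M W 0 s (\<lambda>r \<omega>. \<beta>1 * v r \<omega>) (Y s)"
        unfolding Ys by (rule ito_integral_bounded_linear[OF Ls X(1)[OF s'(1)]]) (simp add: Tsc v_def)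
      show "AE \<omega> in M. v s \<omega> = v 0 \<omega> + \<beta>0 * (LBINT r:{0..s}. v r \<omega>) + Y s \<omega>"
        using X(2)[OF s'(1)] ycont yinit
      proof eventually_elim
        case (elim \<omega>)
        have "continuous_on {0..s} (\<lambda>r. T (s - r) (\<beta>0 *\<^sub>R y r \<omega>))"
          by (intro semigroup_path_continuous[OF gen decay] continuous_intros continuous_on_subset[OF elim(2)]) auto
        then have int: "set_integrable lborel {0..s} (\<lambda>r. T (s - r) (\<beta>0 *\<^sub>R y r \<omega>))"
          unfolding set_integrable_def by (intro borel_integrable_compact) auto
        have "inner (T (t - s) (set_lebesgue_integral lborel {0..s} (\<lambda>r. T (s - r) (\<beta>0 *\<^sub>R y r \<omega>)))) z
          = (\<integral>r. inner (T (t - s) (indicator {0..s} r *\<^sub>R T (s - r) (\<beta>0 *\<^sub>R y r \<omega>))) z \<partial>lborel)"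
          using int unfolding set_lebesgue_integral_def set_integrable_def
          by (intro integral_bounded_linear[OF Ls, symmetric])
        also have "\<dots> = (\<integral>r. \<beta>0 * (indicator {0..s} r *\<^sub>R v r \<omega>) \<partial>lborel)"
        proof (intro Bochner_Integration.integral_cong refl)
          fix r
          show "inner (T (t - s) (indicator {0..s} r *\<^sub>R T (s - r) (\<beta>0 *\<^sub>R y r \<omega>))) z = \<beta>0 * (indicator {0..s} r *\<^sub>R v r \<omega>)"
            using linear_0[OF bounded_linear.linear[OF Ls]] by (cases "r \<in> {0..s}") (auto simp: Tsc v_def)
        qed
        also have "\<dots> = \<beta>0 * (LBINT r:{0..s}. v r \<omega>)" by (simp add: set_lebesgue_integral_def)
        finally have I: "inner (T (t - s) (set_lebesgue_integral lborel {0..s} (\<lambda>r. T (s - r) (\<beta>0 *\<^sub>R y r \<omega>)))) z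
          = \<beta>0 * (LBINT r:{0..s}. v r \<omega>)" .
        have "v s \<omega> = inner (T (t - s) (T s (y0 \<omega>) + set_lebesgue_integral lborel {0..s} (\<lambda>r. T (s - r) (\<beta>0 *\<^sub>R y r \<omega>)) + X s \<omega>)) z"
          unfolding v_def by (subst elim(1)) simp
        also have "\<dots> = inner (T (t - s) (T s (y0 \<omega>))) z + \<beta>0 * (LBINT r:{0..s}. v r \<omega>) + Y s \<omega>"
          unfolding I[symmetric] Ys
          using linear_add[OF bounded_linear.linear[OF Ls]] by simp
        also have "inner (T (t - s) (T s (y0 \<omega>))) z = v 0 \<omega>"
          using TT[of 0 s "y0 \<omega>"] s' elim(3) by (simp add: v_def)
        finally show ?case .
      qed
    qed
    then show ?thesis using yinit
      by eventually_elim (simp add: v_def semigroup_0[OF gen])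
  qed
  obtain S :: "'h set" where S: "countable S" "UNIV \<subseteq> closure S"
    using separable[of "UNIV :: 'h set"] by metis
  have "AE \<omega> in M. \<forall>z\<in>S. inner (y t \<omega>) z = inner (T t (y0 \<omega>)) z * exp ((\<beta>0 - \<beta>1\<^sup>2 / 2) * t + \<beta>1 * W t \<omega>)"
    using S(1) weak by (subst AE_ball_countable) auto
  then show ?thesis
  proof eventually_elim
    case (elim \<omega>)
    \<comment> \<open>Orthogonal to a dense set, hence to itself.\<close>
    define w where "w = y t \<omega> - exp ((\<beta>0 - \<beta>1\<^sup>2 / 2) * t + \<beta>1 * W t \<omega>) *\<^sub>R T t (y0 \<omega>)"
    have "closed {z. inner w z = 0}" by (intro closed_Collect_eq continuous_intros)
    moreover have "S \<subseteq> {z. inner w z = 0}" using elim by (auto simp: w_def inner_diff_left)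
    ultimately have "closure S \<subseteq> {z. inner w z = 0}" by (intro closure_minimal)
    then have "inner w w = 0" using S(2) by blast
    then show ?case by (simp add: w_def)
  qed
qed

end

theorem theorem6:
  fixes M :: "'w measure" and W :: "real \<Rightarrow> 'w \<Rightarrow> real"
    and D :: "'h::{real_inner,banach,second_countable_topology} set"
    and A :: "'h \<Rightarrow> 'h" and T :: "real \<Rightarrow> 'h \<Rightarrow> 'h"
    and \<beta>0 \<beta>1 p :: real and y0 :: "'w \<Rightarrow> 'h" and y :: "real \<Rightarrow> 'w \<Rightarrow> 'h"
  assumes "prob_space M" and "complete_measure M"
    and "std_brownian_motion M W"
    and "self_adjoint_op D A" and "positive_definite_op D A" and "compact_resolvent D A"
    and "generates_C0_semigroup T D (\<lambda>x. - A x)"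
    and "p \<ge> 1"
    and "\<beta>1\<^sup>2 > 2 * (\<beta>0 - principal_eigenvalue D A)"
    and "y0 \<in> borel_measurable (nat_filt M W 0)"
    and "integrable M (\<lambda>\<omega>. norm (y0 \<omega>) powr p)"
    and "AE \<omega> in M. y0 \<omega> \<noteq> 0"
    and "mild_solution M W T \<beta>0 \<beta>1 y0 y"
  shows "p / 2 * \<beta>1\<^sup>2 + p * (principal_eigenvalue D A - \<beta>0) > 0 \<and>
    (\<exists>\<xi> :: 'w \<Rightarrow> real. \<xi> \<in> borel_measurable M \<and>
      (AE \<omega> in M. \<forall>t\<ge>0. norm (y t \<omega>) powr p
         \<le> \<xi> \<omega> * exp (- ((p / 2 * \<beta>1\<^sup>2 + p * (principal_eigenvalue D A - \<beta>0)) / 2) * t)))"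
proof -
  interpret prob_space M by fact
  interpret brownian M W by unfold_locales fact
  define \<mu> where "\<mu> = p / 2 * \<beta>1\<^sup>2 + p * (principal_eigenvalue D A - \<beta>0)"
  let ?l = "principal_eigenvalue D A"
  \<comment> \<open>Exhibits \<mu> as \<open>p / 2\<close> times the gap in the assumption on
    \<open>\<beta>1\<^sup>2\<close>.\<close>
  have "\<mu> = p * ((\<beta>1\<^sup>2 - 2 * (\<beta>0 - ?l)) / 2)" by (simp add: \<mu>_def algebra_simps)
  moreover have "0 < (\<beta>1\<^sup>2 - 2 * (\<beta>0 - ?l)) / 2" using assms(9) by simp
  ultimately have \<mu>: "\<mu> > 0" using assms(8) by (metis mult_pos_pos less_le_trans zero_less_one)
  note gen = assms(7) and sol = assms(13)
  have dense: "closure D = UNIV" using assms(4) by (simp add: self_adjoint_op_def)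
  have decay: "norm (T s x) \<le> exp (- ?l * s) * norm x" if "0 \<le> s" for s x
    by (rule semigroup_exponential_decay[OF gen dense principal_eigenvalue_le[OF assms(5)] that])
  obtain S :: "real set" where S: "countable S" "S \<subseteq> {0..}" "{0..} \<subseteq> closure S"
    using separable[of "{0::real..}"] by metis
  \<comment> \<open>The random constant is the supremum of the rescaled path over countably many
    dense times, which makes it measurable. \<open>enn2real\<close> sets it to 0 where the supremum
    is infinite, and that happens on a null event only.\<close>
  define f where "f t \<omega> = norm (y t \<omega>) powr p * exp (\<mu> / 2 * t)" for t \<omega>
  define \<xi> where "\<xi> \<omega> = enn2real (SUP t\<in>S. ennreal (f t \<omega>))" for \<omega>
  have fM: "f t \<in> borel_measurable M" if "t \<in> S" for t
  proof -
    have "0 \<le> t" using that S(2) by auto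
    then have [measurable]: "y t \<in> borel_measurable M"
      using sol measurable_F unfolding mild_solution_def by blast
    show ?thesis unfolding f_def[abs_def] by measurable
  qed
  have "(\<lambda>\<omega>. SUP t\<in>S. ennreal (f t \<omega>)) \<in> borel_measurable M"
    using fM by (intro borel_measurable_SUP[OF S(1)]) auto
  then have \<xi>M: "\<xi> \<in> borel_measurable M" unfolding \<xi>_def[abs_def] by simp
  have expl: "AE \<omega> in M. \<forall>t\<in>S. y t \<omega> = exp ((\<beta>0 - \<beta>1\<^sup>2 / 2) * t + \<beta>1 * W t \<omega>) *\<^sub>R T t (y0 \<omega>)"
    using S(1,2) mild_solution_explicit[OF gen decay sol] by (subst AE_ball_countable) auto
  have "AE \<omega> in M. continuous_on {0..} (\<lambda>t. y t \<omega>)" using sol unfolding mild_solution_def by blast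
  moreover have "AE \<omega> in M. \<exists>C. \<forall>t\<ge>0. (p * \<beta>1) * W t \<omega> \<le> C + \<mu> / 2 * t"
    using \<mu> by (intro brownian_sublinear_growth) simp
  ultimately have "AE \<omega> in M. \<forall>t\<ge>0. norm (y t \<omega>) powr p \<le> \<xi> \<omega> * exp (- (\<mu> / 2) * t)"
    using expl
  proof eventually_elim
    case (elim \<omega>)
    then obtain C where C: "\<And>t. 0 \<le> t \<Longrightarrow> (p * \<beta>1) * W t \<omega> \<le> C + \<mu> / 2 * t" by blast
    have bound: "f t \<omega> \<le> norm (y0 \<omega>) powr p * exp C" if t: "t \<in> S" for t
    proof -
      have t0: "0 \<le> t" using t S(2) by auto
      define e where "e = (\<beta>0 - \<beta>1\<^sup>2 / 2) * t + \<beta>1 * W t \<omega> + - ?l * t"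
      have "norm (y t \<omega>) = exp ((\<beta>0 - \<beta>1\<^sup>2 / 2) * t + \<beta>1 * W t \<omega>) * norm (T t (y0 \<omega>))"
        using elim(3) t by simp
      also have "\<dots> \<le> exp ((\<beta>0 - \<beta>1\<^sup>2 / 2) * t + \<beta>1 * W t \<omega>) * (exp (- ?l * t) * norm (y0 \<omega>))"
        using decay[OF t0] by (intro mult_left_mono) auto
      also have "\<dots> = exp e * norm (y0 \<omega>)" by (simp only: e_def exp_add mult.assoc)
      finally have "norm (y t \<omega>) powr p \<le> (exp e * norm (y0 \<omega>)) powr p"
        using assms(8) by (intro powr_mono2) auto
      also have "\<dots> = exp (p * e) * norm (y0 \<omega>) powr p"
        by (simp add: powr_mult exp_powr_real mult.commute)
      finally have "f t \<omega> \<le> exp (p * e) * norm (y0 \<omega>) powr p * exp (\<mu> / 2 * t)"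
        unfolding f_def by (intro mult_right_mono) auto
      also have "\<dots> = norm (y0 \<omega>) powr p * exp (p * e + \<mu> / 2 * t)" by (simp add: exp_add)
      \<comment> \<open>Drift and coercivity contribute
        \<open>p * (\<beta>0 - \<beta>1\<^sup>2 / 2 - ?l) = - \<mu>\<close> per unit time, so the
        weight \<open>exp (\<mu> / 2 * t)\<close> in \<open>f\<close> leaves
        \<open>- \<mu> / 2\<close>, just what the growth bound for the noise compensates.\<close>
      also have "p * e + \<mu> / 2 * t = (p * \<beta>1) * W t \<omega> - \<mu> / 2 * t"
        by (simp add: e_def \<mu>_def field_simps)
      also have "norm (y0 \<omega>) powr p * exp ((p * \<beta>1) * W t \<omega> - \<mu> / 2 * t) \<le> norm (y0 \<omega>) powr p * exp C"
        using C[OF t0] by (intro mult_left_mono) auto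
      finally show ?thesis .
    qed
    then have "(SUP t\<in>S. ennreal (f t \<omega>)) \<le> ennreal (norm (y0 \<omega>) powr p * exp C)"
      by (intro SUP_least ennreal_leI)
    then have fin: "(SUP t\<in>S. ennreal (f t \<omega>)) < top" by (rule order_le_less_trans) simp
    have le: "f t \<omega> \<le> \<xi> \<omega>" if "t \<in> S" for t
    proof -
      have "ennreal (f t \<omega>) \<le> (SUP t\<in>S. ennreal (f t \<omega>))" using that by (intro SUP_upper)
      then have "enn2real (ennreal (f t \<omega>)) \<le> \<xi> \<omega>" unfolding \<xi>_def using fin by (intro enn2real_mono)
      then show ?thesis by (simp add: f_def)
    qed
    show ?case
    proof (intro allI impI)
      fix t :: real assume t: "0 \<le> t"
      obtain r where r: "\<And>k. r k \<in> S" "r \<longlonglongrightarrow> t" using t S(3) closure_sequential by (metis atLeast_iff subsetD)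
      \<comment> \<open>Dense times suffice because the path of \<open>y\<close> itself is
        continuous; the explicit formula is not evaluated at \<open>t\<close>.\<close>
      have "(\<lambda>k. y (r k) \<omega>) \<longlonglongrightarrow> y t \<omega>"
        using elim(1) t r S(2) by (auto simp: continuous_on_sequentially o_def subset_iff)
      then have "(\<lambda>k. f (r k) \<omega>) \<longlonglongrightarrow> f t \<omega>"
        unfolding f_def using assms(8) r(2) by (intro tendsto_intros tendsto_powr') auto
      then have "f t \<omega> \<le> \<xi> \<omega>" using le r(1) by (intro LIMSEQ_le_const2) auto
      then show "norm (y t \<omega>) powr p \<le> \<xi> \<omega> * exp (- (\<mu> / 2) * t)"
        by (simp add: f_def exp_minus field_simps)
    qed
  qed
  with \<mu> \<xi>M show ?thesis unfolding \<mu>_def by blast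
qed

end
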